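(* Let $f:\mathbb{R}^d\to\mathbb{R}$ satisfy $f\in C^2(\mathbb{R}^d)$ and $\inf f>-\infty$. Let $\gamma\in C^1(\mathbb{R}_+;\mathbb{R}_+)$ satisfy $c\le\gamma(t)\le C$ for all $t\ge0$, for some constants $0<c\le C$, and let $0<\beta<\frac{2c}{C^2}$. Consider, for initial data $x_0,v_0\in\mathbb{R}^d$, the system $$\ddot x(t)+\gamma(t)\dot x(t)+\beta\nabla^2 f(x(t))\dot x(t)+\nabla f(x(t))=0,\ t>0,\qquad x(0)=x_0,\ \dot x(0)=v_0. \tag{ISEHD}$$ Then: (i) there exists a global solution $x\in C^2(\mathbb{R}_+;\mathbb{R}^d)$ of (ISEHD); (ii) $\nabla f\circ x\in L^2(\mathbb{R}_+;\mathbb{R}^d)$ and $\dot x\in L^2(\mathbb{R}_+;\mathbb{R}^d)$; (iii) if $x$ is bounded on $\mathbb{R}_+$, then $\lim_{t\to+\infty}\|\nabla f(x(t))\|=\lim_{t\to+\infty}\|\dot x(t)\|=0$ and $\lim_{t\to+\infty}f(x(t))$ exists; (iv) if in addition to (iii) $f$ is definable, then $\dot x\in L^1(\mathbb{R}_+;\mathbb{R}^d)$ and $x(t)$ converges as $t\to+\infty$ to a critical point of $f$.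
   Context: $\mathbb{R}_+=[0,+\infty[$. A function is called definable if it is definable in some o-minimal structure over $\mathbb{R}$ (e.g. semialgebraic functions). A critical point of $f$ is a point $u$ with $\nabla f(u)=0$. *)

theory Defs
  imports "HOL-Analysis.Analysis"
begin

text \<open>Points of R^n are represented as real lists of length n.
  Polynomial functions R^n -> R: generated by constants, coordinate
  projections (i < n), sums and products.\<close>

inductive poly_fun :: "nat \<Rightarrow> (real list \<Rightarrow> real) \<Rightarrow> bool" for n :: nat where
  const: "poly_fun n (\<lambda>_. c)"
| proj: "i < n \<Longrightarrow> poly_fun n (\<lambda>xs. xs ! i)"
| add: "poly_fun n p \<Longrightarrow> poly_fun n q \<Longrightarrow> poly_fun n (\<lambda>xs. p xs + q xs)"
| mult: "poly_fun n p \<Longrightarrow> poly_fun n q \<Longrightarrow> poly_fun n (\<lambda>xs. p xs * q xs)"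

definition real_space :: "nat \<Rightarrow> real list set" where
  "real_space n = {xs. length xs = n}"

definition algebraic_set :: "nat \<Rightarrow> real list set \<Rightarrow> bool" where
  "algebraic_set n A \<longleftrightarrow> (\<exists>p. poly_fun n p \<and> A = {xs \<in> real_space n. p xs = 0})"

definition basic_interval :: "real set \<Rightarrow> bool" where
  "basic_interval I \<longleftrightarrow> (\<exists>a. I = {a}) \<or> (\<exists>a b. I = {a<..<b}) \<or> (\<exists>a. I = {a<..})
     \<or> (\<exists>b. I = {..<b}) \<or> I = UNIV"

definition finite_union_intervals :: "real set \<Rightarrow> bool" where
  "finite_union_intervals A \<longleftrightarrow> (\<exists>F. finite F \<and> (\<forall>I\<in>F. basic_interval I) \<and> A = \<Union>F)"

text \<open>An o-minimal structure on (R,+,*) (van den Dries / Coste):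
  a sequence S_n of Boolean algebras of subsets of R^n, closed under
  cartesian product with R (on both sides) and under the projection
  R^(n+1) -> R^n, containing all algebraic subsets, and such that S_1
  consists exactly of the finite unions of points and intervals.\<close>
definition o_minimal_structure :: "(nat \<Rightarrow> real list set set) \<Rightarrow> bool" where
  "o_minimal_structure S \<longleftrightarrow>
     (\<forall>n. S n \<subseteq> Pow (real_space n)
        \<and> {} \<in> S n
        \<and> (\<forall>A\<in>S n. real_space n - A \<in> S n)
        \<and> (\<forall>A\<in>S n. \<forall>B\<in>S n. A \<union> B \<in> S n)
        \<and> (\<forall>A\<in>S n. {xs @ [r] |xs r. xs \<in> A} \<in> S (Suc n))
        \<and> (\<forall>A\<in>S n. {r # xs |xs r. xs \<in> A} \<in> S (Suc n))
        \<and> (\<forall>A\<in>S (Suc n). take n ` A \<in> S n)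
        \<and> (\<forall>A. algebraic_set n A \<longrightarrow> A \<in> S n))
   \<and> (\<forall>A\<in>S 1. finite_union_intervals {r. [r] \<in> A})"

text \<open>A function f : E -> R on a Euclidean space is definable if, in
  some (equivalently: any) orthonormal coordinate system given by an
  enumeration of the basis, its graph belongs to some o-minimal structure.\<close>
definition definable_fun :: "('a::euclidean_space \<Rightarrow> real) \<Rightarrow> bool" where
  "definable_fun f \<longleftrightarrow> (\<exists>S bs. o_minimal_structure S \<and> distinct bs \<and> set bs = Basis
      \<and> {map (\<lambda>b. x \<bullet> b) bs @ [f x] |x. True} \<in> S (Suc (length bs)))"

definition isehd_solution ::
  "('a::euclidean_space \<Rightarrow> 'a) \<Rightarrow> ('a \<Rightarrow> 'a \<Rightarrow>\<^sub>L 'a) \<Rightarrow> (real \<Rightarrow> real) \<Rightarrow> real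
    \<Rightarrow> 'a \<Rightarrow> 'a \<Rightarrow> (real \<Rightarrow> 'a) \<Rightarrow> (real \<Rightarrow> 'a) \<Rightarrow> (real \<Rightarrow> 'a) \<Rightarrow> bool" where
  "isehd_solution grad hess \<gamma> \<beta> x0 v0 x x' x'' \<longleftrightarrow>
     (\<forall>t\<ge>0. (x has_vector_derivative x' t) (at t within {0..})
           \<and> (x' has_vector_derivative x'' t) (at t within {0..}))
     \<and> continuous_on {0..} x''
     \<and> (\<forall>t>0. x'' t + \<gamma> t *\<^sub>R x' t + \<beta> *\<^sub>R blinfun_apply (hess (x t)) (x' t) + grad (x t) = 0)
     \<and> x 0 = x0 \<and> x' 0 = v0"

end

theory Submission
  imports Defs
begin

text \<open>
  With \<open>v = x' + \<beta> \<nabla>f(x)\<close> the equation becomes the first-order system \<open>x' = v - \<beta> \<nabla>f(x)\<close>,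
  \<open>v' = - \<gamma> x' - \<nabla>f(x)\<close>, in which only the locally Lipschitz field \<open>\<nabla>f\<close> occurs. The energy
  \<open>E = f(x) + |v|\<^sup>2/2\<close> satisfies \<open>E' \<le> - \<delta> (|x'|\<^sup>2 + |\<nabla>f(x)|\<^sup>2)\<close> because \<open>\<beta>\<gamma> < 2\<close>. This excludes
  blow-up, gives both \<open>L\<^sup>2\<close> bounds, and, for bounded trajectories, whose dissipation rate is
  Lipschitz, forces \<open>x'\<close> and \<open>\<nabla>f(x)\<close> to vanish at infinity.

  If \<open>f\<close> is definable, so is \<open>(y, w) \<mapsto> f(y) + w\<^sup>2/2\<close>, whose slope at \<open>(x, |v|)\<close> is at most a
  multiple of \<open>|x'| + |\<nabla>f(x)|\<close>. The Kurdyka-Lojasiewicz inequality for this function provides a bounded monotone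
  \<open>\<phi>\<close> such that \<open>\<phi>(E - E\<^sub>\<infinity>)\<close> decreases at least at a rate proportional to \<open>|x'|\<close>, whence finite
  length. Over the real numbers the inequality needs only the germ at \<open>0+\<close> of the monotonicity
  theorem, and no differentiability of definable functions.
\<close>

section \<open>Definable predicates and terms\<close>

text \<open>The obstacle in the definable case is that only the graph of \<open>f\<close> is given
  as definable. Every object of the Kurdyka-Lojasiewicz argument therefore has to be expressed by a
  first-order formula in the values of the function: a bound on the slope becomes an epsilon-delta
  statement on increments, and a point of minimal slope is selected by minimising its coordinates
  one after the other. As \<open>\<phi>\<close> is then known only to be continuous and monotone,
  the inequality is kept in the form of finite increments, with a second-order error governed by a
  Lipschitz constant \<open>L\<close> of the gradient. Along the trajectory this error is absorbed
  for short times, and a one-sided Dini argument replaces the chain rule. Global existence avoids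
  maximal intervals of existence: the energy bounds the displacement up to time \<open>t\<close> in
  advance, so the field can be cut off at a radius growing with \<open>t\<close>, and the same bound
  shows afterwards that the cutoff was never active.\<close>

locale o_minimal =
  fixes S :: "nat \<Rightarrow> real list set set"
  assumes om: "o_minimal_structure S"
begin

section \<open>Closure properties of the structure at the level of coordinates\<close>

lemma sub_space: "A \<in> S n \<Longrightarrow> x \<in> A \<Longrightarrow> length x = n"
  using om unfolding o_minimal_structure_def real_space_def by blast

lemma S_compl: "A \<in> S n \<Longrightarrow> {xs. length xs = n \<and> xs \<notin> A} \<in> S n"
proof -
  assume "A \<in> S n"
  then have "real_space n - A \<in> S n"
    using om unfolding o_minimal_structure_def by blast
  moreover have "real_space n - A = {xs. length xs = n \<and> xs \<notin> A}"
    by (auto simp: real_space_def)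
  ultimately show ?thesis by simp
qed

lemma S_un: "A \<in> S n \<Longrightarrow> B \<in> S n \<Longrightarrow> A \<union> B \<in> S n"
  using om unfolding o_minimal_structure_def by blast

lemma S_int:
  assumes "A \<in> S n" "B \<in> S n"
  shows "A \<inter> B \<in> S n"
proof -
  have "{xs. length xs = n \<and> xs \<notin> {xs. length xs = n \<and> xs \<notin> A} \<union> {xs. length xs = n \<and> xs \<notin> B}} \<in> S n"
    by (intro S_compl S_un assms)
  moreover have "{xs. length xs = n \<and> xs \<notin> {xs. length xs = n \<and> xs \<notin> A} \<union> {xs. length xs = n \<and> xs \<notin> B}} = A \<inter> B"
    using sub_space[OF assms(1)] by auto
  ultimately show ?thesis by simp
qed

lemma S_poly: "poly_fun n p \<Longrightarrow> {xs. length xs = n \<and> p xs = 0} \<in> S n"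
proof -
  assume "poly_fun n p"
  then have "algebraic_set n {xs. length xs = n \<and> p xs = 0}"
    unfolding algebraic_set_def real_space_def by auto
  then show ?thesis
    using om unfolding o_minimal_structure_def by blast
qed

lemma S_proj: "A \<in> S (n + m) \<Longrightarrow> take n ` A \<in> S n"
proof (induction m arbitrary: A)
  case 0
  then have "take n ` A = A"
    using sub_space[OF 0] by force
  then show ?case using 0 by simp
next
  case (Suc m)
  have "take (n + m) ` A \<in> S (n + m)"
    using om Suc.prems unfolding o_minimal_structure_def by simp
  from Suc.IH[OF this] show ?case
    by (simp add: image_image min_def)
qed

lemma S_cons: "A \<in> S m \<Longrightarrow> {xs. length xs = n + m \<and> drop n xs \<in> A} \<in> S (n + m)"
proof (induction n)
  case 0
  then have "{xs. length xs = 0 + m \<and> drop 0 xs \<in> A} = A"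
    using sub_space[OF 0] by auto
  then show ?case using 0 by simp
next
  case (Suc n)
  have "{r # xs |xs r. xs \<in> {xs. length xs = n + m \<and> drop n xs \<in> A}} \<in> S (Suc (n + m))"
    using om Suc.IH[OF Suc.prems] unfolding o_minimal_structure_def by blast
  moreover have "{r # xs |xs r. xs \<in> {xs. length xs = n + m \<and> drop n xs \<in> A}} =
    {xs. length xs = Suc n + m \<and> drop (Suc n) xs \<in> A}"
    by (auto simp: length_Suc_conv)
  ultimately show ?case by simp
qed

lemma S_coord_eq: "a < N \<Longrightarrow> b < N \<Longrightarrow> {xs. length xs = N \<and> xs ! a = xs ! b} \<in> S N"
  using S_poly[of N "\<lambda>xs. xs ! a + (- 1) * xs ! b", OF poly_fun.add[OF poly_fun.proj poly_fun.mult[OF poly_fun.const poly_fun.proj]]]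
  by simp

text \<open>An assignment \<open>(!) xs\<close> has unspecified values beyond the length of
  \<open>xs\<close>. Finite support makes these values irrelevant, so that a predicate on
  assignments can be tested on lists.\<close>

definition supported :: "nat \<Rightarrow> ((nat \<Rightarrow> real) \<Rightarrow> bool) \<Rightarrow> bool" where
  "supported n P \<longleftrightarrow> (\<forall>e e'. (\<forall>i<n. e i = e' i) \<longrightarrow> P e = P e')"

lemma supportedD: "supported n P \<Longrightarrow> (\<And>i. i < n \<Longrightarrow> e i = e' i) \<Longrightarrow> P e \<longleftrightarrow> P e'"
  unfolding supported_def by blast

text \<open>Formulas are predicates on assignments of all variables \<open>0, 1, 2, \<dots>\<close>, of which only finitely
  many may matter; a quantifier binds variable 0 and shifts the others.\<close>
definition definable_pred :: "((nat \<Rightarrow> real) \<Rightarrow> bool) \<Rightarrow> bool" where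
  "definable_pred P \<longleftrightarrow> (\<exists>n. supported n P \<and> {xs. length xs = n \<and> P ((!) xs)} \<in> S n)"

text \<open>Permuting, identifying and adding variables all reduce to this one fact. The renaming is
  a linear set in \<open>n + m\<close> coordinates, cut out by the equations
  \<open>zs ! (n + i) = zs ! \<sigma> i\<close>; it is intersected with the cylinder over the given
  set, and the last \<open>m\<close> coordinates are projected away.\<close>

lemma S_reindex:
  assumes sup: "supported m P" and A: "{xs. length xs = m \<and> P ((!) xs)} \<in> S m"
    and \<sigma>: "\<And>i. i < m \<Longrightarrow> \<sigma> i < n"
  shows "{xs. length xs = n \<and> P (\<lambda>i. xs ! \<sigma> i)} \<in> S n"
proof -
  let ?A = "{xs. length xs = m \<and> P ((!) xs)}"
  have eqs: "j \<le> m \<Longrightarrow> {zs. length zs = n + m \<and> (\<forall>i<j. zs ! (n + i) = zs ! \<sigma> i)} \<in> S (n + m)" for j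
  proof (induction j)
    case 0
    show ?case using S_poly[OF poly_fun.const[of "n + m" 0]] by simp
  next
    case (Suc j)
    have "{zs. length zs = n + m \<and> (\<forall>i<j. zs ! (n + i) = zs ! \<sigma> i)} \<inter>
        {zs. length zs = n + m \<and> zs ! (n + j) = zs ! \<sigma> j} \<in> S (n + m)"
      using Suc \<sigma>[of j] by (intro S_int S_coord_eq) auto
    moreover have "{zs :: real list. length zs = n + m \<and> (\<forall>i<j. zs ! (n + i) = zs ! \<sigma> i)} \<inter>
        {zs. length zs = n + m \<and> zs ! (n + j) = zs ! \<sigma> j} =
        {zs. length zs = n + m \<and> (\<forall>i<Suc j. zs ! (n + i) = zs ! \<sigma> i)}"
      by (auto simp: less_Suc_eq)
    ultimately show ?case by (simp only:)
  qed
  let ?B = "{zs. length zs = n + m \<and> drop n zs \<in> ?A} \<inter>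
      {zs. length zs = n + m \<and> (\<forall>i<m. zs ! (n + i) = zs ! \<sigma> i)}"
  have B: "take n ` ?B \<in> S n"
    by (intro S_proj[of _ n m] S_int S_cons A eqs) simp
  have "take n ` ?B = {xs. length xs = n \<and> P (\<lambda>i. xs ! \<sigma> i)}" (is "_ = ?C")
  proof
    show "take n ` ?B \<subseteq> ?C"
    proof
      fix ys assume "ys \<in> take n ` ?B"
      then obtain zs where zs: "zs \<in> ?B" "ys = take n zs" by blast
      have "P ((!) (drop n zs))" using zs by simp
      moreover have "P ((!) (drop n zs)) \<longleftrightarrow> P (\<lambda>i. ys ! \<sigma> i)"
        by (rule supportedD[OF sup]) (use zs \<sigma> in auto)
      ultimately show "ys \<in> ?C" using zs by simp
    qed
    show "?C \<subseteq> take n ` ?B"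
    proof
      fix xs assume xs: "xs \<in> ?C"
      let ?zs = "xs @ map (\<lambda>i. xs ! \<sigma> i) [0..<m]"
      have "P (\<lambda>i. xs ! \<sigma> i) \<longleftrightarrow> P ((!) (map (\<lambda>i. xs ! \<sigma> i) [0..<m]))"
        by (rule supportedD[OF sup]) simp
      then have "?zs \<in> ?B" using xs \<sigma> by (auto simp: nth_append)
      moreover have "xs = take n ?zs" using xs by simp
      ultimately show "xs \<in> take n ` ?B" by blast
    qed
  qed
  with B show ?thesis by simp
qed

lemma definable_reindex:
  assumes "definable_pred P"
  shows "definable_pred (\<lambda>e. P (\<lambda>i. e (\<sigma> i)))"
proof -
  obtain m where m: "supported m P" "{xs. length xs = m \<and> P ((!) xs)} \<in> S m"
    using assms unfolding definable_pred_def by blast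
  \<comment> \<open>Inserting 0 keeps the set nonempty, so that \<open>Max\<close> is meaningful
    also for \<open>m = 0\<close>.\<close>
  define n where "n = Suc (Max (insert 0 (\<sigma> ` {..<m})))"
  have \<sigma>: "\<sigma> i < n" if "i < m" for i
    unfolding n_def using that by (auto simp: less_Suc_eq_le intro!: Max_ge)
  have "supported n (\<lambda>e. P (\<lambda>i. e (\<sigma> i)))"
    unfolding supported_def by (auto intro!: supportedD[OF m(1)] \<sigma>)
  moreover have "{xs. length xs = n \<and> P (\<lambda>i. xs ! \<sigma> i)} \<in> S n"
    by (rule S_reindex[OF m]) (rule \<sigma>)
  ultimately show ?thesis unfolding definable_pred_def by blast
qed

text \<open>Two formulas can be combined only inside one common \<open>S N\<close>; every
  sufficiently large arity serves.\<close>

lemma definable_level: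
  assumes "definable_pred P"
  shows "\<exists>n. \<forall>N\<ge>n. supported N P \<and> {xs. length xs = N \<and> P ((!) xs)} \<in> S N"
proof -
  obtain m where m: "supported m P" "{xs. length xs = m \<and> P ((!) xs)} \<in> S m"
    using assms unfolding definable_pred_def by blast
  show ?thesis
  proof (intro exI[of _ m] allI impI conjI)
    fix N assume "m \<le> N"
    then show "{xs. length xs = N \<and> P ((!) xs)} \<in> S N"
      using S_reindex[OF m, of "\<lambda>i. i" N] by simp
    show "supported N P"
      using m(1) \<open>m \<le> N\<close> unfolding supported_def by (meson order_less_le_trans)
  qed
qed

section \<open>Closure of definable predicates under connectives and quantifiers\<close>

lemma definable_not: "definable_pred P \<Longrightarrow> definable_pred (\<lambda>e. \<not> P e)"
proof -
  assume "definable_pred P"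
  then obtain m where m: "supported m P" "{xs. length xs = m \<and> P ((!) xs)} \<in> S m"
    unfolding definable_pred_def by blast
  have "supported m (\<lambda>e. \<not> P e)" using m(1) unfolding supported_def by blast
  moreover have "{xs. length xs = m \<and> \<not> P ((!) xs)} \<in> S m"
    using S_compl[OF m(2)] by (simp add: conj_disj_distribL cong: conj_cong)
  ultimately show ?thesis unfolding definable_pred_def by blast
qed

lemma definable_conj: "definable_pred P \<Longrightarrow> definable_pred Q \<Longrightarrow> definable_pred (\<lambda>e. P e \<and> Q e)"
proof -
  assume "definable_pred P" "definable_pred Q"
  obtain m where m: "\<forall>N\<ge>m. supported N P \<and> {xs. length xs = N \<and> P ((!) xs)} \<in> S N"
    using definable_level[OF \<open>definable_pred P\<close>] by blast
  obtain n where n: "\<forall>N\<ge>n. supported N Q \<and> {xs. length xs = N \<and> Q ((!) xs)} \<in> S N"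
    using definable_level[OF \<open>definable_pred Q\<close>] by blast
  define N where "N = max m n"
  have P: "supported N P" "{xs. length xs = N \<and> P ((!) xs)} \<in> S N"
    using m unfolding N_def by auto
  have Q: "supported N Q" "{xs. length xs = N \<and> Q ((!) xs)} \<in> S N"
    using n unfolding N_def by auto
  have "supported N (\<lambda>e. P e \<and> Q e)"
    using P(1) Q(1) unfolding supported_def by blast
  moreover have "{xs. length xs = N \<and> P ((!) xs) \<and> Q ((!) xs)} =
      {xs. length xs = N \<and> P ((!) xs)} \<inter> {xs. length xs = N \<and> Q ((!) xs)}" by blast
  ultimately show ?thesis unfolding definable_pred_def using S_int[OF P(2) Q(2)] by auto
qed

lemma definable_disj: "definable_pred P \<Longrightarrow> definable_pred Q \<Longrightarrow> definable_pred (\<lambda>e. P e \<or> Q e)"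
  using definable_not[OF definable_conj[OF definable_not definable_not], of P Q] by simp

lemma definable_imp: "definable_pred P \<Longrightarrow> definable_pred Q \<Longrightarrow> definable_pred (\<lambda>e. P e \<longrightarrow> Q e)"
  unfolding imp_conv_disj by (rule definable_disj[OF definable_not])

lemma definable_ex:
  assumes "definable_pred (\<lambda>e. P (e 0) (\<lambda>i. e (Suc i)))"
  shows "definable_pred (\<lambda>e. \<exists>v. P v e)"
proof -
  let ?R = "\<lambda>e. P (e 0) (\<lambda>i. e (Suc i))"
  obtain m where m: "\<forall>N\<ge>m. supported N ?R \<and> {xs. length xs = N \<and> ?R ((!) xs)} \<in> S N"
    using definable_level[OF assms] by blast
  have supR: "supported (Suc m) ?R" and R: "{xs. length xs = Suc m \<and> ?R ((!) xs)} \<in> S (Suc m)"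
    using m[rule_format, of "Suc m"] by auto
  have sup: "supported m (P v)" for v
    unfolding supported_def
  proof (intro allI impI)
    fix e e' :: "nat \<Rightarrow> real" assume "\<forall>i<m. e i = e' i"
    then have "?R (case_nat v e) \<longleftrightarrow> ?R (case_nat v e')"
      by (intro supportedD[OF supR]) (auto split: nat.splits)
    then show "P v e = P v e'" by simp
  qed
  \<comment> \<open>Projection removes the last coordinate, whereas the quantifier binds variable 0.
    The renaming \<open>case_nat m (\<lambda>i. i)\<close> reads variable 0 from position
    \<open>m\<close> and shifts the others down.\<close>
  have "{xs. length xs = Suc m \<and> P (xs ! m) ((!) xs)} \<in> S (Suc m)"
    using S_reindex[OF supR R, of "case_nat m (\<lambda>i. i)" "Suc m"]
    by (auto split: nat.splits)
  then have "take m ` {xs. length xs = Suc m \<and> P (xs ! m) ((!) xs)} \<in> S m"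
    using S_proj[of _ m 1] by simp
  moreover have "take m ` {xs. length xs = Suc m \<and> P (xs ! m) ((!) xs)} =
     {xs. length xs = m \<and> (\<exists>v. P v ((!) xs))}" (is "_ ` ?A = ?B")
  proof
    show "take m ` ?A \<subseteq> ?B"
    proof
      fix ys assume "ys \<in> take m ` ?A"
      then obtain zs where zs: "length zs = Suc m" "P (zs ! m) ((!) zs)" "ys = take m zs" by blast
      have "P (zs ! m) ((!) zs) \<longleftrightarrow> P (zs ! m) ((!) ys)"
        by (rule supportedD[OF sup]) (simp add: zs)
      then show "ys \<in> ?B" using zs by auto
    qed
    show "?B \<subseteq> take m ` ?A"
    proof
      fix xs assume "xs \<in> ?B"
      then obtain v where v: "length xs = m" "P v ((!) xs)" by blast
      have "P v ((!) xs) \<longleftrightarrow> P v ((!) (xs @ [v]))"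
        by (rule supportedD[OF sup]) (simp add: v nth_append)
      then have "xs @ [v] \<in> ?A" using v by (auto simp: nth_append)
      moreover have "xs = take m (xs @ [v])" using v by simp
      ultimately show "xs \<in> take m ` ?A" by blast
    qed
  qed
  moreover have "supported m (\<lambda>e. \<exists>v. P v e)"
    using sup unfolding supported_def by blast
  ultimately show ?thesis unfolding definable_pred_def by auto
qed

lemma definable_all:
  assumes "definable_pred (\<lambda>e. P (e 0) (\<lambda>i. e (Suc i)))"
  shows "definable_pred (\<lambda>e. \<forall>v. P v e)"
  using definable_not[OF definable_ex[OF definable_not[OF assms]]] by simp

lemma definable_finite_all: "finite I \<Longrightarrow> (\<And>i. i \<in> I \<Longrightarrow> definable_pred (P i)) \<Longrightarrow> definable_pred (\<lambda>e. \<forall>i\<in>I. P i e)"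
proof (induction I rule: finite_induct)
  case empty
  have "definable_pred (\<lambda>e. True)"
    unfolding definable_pred_def using S_poly[OF poly_fun.const[of 0 0]]
    by (auto simp: supported_def intro!: exI[of _ 0])
  then show ?case by simp
next
  case (insert i I)
  then have "definable_pred (\<lambda>e. P i e \<and> (\<forall>i\<in>I. P i e))" by (intro definable_conj) auto
  then show ?case by simp
qed

lemma definable_poly:
  assumes "poly_fun n p" "\<And>xs. length xs = n \<Longrightarrow> p xs = q ((!) xs)"
    "\<And>e e'. (\<And>i. i < n \<Longrightarrow> e i = e' i) \<Longrightarrow> q e = q e'"
  shows "definable_pred (\<lambda>e. q e = 0)"
proof -
  have "{xs. length xs = n \<and> q ((!) xs) = 0} \<in> S n"
    using S_poly[OF assms(1)] assms(2) by (simp cong: conj_cong)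
  moreover have "supported n (\<lambda>e. q e = 0)"
    unfolding supported_def using assms(3) by metis
  ultimately show ?thesis unfolding definable_pred_def by blast
qed

section \<open>Definable terms and atomic formulas\<close>

text \<open>The graph of the term, with the value in the fresh variable 0.\<close>
definition definable_term :: "((nat \<Rightarrow> real) \<Rightarrow> real) \<Rightarrow> bool" where
  "definable_term h \<longleftrightarrow> definable_pred (\<lambda>e. e 0 = h (\<lambda>i. e (Suc i)))"

lemma term_subst2:
  assumes P: "definable_pred (\<lambda>e. P (e 0) (e (Suc 0)))" and "definable_term f" "definable_term g"
  shows "definable_pred (\<lambda>e. P (f e) (g e))"
proof -
  have "definable_pred (\<lambda>e. \<exists>u v. u = f e \<and> v = g e \<and> P u v)"
  proof (intro definable_ex definable_conj)
    show "definable_pred (\<lambda>e. e (Suc 0) = f (\<lambda>i. e (Suc (Suc i))))"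
      using definable_reindex[OF \<open>definable_term f\<close>[unfolded definable_term_def], of "\<lambda>i. Suc i"] by simp
    show "definable_pred (\<lambda>e. e 0 = g (\<lambda>i. e (Suc (Suc i))))"
      using definable_reindex[OF \<open>definable_term g\<close>[unfolded definable_term_def], of "case_nat 0 (\<lambda>i. Suc (Suc i))"] by simp
    \<comment> \<open>Here \<open>v\<close> is variable 0 and \<open>u\<close> is variable 1. The
      renaming \<open>1 - i\<close> exchanges them; truncated subtraction sends all other indices to
      0, but \<open>P\<close> reads none of these.\<close>
    show "definable_pred (\<lambda>e. P (e (Suc 0)) (e 0))"
      using definable_reindex[OF P, of "\<lambda>i. 1 - i"] by simp
  qed
  then show ?thesis by simp
qed

lemma term_reindex: "definable_term h \<Longrightarrow> definable_term (\<lambda>e. h (\<lambda>i. e (\<sigma> i)))"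
  unfolding definable_term_def using definable_reindex[of "\<lambda>e. e 0 = h (\<lambda>i. e (Suc i))" "case_nat 0 (\<lambda>i. Suc (\<sigma> i))"] by simp

lemma definable_eq01: "definable_pred (\<lambda>e. e 0 = e (Suc 0))"
proof -
  have "definable_pred (\<lambda>e. e 0 + (- 1) * e (Suc 0) = 0)"
    by (rule definable_poly[of 2 "\<lambda>xs. xs ! 0 + (-1) * xs ! Suc 0"], (intro poly_fun.intros; simp)) auto
  then show ?thesis by simp
qed

lemma term_var: "definable_term (\<lambda>e. e k)"
  unfolding definable_term_def using definable_reindex[OF definable_eq01, of "\<lambda>i. if i = 0 then 0 else Suc k"] by simp

lemma term_const: "definable_term (\<lambda>e. c)"
proof -
  have "definable_pred (\<lambda>e. e 0 + (- c) = 0)"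
    by (rule definable_poly[of 1 "\<lambda>xs. xs ! 0 + (-c)"], (intro poly_fun.intros; simp)) auto
  then show ?thesis unfolding definable_term_def by simp
qed

lemma definable_eq: "definable_term f \<Longrightarrow> definable_term g \<Longrightarrow> definable_pred (\<lambda>e. f e = g e)"
  by (rule term_subst2[OF definable_eq01])

lemma term_op:
  assumes P: "definable_pred (\<lambda>e. e 0 = F (e (Suc 0)) (e (Suc (Suc 0))))" and "definable_term f" "definable_term g"
  shows "definable_term (\<lambda>e. F (f e) (g e))"
proof -
  have "definable_pred (\<lambda>e. \<exists>u v. u = f (\<lambda>i. e (Suc i)) \<and> v = g (\<lambda>i. e (Suc i)) \<and> e 0 = F u v)"
  proof (intro definable_ex definable_conj)
    show "definable_pred (\<lambda>e. e (Suc 0) = f (\<lambda>i. e (Suc (Suc (Suc i)))))"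
      by (intro definable_eq term_var term_reindex[where \<sigma> = "\<lambda>i. Suc (Suc (Suc i))"] assms)
    show "definable_pred (\<lambda>e. e 0 = g (\<lambda>i. e (Suc (Suc (Suc i)))))"
      by (intro definable_eq term_var term_reindex[where \<sigma> = "\<lambda>i. Suc (Suc (Suc i))"] assms)
    show "definable_pred (\<lambda>e. e (Suc (Suc 0)) = F (e (Suc 0)) (e 0))"
      using definable_reindex[OF P, of "\<lambda>i. 2 - i"] by (simp add: numeral_2_eq_2)
  qed
  then show ?thesis unfolding definable_term_def by simp
qed

lemma term_add: "definable_term f \<Longrightarrow> definable_term g \<Longrightarrow> definable_term (\<lambda>e. f e + g e)"
proof (rule term_op[where F = "(+)"])
  have "definable_pred (\<lambda>e. e 0 + (- 1) * (e (Suc 0) + e (Suc (Suc 0))) = 0)"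
    by (rule definable_poly[of 3 "\<lambda>xs. xs ! 0 + (-1) * (xs ! Suc 0 + xs ! Suc (Suc 0))"], (intro poly_fun.intros; simp)) auto
  moreover have "(a + (- 1) * (b + c) = 0) \<longleftrightarrow> a = b + c" for a b c :: real by auto
  ultimately show "definable_pred (\<lambda>e. e 0 = e (Suc 0) + e (Suc (Suc 0)))"
    by (simp only:)
qed

lemma term_mult: "definable_term f \<Longrightarrow> definable_term g \<Longrightarrow> definable_term (\<lambda>e. f e * g e)"
proof (rule term_op[where F = "(*)"])
  have "definable_pred (\<lambda>e. e 0 + (- 1) * (e (Suc 0) * e (Suc (Suc 0))) = 0)"
    by (rule definable_poly[of 3 "\<lambda>xs. xs ! 0 + (-1) * (xs ! Suc 0 * xs ! Suc (Suc 0))"], (intro poly_fun.intros; simp)) auto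
  moreover have "(a + (- 1) * (b * c) = 0) \<longleftrightarrow> a = b * c" for a b c :: real by auto
  ultimately show "definable_pred (\<lambda>e. e 0 = e (Suc 0) * e (Suc (Suc 0)))"
    by (simp only:)
qed

lemma term_diff: "definable_term f \<Longrightarrow> definable_term g \<Longrightarrow> definable_term (\<lambda>e. f e - g e)"
  using term_add[OF _ term_mult[OF term_const[of "- 1"]], of f g] by simp

lemma term_power2: "definable_term f \<Longrightarrow> definable_term (\<lambda>e. (f e)\<^sup>2)"
  unfolding power2_eq_square by (rule term_mult)

lemma term_sum: "finite I \<Longrightarrow> (\<And>i. i \<in> I \<Longrightarrow> definable_term (h i)) \<Longrightarrow> definable_term (\<lambda>e. \<Sum>i\<in>I. h i e)"
  by (induction I rule: finite_induct) (auto intro!: term_const term_add)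

text \<open>Over the reals the order is existential: \<open>a < b\<close> iff \<open>(b - a) z\<^sup>2 = 1\<close> for some \<open>z\<close>.\<close>
lemma definable_less: "definable_term f \<Longrightarrow> definable_term g \<Longrightarrow> definable_pred (\<lambda>e. f e < g e)"
proof (rule term_subst2)
  have "definable_pred (\<lambda>e. \<exists>z. (e (Suc 0) - e 0) * z\<^sup>2 = 1)"
    by (intro definable_ex definable_eq term_mult term_diff term_power2 term_var term_const)
  moreover have "(\<exists>z. (b - a) * z\<^sup>2 = 1) \<longleftrightarrow> a < b" for a b :: real
  proof
    assume "\<exists>z. (b - a) * z\<^sup>2 = 1"
    then obtain z where "(b - a) * z\<^sup>2 = 1" by blast
    then show "a < b"
      by (metis diff_gt_0_iff_gt zero_less_mult_pos2 zero_less_one zero_less_power2 mult_zero_right power_zero_numeral zero_neq_one)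
  next
    assume "a < b"
    then show "\<exists>z. (b - a) * z\<^sup>2 = 1"
      by (intro exI[of _ "1 / sqrt (b - a)"]) (simp add: power_divide)
  qed
  ultimately show "definable_pred (\<lambda>e. e 0 < e (Suc 0))" by simp
qed

lemma definable_le: "definable_term f \<Longrightarrow> definable_term g \<Longrightarrow> definable_pred (\<lambda>e. f e \<le> g e)"
  using definable_not[OF definable_less, of g f] by (simp add: not_less)

lemmas definable_intros = definable_conj definable_disj definable_not definable_imp definable_ex definable_all definable_eq definable_less definable_le
  term_var term_const term_add term_mult term_diff term_power2

section \<open>Points of a Euclidean space as blocks of variables\<close>

definition definable_vector :: "((nat \<Rightarrow> real) \<Rightarrow> 'b::euclidean_space) \<Rightarrow> bool" where
  "definable_vector h \<longleftrightarrow> (\<forall>b\<in>Basis. definable_term (\<lambda>e. h e \<bullet> b))"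

lemma vector_inner: "definable_vector h \<Longrightarrow> b \<in> Basis \<Longrightarrow> definable_term (\<lambda>e. h e \<bullet> b)"
  unfolding definable_vector_def by blast

lemma vector_reindex: "definable_vector h \<Longrightarrow> definable_vector (\<lambda>e. h (\<lambda>i. e (\<sigma> i)))"
  unfolding definable_vector_def using term_reindex by blast

definition vec :: "'b::euclidean_space list \<Rightarrow> (nat \<Rightarrow> real) \<Rightarrow> 'b" where
  "vec bs e = (\<Sum>i<length bs. e i *\<^sub>R bs ! i)"

lemma vec_inner:
  assumes "distinct bs" "set bs = Basis" "i < length bs"
  shows "vec bs e \<bullet> (bs ! i) = e i"
proof -
  have "(bs ! j) \<bullet> (bs ! i) = (if j = i then 1 else 0)" if "j < length bs" for j
    using that assms by (metis inner_Basis nth_eq_iff_index_eq nth_mem)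
  then have "vec bs e \<bullet> (bs ! i) = (\<Sum>j<length bs. if j = i then e j else 0)"
    unfolding vec_def inner_sum_left by (intro sum.cong) auto
  then show ?thesis using assms by simp
qed

lemma vec_coords:
  assumes "distinct bs" "set bs = Basis"
  shows "vec bs (\<lambda>i. y \<bullet> (bs ! i)) = y"
proof (rule euclidean_eqI)
  fix b :: 'a assume "b \<in> Basis"
  then obtain i where "i < length bs" "b = bs ! i" using assms by (metis in_set_conv_nth)
  then show "vec bs (\<lambda>i. y \<bullet> (bs ! i)) \<bullet> b = y \<bullet> b"
    by (simp add: vec_inner[OF assms])
qed

lemma vector_vec:
  assumes "distinct bs" "set bs = (Basis :: 'b::euclidean_space set)"
  shows "definable_vector (\<lambda>e. vec bs (\<lambda>i. e (\<sigma> i)))"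
  unfolding definable_vector_def
proof
  fix b :: 'b assume "b \<in> Basis"
  then obtain i where "i < length bs" "b = bs ! i" using assms by (metis in_set_conv_nth)
  then show "definable_term (\<lambda>e. vec bs (\<lambda>i. e (\<sigma> i)) \<bullet> b)"
    by (simp add: vec_inner[OF assms] term_var)
qed

text \<open>A block of \<open>n\<close> existential quantifiers, packed into one function
  \<open>u\<close> of which only the values below \<open>n\<close> are read. The induction peels off
  variable 0, so that the new \<open>u\<close> is \<open>case_nat\<close> of the innermost value and
  the old \<open>u\<close>.\<close>

lemma definable_ex_block:
  assumes "definable_pred R"
  shows "definable_pred (\<lambda>e. \<exists>u. R (\<lambda>i. if i < n then u i else e (i - n)))"
  using assms
proof (induction n arbitrary: R)
  case (Suc n)
  have 1: "definable_pred (\<lambda>e. \<exists>v. R (case_nat v e))"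
  proof (rule definable_ex)
    have "case_nat (e 0) (\<lambda>i. e (Suc i)) = e" for e :: "nat \<Rightarrow> real"
      by (rule ext) (auto split: nat.splits)
    then show "definable_pred (\<lambda>e. R (case_nat (e 0) (\<lambda>i. e (Suc i))))" using Suc.prems by simp
  qed
  have "(\<exists>u v. R (case_nat v (\<lambda>i. if i < n then u i else e (i - n)))) \<longleftrightarrow>
        (\<exists>u. R (\<lambda>i. if i < Suc n then u i else e (i - Suc n)))" for e
  proof
    assume "\<exists>u v. R (case_nat v (\<lambda>i. if i < n then u i else e (i - n)))"
    then obtain u v where "R (case_nat v (\<lambda>i. if i < n then u i else e (i - n)))" by blast
    moreover have "case_nat v (\<lambda>i. if i < n then u i else e (i - n)) =
        (\<lambda>i. if i < Suc n then case_nat v u i else e (i - Suc n))"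
      by (rule ext) (auto split: nat.splits)
    ultimately show "\<exists>u. R (\<lambda>i. if i < Suc n then u i else e (i - Suc n))" by auto
  next
    assume "\<exists>u. R (\<lambda>i. if i < Suc n then u i else e (i - Suc n))"
    then obtain u where "R (\<lambda>i. if i < Suc n then u i else e (i - Suc n))" by blast
    moreover have "case_nat (u 0) (\<lambda>i. if i < n then u (Suc i) else e (i - n)) =
        (\<lambda>i. if i < Suc n then u i else e (i - Suc n))"
      by (rule ext) (auto split: nat.splits)
    ultimately have "R (case_nat (u 0) (\<lambda>i. if i < n then u (Suc i) else e (i - n)))"
      by (simp only:)
    then show "\<exists>u v. R (case_nat v (\<lambda>i. if i < n then u i else e (i - n)))"
      by (intro exI[of _ "\<lambda>i. u (Suc i)"] exI[of _ "u 0"])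
  qed
  then show ?case using Suc.IH[OF 1] by simp
qed simp

text \<open>Quantifying over points amounts to quantifying over their coordinates. The premise
  ranges over all enumerations \<open>bs\<close> of the basis, so that none has to be named when a
  formula is assembled from introduction rules.\<close>

lemma definable_ex_vec:
  fixes P :: "'b::euclidean_space \<Rightarrow> (nat \<Rightarrow> real) \<Rightarrow> bool"
  assumes "\<And>bs. distinct bs \<Longrightarrow> set bs = (Basis :: 'b set) \<Longrightarrow> definable_pred (\<lambda>e. P (vec bs (\<lambda>i. e i)) (\<lambda>i. e (i + length bs)))"
  shows "definable_pred (\<lambda>e. \<exists>y. P y e)"
proof -
  obtain bs :: "'b list" where bs: "set bs = Basis" "distinct bs"
    using finite_distinct_list[OF finite_Basis] by blast
  have eq: "(\<exists>u. P (vec bs (\<lambda>i. if i < length bs then u i else e (i - length bs)))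
        (\<lambda>i. if i + length bs < length bs then u (i + length bs) else e (i + length bs - length bs)))
        \<longleftrightarrow> (\<exists>y. P y e)" for e
  proof -
    have "vec bs (\<lambda>i. if i < length bs then u i else e (i - length bs)) = vec bs u" for u
      unfolding vec_def by simp
    then show ?thesis using vec_coords[OF bs(2,1)] by simp metis
  qed
  show ?thesis
    using definable_ex_block[OF assms[OF bs(2,1)], of "length bs"] unfolding eq .
qed

lemma definable_all_vec:
  fixes P :: "'b::euclidean_space \<Rightarrow> (nat \<Rightarrow> real) \<Rightarrow> bool"
  assumes "\<And>bs. distinct bs \<Longrightarrow> set bs = (Basis :: 'b set) \<Longrightarrow> definable_pred (\<lambda>e. P (vec bs (\<lambda>i. e i)) (\<lambda>i. e (i + length bs)))"
  shows "definable_pred (\<lambda>e. \<forall>y. P y e)"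
  using definable_not[OF definable_ex_vec[OF definable_not[OF assms]]] by simp

lemma definable_eq_vec: "definable_vector h \<Longrightarrow> definable_vector k \<Longrightarrow> definable_pred (\<lambda>e. h e = (k e :: 'b::euclidean_space))"
  unfolding euclidean_eq_iff[where 'a = 'b] definable_vector_def
  by (intro definable_finite_all finite_Basis definable_eq) auto

lemma term_norm2:
  assumes "definable_vector (h :: _ \<Rightarrow> 'b::euclidean_space)"
  shows "definable_term (\<lambda>e. (norm (h e))\<^sup>2)"
proof -
  have "(norm x)\<^sup>2 = (\<Sum>b\<in>Basis. (x \<bullet> b) * (x \<bullet> b))" for x :: 'b
    unfolding power2_norm_eq_inner by (rule euclidean_inner)
  then show ?thesis using assms unfolding definable_vector_def by (auto intro!: term_sum term_mult)
qed

lemma vector_diff: "definable_vector h \<Longrightarrow> definable_vector k \<Longrightarrow> definable_vector (\<lambda>e. h e - (k e :: 'b::euclidean_space))"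
  unfolding definable_vector_def by (auto simp: inner_diff_left intro!: term_diff)

text \<open>The graph is given with the value behind the coordinates, at position
  \<open>length bs\<close>, while a term has its value at variable 0. Quantifying over the block of
  coordinates moves the value to the front, and an equation between vectors substitutes
  \<open>h\<close> for the argument.\<close>

lemma term_graph:
  fixes f :: "'b::euclidean_space \<Rightarrow> real"
  assumes bs: "distinct bs" "set bs = Basis"
    and G: "{map (\<lambda>b. x \<bullet> b) bs @ [f x] |x. True} \<in> S (Suc (length bs))"
    and h: "definable_vector h"
  shows "definable_term (\<lambda>e. f (h e))"
proof -
  let ?d = "length bs"
  have "{map (\<lambda>b. x \<bullet> b) bs @ [f x] |x. True} =
      {xs. length xs = Suc ?d \<and> xs ! ?d = f (vec bs ((!) xs))}" (is "?A = ?B")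
  proof
    show "?A \<subseteq> ?B"
    proof
      fix xs assume "xs \<in> ?A"
      then obtain x where x: "xs = map (\<lambda>b. x \<bullet> b) bs @ [f x]" by blast
      have "vec bs ((!) xs) = vec bs (\<lambda>i. x \<bullet> (bs ! i))"
        unfolding vec_def x by (intro sum.cong) (auto simp: nth_append)
      then show "xs \<in> ?B" using x by (simp add: vec_coords[OF bs] nth_append)
    qed
    show "?B \<subseteq> ?A"
    proof
      fix xs assume xs: "xs \<in> ?B"
      have "xs = map (\<lambda>b. vec bs ((!) xs) \<bullet> b) bs @ [f (vec bs ((!) xs))]"
        by (rule nth_equalityI) (use xs in \<open>auto simp: nth_append vec_inner[OF bs] less_Suc_eq\<close>)
      then show "xs \<in> ?A" by blast
    qed
  qed
  moreover have "supported (Suc ?d) (\<lambda>e. e ?d = f (vec bs e))"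
    unfolding supported_def vec_def by (auto intro!: arg_cong2[where f="(=)"] arg_cong[where f=f] sum.cong)
  ultimately have base: "definable_pred (\<lambda>e. e ?d = f (vec bs e))"
    using G unfolding definable_pred_def by auto
  have "definable_pred (\<lambda>e. \<exists>u. vec bs (\<lambda>i. if i < ?d then u i else e (i - ?d)) = h (\<lambda>i. if Suc i + ?d < ?d then u (Suc i + ?d) else e (Suc i + ?d - ?d))
     \<and> (if ?d < ?d then u ?d else e (?d - ?d)) = f (vec bs (\<lambda>i. if i < ?d then u i else e (i - ?d))))"
    by (intro definable_ex_block[of "\<lambda>e. vec bs (\<lambda>i. e i) = h (\<lambda>i. e (Suc i + ?d)) \<and> e ?d = f (vec bs e)"]
         definable_conj definable_eq_vec vector_vec bs vector_reindex[OF h, of "\<lambda>i. Suc i + ?d"] base)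
  moreover have "vec bs (\<lambda>i. if i < ?d then u i else e (i - ?d)) = vec bs u" for u e
    unfolding vec_def by simp
  ultimately have 1: "definable_pred (\<lambda>e. \<exists>u. vec bs u = h (\<lambda>i. e (Suc i)) \<and> e 0 = f (vec bs u))" by simp
  have "(\<exists>u. vec bs u = h (\<lambda>i. e (Suc i)) \<and> e 0 = f (vec bs u)) \<longleftrightarrow> e 0 = f (h (\<lambda>i. e (Suc i)))" for e
    using vec_coords[OF bs] by metis
  with 1 show ?thesis unfolding definable_term_def by simp
qed

section \<open>O-minimality in one variable\<close>

lemma definable_one_dim:
  assumes "definable_pred (\<lambda>e. P (e 0))"
  shows "finite_union_intervals {r. P r}"
proof -
  obtain m where m: "supported m (\<lambda>e. P (e 0))" "{xs. length xs = m \<and> P (xs ! 0)} \<in> S m"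
    using assms unfolding definable_pred_def by blast
  have "{xs. length xs = 1 \<and> P (xs ! 0)} \<in> S 1"
    using S_reindex[OF m, of "\<lambda>i. 0" 1] by simp
  then have "finite_union_intervals {r. [r] \<in> {xs. length xs = 1 \<and> P (xs ! 0)}}"
    using om unfolding o_minimal_structure_def by blast
  then show ?thesis by simp
qed

text \<open>The form in which o-minimality is exploited: immediately to the right of a point a
  definable predicate is constantly true or constantly false. Predicates with this property are
  closed under Boolean operations and comprise points and open half-lines, hence all finite unions
  of basic intervals.\<close>

lemma definable_decided_right:
  assumes "definable_pred (\<lambda>e. P (e 0))"
  shows "eventually P (at_right x) \<or> eventually (\<lambda>y. \<not> P y) (at_right x)"
proof -
  let ?dec = "\<lambda>Q. eventually Q (at_right x) \<or> eventually (\<lambda>y. \<not> Q y) (at_right x)"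
  have dec_conj: "?dec (\<lambda>y. Q y \<and> R y)" if Q: "?dec Q" and R: "?dec R" for Q R
  proof (cases "eventually Q (at_right x) \<and> eventually R (at_right x)")
    case True
    then show ?thesis by (simp add: eventually_conj)
  next
    case False
    then have "eventually (\<lambda>y. \<not> Q y) (at_right x) \<or> eventually (\<lambda>y. \<not> R y) (at_right x)"
      using Q R by blast
    then have "eventually (\<lambda>y. \<not> (Q y \<and> R y)) (at_right x)"
      by (elim disjE) (rule eventually_mono, assumption, blast)+
    then show ?thesis by blast
  qed
  have dec_disj: "?dec (\<lambda>y. Q y \<or> R y)" if "?dec Q" "?dec R" for Q R
    using dec_conj[of "\<lambda>y. \<not> Q y" "\<lambda>y. \<not> R y"] that by auto
  have lt: "?dec (\<lambda>y. y < b)" for b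
    by (cases "x < b") (auto simp: eventually_at_right_field intro: exI[of _ b] exI[of _ "x + 1"])
  have gt: "?dec (\<lambda>y. b < y)" for b
    by (cases "x < b") (auto simp: eventually_at_right_field intro: exI[of _ b] exI[of _ "x + 1"])
  have eq: "?dec (\<lambda>y. y = a)" for a
    by (cases "x < a") (auto simp: eventually_at_right_field intro: exI[of _ a] exI[of _ "x + 1"])
  have int: "?dec (\<lambda>y. y \<in> I)" if "basic_interval I" for I
    using that lt gt eq dec_conj[OF gt lt] unfolding basic_interval_def
    by (elim disjE exE) simp_all
  obtain F where F: "finite F" "\<forall>I\<in>F. basic_interval I" "{r. P r} = \<Union>F"
    using definable_one_dim[OF assms] unfolding finite_union_intervals_def by blast
  have "?dec (\<lambda>y. y \<in> \<Union>F)"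
    using F(1,2)
  proof (induction F rule: finite_induct)
    case (insert I F)
    then show ?case using dec_disj[OF int[of I] insert.IH] by simp
  qed simp
  moreover have "P y \<longleftrightarrow> y \<in> \<Union>F" for y using F(3) by (metis mem_Collect_eq)
  ultimately show ?thesis by presburger
qed

text \<open>The reflection \<open>y \<mapsto> - y\<close> turns left germs into right germs.\<close>

lemma definable_decided_left:
  assumes "definable_pred (\<lambda>e. P (e 0))"
  shows "eventually P (at_left x) \<or> eventually (\<lambda>y. \<not> P y) (at_left x)"
proof -
  have "definable_pred (\<lambda>e. \<exists>v. v = 0 - e 0 \<and> P v)"
    by (intro definable_ex definable_conj definable_eq term_diff term_const term_var assms)
  then have "definable_pred (\<lambda>e. P (- e 0))" by simp
  from definable_decided_right[OF this, of "- x"] show ?thesis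
    by (simp add: eventually_at_left_to_right)
qed

end

section \<open>Monotonicity of definable functions near \<open>0+\<close>\<close>

text \<open>Each point has an open interval with rational endpoints on which it is the strict
  minimiser of \<open>h\<close>. An interval determines its strict minimiser, so there can be only
  countably many such points.\<close>

lemma not_all_strict_local_min:
  fixes h :: "real \<Rightarrow> real"
  assumes "a < b"
    and min: "\<And>x. x \<in> {a<..<b} \<Longrightarrow> eventually (\<lambda>y. h x < h y) (at_right x) \<and> eventually (\<lambda>y. h x < h y) (at_left x)"
  shows False
proof -
  have "\<exists>p q. p \<in> \<rat> \<and> q \<in> \<rat> \<and> p < x \<and> x < q \<and> (\<forall>y\<in>{p<..<q}. y \<noteq> x \<longrightarrow> h x < h y)"
    if x: "x \<in> {a<..<b}" for x
  proof -
    obtain u where u: "u > x" "\<And>y. x < y \<Longrightarrow> y < u \<Longrightarrow> h x < h y"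
      using min[OF x] unfolding eventually_at_right_field by blast
    obtain l where l: "l < x" "\<And>y. l < y \<Longrightarrow> y < x \<Longrightarrow> h x < h y"
      using min[OF x] unfolding eventually_at_left_field by blast
    obtain p where "p \<in> \<rat>" "l < p" "p < x" using Rats_dense_in_real l(1) by blast
    moreover obtain q where "q \<in> \<rat>" "x < q" "q < u" using Rats_dense_in_real u(1) by blast
    ultimately show ?thesis
      using u(2) l(2) by (intro exI[of _ p] exI[of _ q]) (auto simp: neq_iff)
  qed
  then obtain p q where pq: "\<And>x. x \<in> {a<..<b} \<Longrightarrow> p x \<in> \<rat> \<and> q x \<in> \<rat> \<and> p x < x \<and> x < q x \<and>
      (\<forall>y\<in>{p x<..<q x}. y \<noteq> x \<longrightarrow> h x < h y)"
    by metis
  have "inj_on (\<lambda>x. (p x, q x)) {a<..<b}"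
  proof (rule inj_onI, rule ccontr)
    fix x y assume xy: "x \<in> {a<..<b}" "y \<in> {a<..<b}" "(p x, q x) = (p y, q y)" "x \<noteq> y"
    then have "h x < h y" "h y < h x" using pq[of x] pq[of y] by auto
    then show False by simp
  qed
  moreover have "(\<lambda>x. (p x, q x)) ` {a<..<b} \<subseteq> \<rat> \<times> \<rat>" using pq by auto
  ultimately have "countable {a<..<b}"
    using countable_subset[OF _ countable_SIGMA[OF countable_rat countable_rat]] countable_image_inj_on
    by blast
  then show False using uncountable_open_interval \<open>a < b\<close> by blast
qed

text \<open>No continuity of \<open>h\<close> is available. At the supremum \<open>s\<close> of the
  points up to which \<open>h x\<close> is a lower bound, the inequality to the left of
  \<open>s\<close> carries the bound to \<open>s\<close> itself, and the one to the right carries it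
  beyond \<open>s\<close> unless \<open>s = y\<close>.\<close>

lemma mono_on_if_locally_mono:
  fixes h :: "real \<Rightarrow> real"
  assumes loc: "\<And>x. x \<in> {a<..<b} \<Longrightarrow> eventually (\<lambda>y. h x \<le> h y) (at_right x) \<and> eventually (\<lambda>y. h y \<le> h x) (at_left x)"
  shows "mono_on {a<..<b} h"
proof (rule mono_onI)
  fix x y assume xy: "x \<in> {a<..<b}" "y \<in> {a<..<b}" "x \<le> y"
  define Z where "Z = {z\<in>{x..y}. \<forall>w\<in>{x..z}. h x \<le> h w}"
  define s where "s = Sup Z"
  have Z: "x \<in> Z" "bdd_above Z" using xy unfolding Z_def by (auto intro!: bdd_aboveI[of _ y])
  have "Sup Z \<le> y"
    using Z(1) by (intro cSup_least) (auto simp: Z_def)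
  then have s: "x \<le> s" "s \<le> y"
    using cSup_upper[OF Z] by (simp_all add: s_def)
  have below: "h x \<le> h w" if xw: "x \<le> w" "w < s" for w
  proof -
    obtain z where "z \<in> Z" "w < z" using xw less_cSup_iff[OF _ Z(2), of w] Z(1) unfolding s_def by blast
    then show ?thesis using xw unfolding Z_def by auto
  qed
  have hs: "h x \<le> h s"
  proof (cases "s = x")
    case False
    have "eventually (\<lambda>y. h y \<le> h s) (at_left s)" using loc[of s] s xy by simp
    moreover have "eventually (\<lambda>y. x < y \<and> y < s) (at_left s)"
      using False s unfolding eventually_at_left_field by (intro exI[of _ x]) auto
    ultimately have "eventually (\<lambda>y. (x < y \<and> y < s) \<and> h y \<le> h s) (at_left s)"
      by (simp add: eventually_conj_iff)
    then obtain w where "x < w" "w < s" "h w \<le> h s"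
      using eventually_happens'[OF trivial_limit_at_left_real] by blast
    then show ?thesis using below[of w] by simp
  qed simp
  have "s = y"
  proof (rule ccontr)
    assume "s \<noteq> y"
    then have "s < y" using s by simp
    obtain u where u: "u > s" "\<And>z. s < z \<Longrightarrow> z < u \<Longrightarrow> h s \<le> h z"
      using loc[of s] s xy unfolding eventually_at_right_field by force
    obtain z where z: "s < z" "z < min u y" using dense[of s "min u y"] u \<open>s < y\<close> by auto
    have "h x \<le> h w" if "w \<in> {x..z}" for w
      using that below[of w] hs u(2)[of w] z by (cases w s rule: linorder_cases) auto
    then have "z \<in> Z" using z s unfolding Z_def by auto
    then have "z \<le> s" unfolding s_def using Z by (intro cSup_upper)
    then show False using z by simp
  qed
  then show "h x \<le> h y" using hs by simp
qed

context o_minimal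
begin

text \<open>Closure under composition with every definable term, rather than definability of the
  graph, lets \<open>h\<close> be applied directly to any variable below quantifiers.\<close>

definition definable_map :: "(real \<Rightarrow> real) \<Rightarrow> bool" where
  "definable_map h \<longleftrightarrow> (\<forall>k. definable_term k \<longrightarrow> definable_term (\<lambda>e. h (k e)))"

lemma definable_mapD: "definable_map h \<Longrightarrow> definable_term k \<Longrightarrow> definable_term (\<lambda>e. h (k e))"
  unfolding definable_map_def by blast

lemma map_trichotomy:
  assumes "definable_map h" "F = at_right x \<or> F = at_left x"
  shows "eventually (\<lambda>y. h x < h y) F \<or> eventually (\<lambda>y. h x = h y) F \<or> eventually (\<lambda>y. h y < h x) F"
proof -
  have dec: "eventually (\<lambda>y. P y) F \<or> eventually (\<lambda>y. \<not> P y) F" if "definable_pred (\<lambda>e. P (e 0))" for P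
    using definable_decided_right[OF that] definable_decided_left[OF that] assms(2) by blast
  have "eventually (\<lambda>y. h x < h y) F \<or> eventually (\<lambda>y. \<not> h x < h y) F"
    by (rule dec) (intro definable_intros definable_mapD[OF assms(1)])
  moreover have "eventually (\<lambda>y. h y < h x) F \<or> eventually (\<lambda>y. \<not> h y < h x) F"
    by (rule dec) (intro definable_intros definable_mapD[OF assms(1)])
  moreover have "eventually (\<lambda>y. h x = h y) F"
    if "eventually (\<lambda>y. \<not> h x < h y) F" "eventually (\<lambda>y. \<not> h y < h x) F"
    using that by eventually_elim simp
  ultimately show ?thesis by blast
qed

lemma eventually_trichotomy:
  assumes "\<And>x. P x \<or> Q x \<or> R x" "definable_pred (\<lambda>e. P (e 0))" "definable_pred (\<lambda>e. Q (e 0))"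
  shows "eventually P (at_right 0) \<or> eventually Q (at_right 0) \<or> eventually R (at_right 0)"
proof -
  have "eventually R (at_right 0)"
    if "eventually (\<lambda>x. \<not> P x) (at_right 0)" "eventually (\<lambda>x. \<not> Q x) (at_right 0)"
    using that by eventually_elim (use assms(1) in blast)
  then show ?thesis using definable_decided_right[OF assms(2)] definable_decided_right[OF assms(3)] by blast
qed

text \<open>Definability decides on which side of \<open>h x\<close> the values of \<open>h\<close> lie immediately to the
  right and to the left of \<open>x\<close>, uniformly for small \<open>x > 0\<close>. The two mixed cases would make every
  such \<open>x\<close> a strict local extremum, which is impossible by countability.\<close>
lemma map_eventually_monotone:
  assumes h: "definable_map h"
  shows "\<exists>\<epsilon>>0. mono_on {0<..<\<epsilon>} h \<or> mono_on {0<..<\<epsilon>} (\<lambda>x. - h x)"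
proof -
  let ?RP = "\<lambda>x. eventually (\<lambda>y. h x < h y) (at_right x)"
  let ?RZ = "\<lambda>x. eventually (\<lambda>y. h x = h y) (at_right x)"
  let ?RN = "\<lambda>x. eventually (\<lambda>y. h y < h x) (at_right x)"
  let ?LP = "\<lambda>x. eventually (\<lambda>y. h y < h x) (at_left x)"
  let ?LZ = "\<lambda>x. eventually (\<lambda>y. h x = h y) (at_left x)"
  let ?LN = "\<lambda>x. eventually (\<lambda>y. h x < h y) (at_left x)"
  have R: "eventually ?RP (at_right 0) \<or> eventually ?RZ (at_right 0) \<or> eventually ?RN (at_right 0)"
    by (rule eventually_trichotomy)
      (use map_trichotomy[OF h] in blast, unfold eventually_at_right_field, (intro definable_intros definable_mapD[OF h])+)
  have L: "eventually ?LN (at_right 0) \<or> eventually ?LZ (at_right 0) \<or> eventually ?LP (at_right 0)"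
    by (rule eventually_trichotomy)
      (use map_trichotomy[OF h] in blast, unfold eventually_at_left_field, (intro definable_intros definable_mapD[OF h])+)
  have inc: ?thesis if R: "eventually (\<lambda>x. eventually (\<lambda>y. h x \<le> h y) (at_right x)) (at_right 0)"
      and L: "eventually (\<lambda>x. eventually (\<lambda>y. h y \<le> h x) (at_left x)) (at_right 0)"
  proof -
    from eventually_conj[OF R L] obtain \<epsilon> where \<epsilon>: "\<epsilon> > 0" "\<And>x. 0 < x \<Longrightarrow> x < \<epsilon> \<Longrightarrow>
        eventually (\<lambda>y. h x \<le> h y) (at_right x) \<and> eventually (\<lambda>y. h y \<le> h x) (at_left x)"
      unfolding eventually_at_right_field[of _ 0] by blast
    have "mono_on {0<..<\<epsilon>} h" by (rule mono_on_if_locally_mono) (use \<epsilon> in auto)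
    then show ?thesis using \<epsilon>(1) by blast
  qed
  have dec: ?thesis if R: "eventually (\<lambda>x. eventually (\<lambda>y. h y \<le> h x) (at_right x)) (at_right 0)"
      and L: "eventually (\<lambda>x. eventually (\<lambda>y. h x \<le> h y) (at_left x)) (at_right 0)"
  proof -
    from eventually_conj[OF R L] obtain \<epsilon> where \<epsilon>: "\<epsilon> > 0" "\<And>x. 0 < x \<Longrightarrow> x < \<epsilon> \<Longrightarrow>
        eventually (\<lambda>y. h y \<le> h x) (at_right x) \<and> eventually (\<lambda>y. h x \<le> h y) (at_left x)"
      unfolding eventually_at_right_field[of _ 0] by blast
    have "mono_on {0<..<\<epsilon>} (\<lambda>x. - h x)" by (rule mono_on_if_locally_mono) (use \<epsilon> in auto)
    then show ?thesis using \<epsilon>(1) by blast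
  qed
  have min: False if R: "eventually ?RP (at_right 0)" and L: "eventually ?LN (at_right 0)"
  proof -
    from eventually_conj[OF R L] obtain \<epsilon> where "\<epsilon> > 0" "\<And>x. 0 < x \<Longrightarrow> x < \<epsilon> \<Longrightarrow> ?RP x \<and> ?LN x"
      unfolding eventually_at_right_field[of _ 0] by blast
    then show False by (intro not_all_strict_local_min[of 0 \<epsilon> h]) auto
  qed
  have max: False if R: "eventually ?RN (at_right 0)" and L: "eventually ?LP (at_right 0)"
  proof -
    from eventually_conj[OF R L] obtain \<epsilon> where "\<epsilon> > 0" "\<And>x. 0 < x \<Longrightarrow> x < \<epsilon> \<Longrightarrow> ?RN x \<and> ?LP x"
      unfolding eventually_at_right_field[of _ 0] by blast
    then show False by (intro not_all_strict_local_min[of 0 \<epsilon> "\<lambda>x. - h x"]) auto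
  qed
  have w: "eventually (\<lambda>x. eventually (Q x) (F x)) (at_right 0)"
    if "eventually (\<lambda>x. eventually (P x) (F x)) (at_right 0)" "\<And>x y. P x y \<Longrightarrow> Q x y"
    for P Q :: "real \<Rightarrow> real \<Rightarrow> bool" and F
    using that(1) by (rule eventually_mono) (erule eventually_mono, rule that(2))
  show ?thesis
    using R
  proof (elim disjE)
    assume RP: "eventually ?RP (at_right 0)"
    then have "\<not> eventually ?LN (at_right 0)" using min by blast
    then have "eventually (\<lambda>x. eventually (\<lambda>y. h y \<le> h x) (at_left x)) (at_right 0)"
      using L by (elim disjE) (blast | erule w, simp)+
    moreover have "eventually (\<lambda>x. eventually (\<lambda>y. h x \<le> h y) (at_right x)) (at_right 0)"
      using RP by (auto elim!: w)
    ultimately show ?thesis by (rule inc[rotated])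
  next
    assume RN: "eventually ?RN (at_right 0)"
    then have "\<not> eventually ?LP (at_right 0)" using max by blast
    then have "eventually (\<lambda>x. eventually (\<lambda>y. h x \<le> h y) (at_left x)) (at_right 0)"
      using L by (elim disjE) (blast | erule w, simp)+
    moreover have "eventually (\<lambda>x. eventually (\<lambda>y. h y \<le> h x) (at_right x)) (at_right 0)"
      using RN by (auto elim!: w)
    ultimately show ?thesis by (rule dec[rotated])
  next
    \<comment> \<open>To the right \<open>h\<close> is locally constant, so both weak inequalities
      hold there, and the behaviour to the left alone decides between \<open>inc\<close> and
      \<open>dec\<close>.\<close>
    assume RZ: "eventually ?RZ (at_right 0)"
    have 1: "eventually (\<lambda>x. eventually (\<lambda>y. h y \<le> h x) (at_right x)) (at_right 0)"
      "eventually (\<lambda>x. eventually (\<lambda>y. h x \<le> h y) (at_right x)) (at_right 0)"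
      using RZ by (auto elim!: w)
    have "eventually (\<lambda>x. eventually (\<lambda>y. h x \<le> h y) (at_left x)) (at_right 0) \<or>
       eventually (\<lambda>x. eventually (\<lambda>y. h y \<le> h x) (at_left x)) (at_right 0)"
      using L by (elim disjE) ((rule disjI1, erule w, simp; fail) | (rule disjI2, erule w, simp; fail))+
    then show ?thesis using dec[OF 1(1)] inc[OF 1(2)] by blast
  qed
qed

text \<open>Continuity at a point is a first-order condition, hence decided near \<open>0+\<close>.
  Discontinuity at all small points is excluded because a monotone function has only countably many
  discontinuities.\<close>

lemma map_eventually_isCont:
  assumes h: "definable_map h"
  shows "eventually (isCont h) (at_right 0)"
proof -
  have eq: "isCont h x \<longleftrightarrow> (\<forall>\<eta>. 0 < \<eta> \<longrightarrow> (\<exists>\<delta>. 0 < \<delta> \<and> (\<forall>y. x - \<delta> < y \<and> y < x + \<delta> \<longrightarrow>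
        h x - \<eta> < h y \<and> h y < h x + \<eta>)))" for x
    unfolding continuous_at_eps_delta by (simp add: dist_real_def abs_less_iff less_diff_eq diff_less_eq add.commute conj_commute)
  have "definable_pred (\<lambda>e. isCont h (e 0))"
    unfolding eq by (intro definable_intros definable_mapD[OF h])
  then have "eventually (isCont h) (at_right 0) \<or> eventually (\<lambda>x. \<not> isCont h x) (at_right 0)"
    by (rule definable_decided_right)
  moreover have False if ev: "eventually (\<lambda>x. \<not> isCont h x) (at_right 0)"
  proof -
    obtain u where u: "u > 0" "\<And>x. 0 < x \<Longrightarrow> x < u \<Longrightarrow> \<not> isCont h x"
      using ev unfolding eventually_at_right_field by blast
    obtain \<epsilon> where \<epsilon>: "\<epsilon> > 0" "mono_on {0<..<\<epsilon>} h \<or> mono_on {0<..<\<epsilon>} (\<lambda>x. - h x)"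
      using map_eventually_monotone[OF h] by blast
    have "countable {x\<in>{0<..<\<epsilon>}. \<not> isCont h x}"
      using \<epsilon>(2)
    proof
      assume "mono_on {0<..<\<epsilon>} h"
      then show ?thesis by (intro mono_on_ctble_discont_open) auto
    next
      assume "mono_on {0<..<\<epsilon>} (\<lambda>x. - h x)"
      then have "countable {x\<in>{0<..<\<epsilon>}. \<not> isCont (\<lambda>x. - h x) x}"
        by (intro mono_on_ctble_discont_open) auto
      moreover have "isCont (\<lambda>x. - h x) x \<longleftrightarrow> isCont h x" for x
        using isCont_minus[of x h] isCont_minus[of x "\<lambda>x. - h x"] by auto
      ultimately show ?thesis by simp
    qed
    moreover have "{0<..<min \<epsilon> u} \<subseteq> {x\<in>{0<..<\<epsilon>}. \<not> isCont h x}" using u by auto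
    ultimately have "countable {0<..<min \<epsilon> u}" by (rule countable_subset[rotated])
    then show False using uncountable_open_interval[of 0 "min \<epsilon> u"] \<epsilon> u by simp
  qed
  ultimately show ?thesis by blast
qed

text \<open>Stated for all small \<open>\<epsilon>\<close> so that finitely many functions can share
  one interval; the sign \<open>s\<close> treats increasing and decreasing functions
  uniformly.\<close>

lemma map_germ:
  assumes "definable_map h"
  shows "eventually (\<lambda>\<epsilon>. continuous_on {0<..<\<epsilon>} h \<and> (\<exists>s\<in>{1, - 1}. mono_on {0<..<\<epsilon>} (\<lambda>x. s * h x))) (at_right 0)"
proof -
  obtain \<epsilon> where \<epsilon>: "\<epsilon> > 0" "mono_on {0<..<\<epsilon>} h \<or> mono_on {0<..<\<epsilon>} (\<lambda>x. - h x)"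
    using map_eventually_monotone[OF assms] by blast
  then have s: "\<exists>s\<in>{1, - 1}. mono_on {0<..<\<epsilon>} (\<lambda>x. s * h x)" by auto
  obtain u where u: "u > 0" "\<And>x. 0 < x \<Longrightarrow> x < u \<Longrightarrow> isCont h x"
    using map_eventually_isCont[OF assms] unfolding eventually_at_right_field by blast
  show ?thesis
    unfolding eventually_at_right_field
  proof (intro exI[of _ "min \<epsilon> u"] conjI allI impI)
    fix y assume y: "0 < y" "y < min \<epsilon> u"
    show "continuous_on {0<..<y} h"
      by (rule continuous_at_imp_continuous_on) (use u y in auto)
    have "{0<..<y} \<subseteq> {0<..<\<epsilon>}" using y by auto
    then show "\<exists>s\<in>{1, - 1}. mono_on {0<..<y} (\<lambda>x. s * h x)"
      using s mono_on_subset by blast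
  qed (use \<epsilon> u in auto)
qed

end

section \<open>The Kurdyka-Lojasiewicz inequality\<close>

text \<open>The gradient is not given as definable; this turns a bound on its norm into a condition
  on increments of \<open>E\<close>. Squares replace norms and absolute values, which keeps the
  condition polynomial in the coordinates and the values of \<open>E\<close>. The margin
  \<open>c < c'\<close> absorbs the remainder of the derivative.\<close>

lemma norm_grad_le_iff:
  fixes E :: "'b::euclidean_space \<Rightarrow> real"
  assumes E: "(E has_derivative (\<lambda>h. g \<bullet> h)) (at p)"
  shows "norm g \<le> c \<longleftrightarrow> 0 \<le> c \<and> (\<forall>c'. c < c' \<longrightarrow> (\<exists>\<delta>. 0 < \<delta> \<and>
     (\<forall>y. (norm (y - p))\<^sup>2 < \<delta> \<longrightarrow> (E y - E p)\<^sup>2 \<le> c'\<^sup>2 * (norm (y - p))\<^sup>2)))"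
proof -
  have der: "\<exists>d>0. \<forall>y. norm (y - p) < d \<longrightarrow> \<bar>E y - E p - g \<bullet> (y - p)\<bar> \<le> \<epsilon> * norm (y - p)" if "\<epsilon> > 0" for \<epsilon>
    using E that unfolding has_derivative_at_alt by simp
  show ?thesis
  proof (intro iffI conjI allI impI)
    assume c: "norm g \<le> c"
    then show "0 \<le> c" using norm_ge_zero order_trans by blast
    fix c' assume c': "c < c'"
    obtain d where d: "d > 0" "\<And>y. norm (y - p) < d \<Longrightarrow> \<bar>E y - E p - g \<bullet> (y - p)\<bar> \<le> (c' - c) * norm (y - p)"
      using der[of "c' - c"] c' by auto
    have "(E y - E p)\<^sup>2 \<le> c'\<^sup>2 * (norm (y - p))\<^sup>2" if "(norm (y - p))\<^sup>2 < d\<^sup>2" for y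
    proof -
      have "norm (y - p) < d" using that d(1) by (simp add: power2_less_imp_less)
      then have "\<bar>E y - E p - g \<bullet> (y - p)\<bar> \<le> (c' - c) * norm (y - p)" by (rule d(2))
      moreover have "\<bar>g \<bullet> (y - p)\<bar> \<le> c * norm (y - p)"
        using Cauchy_Schwarz_ineq2[of g "y - p"] mult_right_mono[OF c norm_ge_zero[of "y - p"]] by linarith
      ultimately have "\<bar>E y - E p\<bar> \<le> c' * norm (y - p)" by (simp add: algebra_simps)
      then have "\<bar>E y - E p\<bar>\<^sup>2 \<le> (c' * norm (y - p))\<^sup>2" by (rule power_mono) simp
      then show ?thesis by (simp add: power_mult_distrib)
    qed
    then show "\<exists>\<delta>. 0 < \<delta> \<and> (\<forall>y. (norm (y - p))\<^sup>2 < \<delta> \<longrightarrow> (E y - E p)\<^sup>2 \<le> c'\<^sup>2 * (norm (y - p))\<^sup>2)"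
      using d(1) by (intro exI[of _ "d\<^sup>2"]) auto
  next
    assume R: "0 \<le> c \<and> (\<forall>c'. c < c' \<longrightarrow> (\<exists>\<delta>. 0 < \<delta> \<and>
     (\<forall>y. (norm (y - p))\<^sup>2 < \<delta> \<longrightarrow> (E y - E p)\<^sup>2 \<le> c'\<^sup>2 * (norm (y - p))\<^sup>2)))"
    show "norm g \<le> c"
    proof (rule ccontr)
      assume "\<not> norm g \<le> c"
      then have gc: "c < norm g" by simp
      define c' where "c' = (c + norm g) / 2"
      have c': "c < c'" "c' < norm g" "0 \<le> c'" using gc R unfolding c'_def by auto
      define \<epsilon> where "\<epsilon> = (norm g - c') / 2"
      have \<epsilon>: "\<epsilon> > 0" "norm g - \<epsilon> > c'" using c' unfolding \<epsilon>_def by (auto simp: field_simps)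
      obtain \<delta> where \<delta>: "0 < \<delta>" "\<And>y. (norm (y - p))\<^sup>2 < \<delta> \<Longrightarrow> (E y - E p)\<^sup>2 \<le> c'\<^sup>2 * (norm (y - p))\<^sup>2"
        using R c'(1) by blast
      obtain d where d: "d > 0" "\<And>y. norm (y - p) < d \<Longrightarrow> \<bar>E y - E p - g \<bullet> (y - p)\<bar> \<le> \<epsilon> * norm (y - p)"
        using der[OF \<epsilon>(1)] by blast
      define m where "m = min d (sqrt \<delta>) / 2"
      have m: "0 < m" "m < d" "m < sqrt \<delta>"
        using d(1) real_sqrt_gt_zero[OF \<delta>(1)] unfolding m_def by (auto simp: min_def)
      \<comment> \<open>A step of length \<open>m\<close> in the direction of the gradient: the
        increment there is about \<open>m * norm g\<close>, too much for the bound
        \<open>c' * m\<close>.\<close>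
      define y where "y = p + (m / norm g) *\<^sub>R g"
      have gpos: "norm g > 0" using c' by linarith
      have ny: "norm (y - p) = m" unfolding y_def using gpos m by simp
      have gy: "g \<bullet> (y - p) = m * norm g"
        unfolding y_def using gpos by (simp add: power2_norm_eq_inner[symmetric] power2_eq_square)
      have "m\<^sup>2 < \<delta>" using m \<delta>(1) by (metis less_eq_real_def real_less_lsqrt real_less_rsqrt real_sqrt_less_iff real_sqrt_unique)
      then have "\<bar>E y - E p\<bar>\<^sup>2 \<le> (c' * m)\<^sup>2" using \<delta>(2)[of y] ny by (simp add: power_mult_distrib)
      then have "\<bar>E y - E p\<bar> \<le> c' * m" using c'(3) m(1) by (metis abs_le_square_iff abs_of_nonneg mult_nonneg_nonneg less_imp_le abs_abs)
      moreover have "\<bar>E y - E p - m * norm g\<bar> \<le> \<epsilon> * m" using d(2)[of y] ny m gy by simp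
      ultimately have "m * norm g - \<epsilon> * m \<le> c' * m" by linarith
      then have "m * (norm g - \<epsilon>) \<le> m * c'" by (simp add: algebra_simps)
      then show False using m \<epsilon> by simp
    qed
  qed
qed

context o_minimal
begin

definition definable_family :: "(real \<Rightarrow> 'b::euclidean_space \<Rightarrow> bool) \<Rightarrow> bool" where
  "definable_family A \<longleftrightarrow> (\<forall>k h. definable_term k \<longrightarrow> definable_vector h \<longrightarrow> definable_pred (\<lambda>e. A (k e) (h e)))"

lemma definable_familyD: "definable_family A \<Longrightarrow> definable_term k \<Longrightarrow> definable_vector h \<Longrightarrow> definable_pred (\<lambda>e. A (k e) (h e))"
  unfolding definable_family_def by blast

text \<open>Definable choice on compact sets: one coordinate is minimised, then the next among the
  minimisers, and so on. Minimisers of a coordinate form a definable compact set, nonempty if the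
  set before was, so the process continues; when \<open>bs\<close> exhausts the basis, at most one
  point is left for each parameter.\<close>

lemma lexicographic_minimum:
  fixes A :: "real \<Rightarrow> 'b::euclidean_space \<Rightarrow> bool"
  assumes "definable_family A" "set bs \<subseteq> Basis" "\<And>r. compact {y. A r y}"
  shows "\<exists>A'. definable_family A' \<and> (\<forall>r y. A' r y \<longrightarrow> A r y) \<and> (\<forall>r. (\<exists>y. A r y) \<longrightarrow> (\<exists>y. A' r y)) \<and>
     (\<forall>b\<in>set bs. \<forall>r y z. A' r y \<longrightarrow> A' r z \<longrightarrow> y \<bullet> b = z \<bullet> b)"
  using assms
proof (induction bs arbitrary: A)
  case Nil
  then show ?case by auto
next
  case (Cons b bs)
  define A1 where "A1 r y \<longleftrightarrow> A r y \<and> (\<forall>z. A r z \<longrightarrow> y \<bullet> b \<le> z \<bullet> b)" for r y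
  have b: "b \<in> Basis" using Cons.prems by simp
  have "definable_family A1"
    unfolding definable_family_def A1_def
  proof (intro allI impI)
    fix k and h :: "_ \<Rightarrow> 'b" assume k: "definable_term k" and h: "definable_vector h"
    show "definable_pred (\<lambda>e. A (k e) (h e) \<and> (\<forall>z. A (k e) z \<longrightarrow> h e \<bullet> b \<le> z \<bullet> b))"
      by (intro definable_conj definable_familyD[OF Cons.prems(1)] k h definable_all_vec definable_imp definable_le vector_inner b
           term_reindex[OF k] vector_reindex[OF h] vector_vec)
  qed
  moreover have "set bs \<subseteq> Basis" using Cons.prems by simp
  moreover have "compact {y. A1 r y}" for r
  proof -
    have "{y. A1 r y} = {y. A r y} \<inter> (\<Inter>z\<in>{z. A r z}. {y. y \<bullet> b \<le> z \<bullet> b})"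
      unfolding A1_def by auto
    moreover have "closed (\<Inter>z\<in>{z. A r z}. {y. y \<bullet> b \<le> z \<bullet> b})"
      by (intro closed_INT ballI closed_Collect_le continuous_intros)
    ultimately show ?thesis using Cons.prems(3)[of r] by (simp add: compact_Int_closed)
  qed
  ultimately obtain A' where A': "definable_family A'" "\<And>r y. A' r y \<Longrightarrow> A1 r y" "\<And>r. \<exists>y. A1 r y \<Longrightarrow> \<exists>y. A' r y"
     "\<And>c r y z. c \<in> set bs \<Longrightarrow> A' r y \<Longrightarrow> A' r z \<Longrightarrow> y \<bullet> c = z \<bullet> c"
    using Cons.IH[of A1] by blast
  have ne: "\<exists>y. A1 r y" if "\<exists>y. A r y" for r
  proof -
    have "\<exists>y\<in>{y. A r y}. \<forall>z\<in>{y. A r y}. y \<bullet> b \<le> z \<bullet> b"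
      by (rule continuous_attains_inf) (use that Cons.prems(3) in \<open>auto intro!: continuous_intros\<close>)
    then show ?thesis unfolding A1_def by blast
  qed
  have eqb: "y \<bullet> b = z \<bullet> b" if "A' r y" "A' r z" for r y z
    using A'(2)[OF that(1)] A'(2)[OF that(2)] unfolding A1_def by (meson order_antisym)
  have sub: "A r y" if "A' r y" for r y using A'(2)[OF that] unfolding A1_def by blast
  show ?case
  proof (intro exI[of _ A'] conjI allI impI ballI)
    show "\<exists>y. A' r y" if "\<exists>y. A r y" for r using A'(3)[OF ne[OF that]] .
    show "y \<bullet> c = z \<bullet> c" if "c \<in> set (b # bs)" "A' r y" "A' r z" for c r y z
      using that(1) eqb[OF that(2,3)] A'(4)[OF _ that(2,3)] by (metis set_ConsD)
  qed (use A'(1) sub in auto)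
qed

lemma definable_cbox: "definable_vector h \<Longrightarrow> definable_pred (\<lambda>e. h e \<in> cbox a (b :: 'b::euclidean_space))"
  unfolding mem_box by (intro definable_finite_all finite_Basis definable_intros vector_inner)

lemma family_minimal_slope:
  fixes E :: "'b::euclidean_space \<Rightarrow> real" and G :: "'b \<Rightarrow> 'b"
  assumes dE: "\<And>h. definable_vector h \<Longrightarrow> definable_term (\<lambda>e. E (h e))"
    and der: "\<And>p. (E has_derivative (\<lambda>h. G p \<bullet> h)) (at p)"
  shows "definable_family (\<lambda>r p. p \<in> cbox a b \<and> E p = es + r \<and> (\<forall>q. q \<in> cbox a b \<and> E q = es + r \<longrightarrow> norm (G p) \<le> norm (G q)))"
proof -
  have definable_slope: "definable_pred (\<lambda>e. norm (G (h e)) \<le> k e)" if h: "definable_vector h" and k: "definable_term k" for h k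
    unfolding norm_grad_le_iff[OF der]
    by (intro definable_intros definable_all_vec dE term_norm2 vector_diff vector_vec term_reindex[OF k] vector_reindex[OF h] h k)
  \<comment> \<open>So far the slope can only be compared with a definable term; two slopes are
    compared by quantifying over all upper bounds of the second.\<close>
  have "norm (G p) \<le> norm (G q) \<longleftrightarrow> (\<forall>c. norm (G q) \<le> c \<longrightarrow> norm (G p) \<le> c)" for p q
    using order_trans by blast
  moreover have "definable_pred (\<lambda>e. \<forall>c. norm (G (k e)) \<le> c \<longrightarrow> norm (G (h e)) \<le> c)" if "definable_vector h" "definable_vector k" for h k
    by (intro definable_all definable_imp definable_slope vector_reindex[OF that(1)] vector_reindex[OF that(2)] term_var)
  ultimately have definable_slope2: "definable_pred (\<lambda>e. norm (G (h e)) \<le> norm (G (k e)))" if "definable_vector h" "definable_vector k" for h k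
    using that by presburger
  show ?thesis
    unfolding definable_family_def
  proof (intro allI impI)
    fix k and h :: "_ \<Rightarrow> 'b" assume k: "definable_term k" and h: "definable_vector h"
    show "definable_pred (\<lambda>e. h e \<in> cbox a b \<and> E (h e) = es + k e \<and>
       (\<forall>q. q \<in> cbox a b \<and> E q = es + k e \<longrightarrow> norm (G (h e)) \<le> norm (G q)))"
      by (intro definable_conj definable_cbox definable_eq definable_imp definable_all_vec definable_slope2 dE term_add term_const h k
          term_reindex[OF k] vector_reindex[OF h] vector_vec)
  qed
qed

text \<open>Uniqueness turns the value of \<open>SOME\<close> into an existential formula. The value
  0 is a default for parameters without a point.\<close>

lemma map_coordinate:
  fixes A :: "real \<Rightarrow> 'b::euclidean_space \<Rightarrow> bool"
  assumes A: "definable_family A" and uniq: "\<And>r y z. A r y \<Longrightarrow> A r z \<Longrightarrow> y = z" and b: "b \<in> Basis"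
  shows "definable_map (\<lambda>r. if \<exists>y. A r y then (SOME y. A r y) \<bullet> b else 0)"
proof -
  have eq: "(v = (if \<exists>y. A r y then (SOME y. A r y) \<bullet> b else 0)) \<longleftrightarrow>
      (\<exists>y. A r y \<and> v = y \<bullet> b) \<or> \<not> (\<exists>y. A r y) \<and> v = 0" for v r
  proof (cases "\<exists>y. A r y")
    case True
    then obtain y where y: "A r y" by blast
    have "(SOME y. A r y) = y" using y uniq by (metis someI)
    then show ?thesis using y uniq by auto
  qed auto
  show ?thesis
    unfolding definable_map_def definable_term_def
  proof (intro allI impI)
    fix k assume "definable_pred (\<lambda>e. e 0 = k (\<lambda>i. e (Suc i)))"
    then have k: "definable_term k" unfolding definable_term_def .
    show "definable_pred (\<lambda>e. e 0 = (if \<exists>y. A (k (\<lambda>i. e (Suc i))) y then (SOME y. A (k (\<lambda>i. e (Suc i))) y) \<bullet> b else 0))"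
      unfolding eq
      by (intro definable_conj definable_disj definable_not definable_ex_vec definable_eq definable_familyD[OF A] term_reindex[OF k] vector_vec vector_inner b term_var term_const)
  qed
qed

text \<open>Kurdyka-Lojasiewicz inequality. On each level set of \<open>E\<close> in the box pick, lexicographically,
  a point \<open>X r\<close> of minimal slope. Its coordinates are monotone for small \<open>r\<close>, so that the curve
  \<open>X\<close> has finite \<open>l\<^sup>1\<close>-length \<open>\<phi>\<close>, and comparing \<open>E\<close> at \<open>X r\<close> and \<open>X r'\<close> gives the inequality
  as a statement on difference quotients of \<open>\<phi>\<close>.\<close>
lemma kurdyka_lojasiewicz:
  fixes E :: "'b::euclidean_space \<Rightarrow> real" and G :: "'b \<Rightarrow> 'b"
  assumes dE: "\<And>h. definable_vector h \<Longrightarrow> definable_term (\<lambda>e. E (h e))"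
    and der: "\<And>p. (E has_derivative (\<lambda>h. G p \<bullet> h)) (at p)"
    and cG: "continuous_on (cbox a b) G"
    and L: "L \<ge> 0" "\<And>p q. p \<in> cbox a b \<Longrightarrow> q \<in> cbox a b \<Longrightarrow> \<bar>E q - E p\<bar> \<le> (norm (G p) + L * norm (q - p)) * norm (q - p)"
  shows "\<exists>\<epsilon>>0. \<exists>\<phi>. continuous_on {0<..<\<epsilon>} \<phi> \<and> mono_on {0<..<\<epsilon>} \<phi> \<and> bounded (\<phi> ` {0<..<\<epsilon>}) \<and>
     (\<forall>p\<in>cbox a b. \<forall>r\<in>{0<..<\<epsilon>}. \<forall>r'\<in>{0<..<\<epsilon>}. E p = es + r \<longrightarrow>
        \<bar>r - r'\<bar> \<le> (norm (G p) + L * \<bar>\<phi> r - \<phi> r'\<bar>) * \<bar>\<phi> r - \<phi> r'\<bar>)"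
proof -
  define A where "A r p \<longleftrightarrow> p \<in> cbox a b \<and> E p = es + r \<and>
     (\<forall>q. q \<in> cbox a b \<and> E q = es + r \<longrightarrow> norm (G p) \<le> norm (G q))" for r p
  have contE: "continuous_on UNIV E"
    using der has_derivative_continuous by (blast intro: continuous_at_imp_continuous_on)
  have level: "compact {p \<in> cbox a b. E p = es + r}" for r
  proof -
    have "closed {p. E p = es + r}"
      by (intro closed_Collect_eq contE continuous_on_const)
    then have "compact (cbox a b \<inter> {p. E p = es + r})" by (intro compact_Int_closed compact_cbox)
    then show ?thesis by (simp add: Int_def)
  qed
  have ne: "\<exists>p. A r p" if "p \<in> cbox a b" "E p = es + r" for p r
  proof -
    have "\<exists>x\<in>{p \<in> cbox a b. E p = es + r}. \<forall>y\<in>{p \<in> cbox a b. E p = es + r}. norm (G x) \<le> norm (G y)"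
      by (rule continuous_attains_inf)
        (use that level in \<open>auto intro!: continuous_intros continuous_on_subset[OF cG]\<close>)
    then show ?thesis unfolding A_def by blast
  qed
  have cA: "compact {p. A r p}" for r
  proof (cases "\<exists>p. A r p")
    case True
    then obtain p where p: "A r p" by blast
    have eq: "{p. A r p} = {q \<in> {q \<in> cbox a b. E q = es + r}. norm (G q) \<le> norm (G p)}"
      using p unfolding A_def by (auto intro: order_trans)
    have "closed {q \<in> {q \<in> cbox a b. E q = es + r}. norm (G q) \<le> norm (G p)}"
      by (intro continuous_on_closed_Collect_le)
       (use compact_imp_closed[OF level] in \<open>auto intro!: continuous_intros continuous_on_subset[OF cG]\<close>)
    from compact_Int_closed[OF level[of r] this] show ?thesis unfolding eq
      by (rule back_subst[where P = compact]) blast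
  qed simp
  have famA: "definable_family A" unfolding A_def by (rule family_minimal_slope[OF dE der])
  obtain bs :: "'b list" where bs: "set bs = Basis"
    using finite_list[OF finite_Basis] by blast
  obtain A' where "definable_family A' \<and> (\<forall>r y. A' r y \<longrightarrow> A r y) \<and> (\<forall>r. (\<exists>y. A r y) \<longrightarrow> (\<exists>y. A' r y)) \<and>
     (\<forall>b\<in>set bs. \<forall>r y z. A' r y \<longrightarrow> A' r z \<longrightarrow> y \<bullet> b = z \<bullet> b)"
    using lexicographic_minimum[OF famA eq_refl[OF bs] cA] by blast
  then have A': "definable_family A'" "\<And>r y. A' r y \<Longrightarrow> A r y" "\<And>r. \<exists>y. A r y \<Longrightarrow> \<exists>y. A' r y"
    "\<And>b r y z. b \<in> Basis \<Longrightarrow> A' r y \<Longrightarrow> A' r z \<Longrightarrow> y \<bullet> b = z \<bullet> b"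
    using bs by blast+
  have uniq: "y = z" if "A' r y" "A' r z" for r y z
    using A'(4)[OF _ that] by (rule euclidean_eqI)
  have "definable_pred (\<lambda>e. \<exists>y. A' (e 0) y)"
    by (intro definable_ex_vec definable_familyD[OF A'(1)] term_var vector_vec)
  then have "eventually (\<lambda>r. \<exists>y. A' r y) (at_right 0) \<or> eventually (\<lambda>r. \<not> (\<exists>y. A' r y)) (at_right 0)"
    by (rule definable_decided_right)
  then show ?thesis
  proof
    \<comment> \<open>The levels \<open>es + r\<close> are not attained in the box for small
      \<open>r > 0\<close>, so the inequality is vacuous and a constant \<open>\<phi>\<close> will
      do.\<close>
    assume "eventually (\<lambda>r. \<not> (\<exists>y. A' r y)) (at_right 0)"
    then obtain \<epsilon> where "\<epsilon> > 0" "\<And>r. 0 < r \<Longrightarrow> r < \<epsilon> \<Longrightarrow> \<not> (\<exists>y. A' r y)"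
      unfolding eventually_at_right_field by blast
    then have "\<epsilon> > 0" "\<And>r p. 0 < r \<Longrightarrow> r < \<epsilon> \<Longrightarrow> p \<in> cbox a b \<Longrightarrow> E p \<noteq> es + r"
      using ne A'(3) by blast+
    then show ?thesis
      by (intro exI[of _ \<epsilon>] exI[of _ "\<lambda>_. 0"] conjI) (auto simp: mono_on_def image_constant_conv)
  next
    assume evne: "eventually (\<lambda>r. \<exists>y. A' r y) (at_right 0)"
    define sel where "sel c r = (if \<exists>y. A' r y then (SOME y. A' r y) \<bullet> c else 0)" for c r
    define X where "X r = (SOME y. A' r y)" for r
    have "definable_map (sel c)" if "c \<in> Basis" for c
      using map_coordinate[OF A'(1) uniq that] unfolding sel_def by simp
    then have "\<forall>c\<in>Basis. eventually (\<lambda>\<epsilon>. continuous_on {0<..<\<epsilon>} (sel c) \<and> (\<exists>s\<in>{1, - 1}. mono_on {0<..<\<epsilon>} (\<lambda>x. s * sel c x))) (at_right 0)"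
      using map_germ by blast
    then have "eventually (\<lambda>\<epsilon>. \<forall>c\<in>Basis. continuous_on {0<..<\<epsilon>} (sel c) \<and> (\<exists>s\<in>{1, - 1}. mono_on {0<..<\<epsilon>} (\<lambda>x. s * sel c x))) (at_right 0)"
      by (intro eventually_ball_finite finite_Basis)
    moreover have "eventually (\<lambda>\<epsilon>. 0 < \<epsilon> \<and> (\<forall>r\<in>{0<..<\<epsilon>}. \<exists>y. A' r y)) (at_right 0)"
      using evne unfolding eventually_at_right_field by (metis dual_order.strict_trans greaterThanLessThan_iff)
    ultimately have "eventually (\<lambda>\<epsilon>. (0 < \<epsilon> \<and> (\<forall>r\<in>{0<..<\<epsilon>}. \<exists>y. A' r y)) \<and>
       (\<forall>c\<in>Basis. continuous_on {0<..<\<epsilon>} (sel c) \<and> (\<exists>s\<in>{1, - 1}. mono_on {0<..<\<epsilon>} (\<lambda>x. s * sel c x)))) (at_right 0)"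
      by eventually_elim blast
    then obtain \<epsilon> where \<epsilon>: "0 < \<epsilon>" and ex: "\<And>r. r \<in> {0<..<\<epsilon>} \<Longrightarrow> \<exists>y. A' r y"
      and cont: "\<And>c. c \<in> Basis \<Longrightarrow> continuous_on {0<..<\<epsilon>} (sel c)"
      and "\<forall>c\<in>Basis. \<exists>s\<in>{1, - 1}. mono_on {0<..<\<epsilon>} (\<lambda>x. s * sel c x)"
      using eventually_happens'[OF trivial_limit_at_right_real] by (smt (verit, best))
    then obtain s where s: "\<And>c. c \<in> Basis \<Longrightarrow> s c \<in> {1, - 1 :: real}"
        and mono: "\<And>c. c \<in> Basis \<Longrightarrow> mono_on {0<..<\<epsilon>} (\<lambda>x. s c * sel c x)"
      by metis
    \<comment> \<open>The sign \<open>s c\<close> makes each coordinate nondecreasing, so an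
      increment of \<open>\<phi>\<close> is the sum of the absolute increments of the coordinates of
      \<open>X\<close>.\<close>
    define \<phi> where "\<phi> r = (\<Sum>c\<in>Basis. s c * sel c r)" for r
    have XA: "A r (X r)" if "r \<in> {0<..<\<epsilon>}" for r
      using A'(2) someI_ex[OF ex[OF that]] unfolding X_def by blast
    have sel: "sel c r = X r \<bullet> c" if "r \<in> {0<..<\<epsilon>}" for r c
      using ex[OF that] unfolding sel_def X_def by simp
    have mono\<phi>: "mono_on {0<..<\<epsilon>} \<phi>"
      unfolding \<phi>_def using mono by (auto intro!: mono_onI sum_mono dest: mono_onD)
    have len: "norm (X r - X r') \<le> \<phi> r - \<phi> r'" if "r \<in> {0<..<\<epsilon>}" "r' \<in> {0<..<\<epsilon>}" "r' \<le> r" for r r'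
    proof -
      have "norm (X r - X r') \<le> (\<Sum>c\<in>Basis. \<bar>(X r - X r') \<bullet> c\<bar>)" by (rule norm_le_l1)
      also have "\<dots> \<le> (\<Sum>c\<in>Basis. s c * sel c r - s c * sel c r')"
      proof (rule sum_mono)
        fix c :: 'b assume c: "c \<in> Basis"
        have "s c * sel c r' \<le> s c * sel c r" using mono_onD[OF mono[OF c] that(2,1,3)] .
        then show "\<bar>(X r - X r') \<bullet> c\<bar> \<le> s c * sel c r - s c * sel c r'"
          using s[OF c] sel[OF that(1)] sel[OF that(2)] by (auto simp: inner_diff_left)
      qed
      also have "\<dots> = \<phi> r - \<phi> r'" unfolding \<phi>_def by (simp add: sum_subtractf)
      finally show ?thesis .
    qed
    have len': "norm (X r' - X r) \<le> \<bar>\<phi> r - \<phi> r'\<bar>" if "r \<in> {0<..<\<epsilon>}" "r' \<in> {0<..<\<epsilon>}" for r r'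
      using len[OF that] len[OF that(2,1)] by (cases "r' \<le> r") (auto simp: norm_minus_commute)
    have "continuous_on {0<..<\<epsilon>} \<phi>"
      unfolding \<phi>_def by (intro continuous_intros cont)
    moreover have "bounded (\<phi> ` {0<..<\<epsilon>})"
    proof -
      obtain B where B: "\<And>p. p \<in> cbox a b \<Longrightarrow> norm p \<le> B"
        using bounded_cbox[of a b] unfolding bounded_iff by blast
      have "norm (\<phi> r) \<le> (\<Sum>c\<in>(Basis::'b set). B)" if r: "r \<in> {0<..<\<epsilon>}" for r
        unfolding \<phi>_def
      proof (rule sum_norm_le)
        fix c :: 'b assume c: "c \<in> Basis"
        have "X r \<in> cbox a b" using XA[OF r] unfolding A_def by blast
        then show "norm (s c * sel c r) \<le> B"
          using s[OF c] B Basis_le_norm[OF c, of "X r"] unfolding sel[OF r] by (force simp: abs_mult)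
      qed
      then show ?thesis unfolding bounded_iff by blast
    qed
    moreover have "\<bar>r - r'\<bar> \<le> (norm (G p) + L * \<bar>\<phi> r - \<phi> r'\<bar>) * \<bar>\<phi> r - \<phi> r'\<bar>"
      if p: "p \<in> cbox a b" "E p = es + r" and r: "r \<in> {0<..<\<epsilon>}" "r' \<in> {0<..<\<epsilon>}" for p r r'
    proof -
      have X: "X r \<in> cbox a b" "E (X r) = es + r" "norm (G (X r)) \<le> norm (G p)"
        "X r' \<in> cbox a b" "E (X r') = es + r'"
        using XA[OF r(1)] XA[OF r(2)] p unfolding A_def by auto
      \<comment> \<open>The increment is measured from \<open>X r\<close>, whose slope is at most
        that of any \<open>p\<close> in the box on the same level.\<close>
      have "\<bar>r - r'\<bar> = \<bar>E (X r') - E (X r)\<bar>" using X by simp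
      also have "\<dots> \<le> (norm (G (X r)) + L * norm (X r' - X r)) * norm (X r' - X r)"
        using L(2) X by blast
      also have "\<dots> \<le> (norm (G p) + L * \<bar>\<phi> r - \<phi> r'\<bar>) * \<bar>\<phi> r - \<phi> r'\<bar>"
        using X(3) len'[OF r] L(1) by (intro mult_mono add_mono) auto
      finally show ?thesis .
    qed
    ultimately show ?thesis using \<epsilon> mono\<phi> by blast
  qed
qed

end

section \<open>Calculus on the half-line\<close>

lemma at_within_half_line:
  fixes t :: real
  assumes "0 \<le> t" "t < T"
  shows "at t within {0..} = at t within {0..T}"
  by (rule at_within_nhd[of _ "{..<T}"]) (use assms in auto)

lemma at_within_half_line_pos:
  fixes t :: real
  assumes "0 < t"
  shows "at t within {0..} = at t"
  by (rule at_within_open_subset[of _ "{0<..}"]) (use assms in auto)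

lemma continuous_on_half_line:
  fixes u :: "real \<Rightarrow> 'b::topological_space"
  assumes "\<And>T. 0 \<le> T \<Longrightarrow> continuous_on {0..T} u"
  shows "continuous_on {0..} u"
  unfolding continuous_on_eq_continuous_within
proof
  fix t :: real assume t: "t \<in> {0..}"
  then have "continuous (at t within {0..t + 1}) u"
    using assms[of "t + 1"] unfolding continuous_on_eq_continuous_within by simp
  then show "continuous (at t within {0..}) u"
    using at_within_half_line[of t "t + 1"] t by simp
qed

lemma has_vector_derivative_integral_half_line:
  fixes g :: "real \<Rightarrow> 'b::banach"
  assumes "continuous_on {0..} g" "0 \<le> t"
  shows "((\<lambda>t. integral {0..t} g) has_vector_derivative g t) (at t within {0..})"
proof -
  have "continuous_on {0..t + 1} g" by (rule continuous_on_subset[OF assms(1)]) auto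
  from integral_has_vector_derivative[OF this, of t] show ?thesis
    using assms(2) at_within_half_line[of t "t + 1"] by simp
qed

lemma continuous_on_half_line_derivative:
  fixes x :: "real \<Rightarrow> 'b::real_normed_vector"
  assumes "\<And>t. 0 \<le> t \<Longrightarrow> (x has_vector_derivative x' t) (at t within {0..})"
  shows "continuous_on {0..} x"
  unfolding continuous_on_eq_continuous_within
  using assms has_vector_derivative_continuous by fastforce

text \<open>Monotone convergence along the truncations to \<open>{0..real k}\<close>.\<close>

lemma integrable_on_half_line:
  fixes g :: "real \<Rightarrow> real"
  assumes cont: "continuous_on {0..} g" and nn: "\<And>t. 0 \<le> t \<Longrightarrow> 0 \<le> g t"
    and B: "\<And>t. 0 \<le> t \<Longrightarrow> integral {0..t} g \<le> B"
  shows "g integrable_on {0..}"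
proof -
  let ?f = "\<lambda>(k::nat) t. if t \<in> {0..real k} then g t else 0"
  have int: "g integrable_on {0..real k}" for k
    by (intro integrable_continuous_real continuous_on_subset[OF cont]) auto
  have 1: "(?f k has_integral integral {0..real k} g) {0..}" for k
    using has_integral_restrict[of "{0..real k}" "{0..}" g] integrable_integral[OF int[of k]] by auto
  have "g integrable_on {0..} \<and> ((\<lambda>k. integral {0..} (?f k)) \<longlongrightarrow> integral {0..} g) sequentially"
  proof (rule monotone_convergence_increasing)
    show "?f k integrable_on {0..}" for k using 1 by blast
    show "?f k t \<le> ?f (Suc k) t" if "t \<in> {0..}" for k t using nn[of t] that by auto
    show "((\<lambda>k. ?f k t) \<longlongrightarrow> g t) sequentially" if "t \<in> {0..}" for t
    proof (rule tendsto_eventually)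
      obtain N where "t \<le> real N" using real_arch_simple by blast
      then show "eventually (\<lambda>k. ?f k t = g t) sequentially"
        using that by (intro eventually_sequentiallyI[of N]) auto
    qed
    have "norm (integral {0..} (?f k)) \<le> B" for k
      using integral_unique[OF 1[of k]] B[of "real k"] integral_nonneg[OF int[of k]] nn by auto
    then show "bounded (range (\<lambda>k. integral {0..} (?f k)))" unfolding bounded_iff by blast
  qed
  then show ?thesis by blast
qed

text \<open>The Lipschitz constant may grow with \<open>T\<close>, but the iterates \<open>P\<close>
  do not depend on \<open>T\<close>. One sequence on the whole half-line converges uniformly on each
  \<open>{0..T}\<close>, so the global solution arises at once, without gluing.\<close>

lemma picard_global:
  fixes F :: "real \<Rightarrow> 'z::euclidean_space \<Rightarrow> 'z"
  assumes cF: "\<And>u. continuous_on {0..} u \<Longrightarrow> continuous_on {0..} (\<lambda>s. F s (u s))"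
    and lip: "\<And>T. 0 \<le> T \<Longrightarrow> \<exists>L>0. \<forall>t\<in>{0..T}. \<forall>z w. norm (F t z - F t w) \<le> L * norm (z - w)"
  shows "\<exists>z. z 0 = z0 \<and> (\<forall>t\<ge>0. (z has_vector_derivative F t (z t)) (at t within {0..}))"
proof -
  define P where "P = rec_nat (\<lambda>_. z0) (\<lambda>_ u t. z0 + integral {0..t} (\<lambda>s. F s (u s)))"
  have P0: "P 0 t = z0" and PS: "P (Suc k) t = z0 + integral {0..t} (\<lambda>s. F s (P k s))" for k t
    unfolding P_def by simp_all
  have der_int: "((\<lambda>t. z0 + integral {0..t} (\<lambda>s. F s (u s))) has_vector_derivative F t (u t)) (at t within {0..})"
    if "continuous_on {0..} u" "0 \<le> t" for u t
    using has_vector_derivative_add[OF has_vector_derivative_const has_vector_derivative_integral_half_line[OF cF[OF that(1)] that(2)], of z0]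
    by simp
  have cP: "continuous_on {0..} (P k)" for k
  proof (induction k)
    case 0
    then show ?case by (simp add: P0[abs_def] continuous_on_const)
  next
    case (Suc k)
    show ?case unfolding PS[abs_def] by (rule continuous_on_half_line_derivative) (rule der_int[OF Suc])
  qed
  have derP: "(P (Suc k) has_vector_derivative F t (P k t)) (at t within {0..})" if "0 \<le> t" for k t
    unfolding PS[abs_def] by (rule der_int[OF cP that])
  \<comment> \<open>The limit of the iterates is written as a telescoping series, to which the
    Weierstrass test applies.\<close>
  define z where "z t = z0 + suminf (\<lambda>k. P (Suc k) t - P k t)" for t
  have unif: "uniform_limit {0..T} P z sequentially" if T: "0 \<le> T" for T
  proof -
    obtain L where L: "L > 0" "\<And>t z w. t \<in> {0..T} \<Longrightarrow> norm (F t z - F t w) \<le> L * norm (z - w)"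
      using lip[OF T] by blast
    have "compact ((\<lambda>t. P 1 t - P 0 t) ` {0..T})"
      by (intro compact_continuous_image continuous_intros continuous_on_subset[OF cP]) auto
    then have "bounded ((\<lambda>t. P 1 t - P 0 t) ` {0..T})" by (rule compact_imp_bounded)
    then obtain M where "\<forall>y\<in>(\<lambda>t. P 1 t - P 0 t) ` {0..T}. norm y \<le> M" unfolding bounded_iff by blast
    then have M: "norm (P 1 t - P 0 t) \<le> M" if "t \<in> {0..T}" for t using that by blast
    have M0: "0 \<le> M" using order_trans[OF norm_ge_zero M[of 0]] T by simp
    \<comment> \<open>In the weighted norm \<open>sup e\<^bsup>-2Lt\<^esup> |u(t)|\<close> the Picard operator contracts by \<open>1/2\<close>.\<close>
    have bd: "norm (P (Suc k) t - P k t) \<le> M * (1/2) ^ k * exp (2 * L * t)" if "t \<in> {0..T}" for k t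
      using that
    proof (induction k arbitrary: t)
      case 0
      have "norm (P 1 t - P 0 t) * 1 \<le> M * exp (2 * L * t)"
        using 0 M[of t] L(1) M0 by (intro mult_mono) auto
      then show ?case by simp
    next
      case (Suc k)
      show ?case
      proof (cases "t = 0")
        case True
        then show ?thesis using M0 by (simp add: PS)
      next
        case False
        then have t: "0 < t" using Suc.prems by auto
        let ?\<phi> = "\<lambda>t. M * (1/2) ^ Suc k * exp (2 * L * t)"
        have "norm ((P (Suc (Suc k)) t - P (Suc k) t) - (P (Suc (Suc k)) 0 - P (Suc k) 0)) \<le> ?\<phi> t - ?\<phi> 0"
        proof (rule differentiable_bound_general[OF t, where f' = "\<lambda>s. F s (P (Suc k) s) - F s (P k s)"
            and \<phi>' = "\<lambda>s. M * (1/2) ^ Suc k * (exp (2 * L * s) * (2 * L))"])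
          show "continuous_on {0..t} (\<lambda>t. P (Suc (Suc k)) t - P (Suc k) t)"
            by (intro continuous_intros continuous_on_subset[OF cP]) auto
          show "continuous_on {0..t} ?\<phi>" by (intro continuous_intros)
          fix s assume s: "0 < s" "s < t"
          show "((\<lambda>t. P (Suc (Suc k)) t - P (Suc k) t) has_vector_derivative F s (P (Suc k) s) - F s (P k s)) (at s)"
            using derP[of s "Suc k"] derP[of s k] s
            by (auto simp: at_within_half_line_pos intro!: has_vector_derivative_diff)
          show "(?\<phi> has_vector_derivative M * (1/2) ^ Suc k * (exp (2 * L * s) * (2 * L))) (at s)"
            unfolding has_real_derivative_iff_has_vector_derivative[symmetric]
            by (auto intro!: derivative_eq_intros)
          have "norm (F s (P (Suc k) s) - F s (P k s)) \<le> L * norm (P (Suc k) s - P k s)"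
            using L(2)[of s] s Suc.prems by auto
          also have "\<dots> \<le> L * (M * (1/2) ^ k * exp (2 * L * s))"
            using Suc.IH[of s] s Suc.prems L(1) by (intro mult_left_mono) auto
          also have "\<dots> = M * (1/2) ^ Suc k * (exp (2 * L * s) * (2 * L))" by simp
          finally show "norm (F s (P (Suc k) s) - F s (P k s)) \<le> \<dots>" .
        qed
        moreover have "0 \<le> ?\<phi> 0" using M0 by simp
        ultimately show ?thesis by (simp add: PS)
      qed
    qed
    have "uniform_limit {0..T} (\<lambda>n t. \<Sum>k<n. P (Suc k) t - P k t) (\<lambda>t. suminf (\<lambda>k. P (Suc k) t - P k t)) sequentially"
    proof (rule Weierstrass_m_test_ev[where M = "\<lambda>k. (M * exp (2 * L * T)) * (1/2) ^ k"])
      show "summable (\<lambda>k. (M * exp (2 * L * T)) * (1/2::real) ^ k)"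
        by (intro summable_mult summable_geometric) simp
      have "norm (P (Suc k) t - P k t) \<le> (M * exp (2 * L * T)) * (1/2) ^ k" if t: "t \<in> {0..T}" for k t
      proof -
        have "M * (1/2) ^ k * exp (2 * L * t) \<le> M * (1/2) ^ k * exp (2 * L * T)"
          using t L(1) M0 by (intro mult_left_mono) auto
        with bd[OF t, of k] show ?thesis by (simp add: mult_ac)
      qed
      then show "\<forall>\<^sub>F k in sequentially. \<forall>t\<in>{0..T}. norm (P (Suc k) t - P k t) \<le> (M * exp (2 * L * T)) * (1/2) ^ k"
        by (intro always_eventually) blast
    qed
    then have "uniform_limit {0..T} (\<lambda>n t. z0 + (\<Sum>k<n. P (Suc k) t - P k t)) z sequentially"
      unfolding z_def by (intro uniform_limit_intros)
    moreover have "z0 + (\<Sum>k<n. P (Suc k) t - P k t) = P n t" for n t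
      using sum_lessThan_telescope[of "\<lambda>k. P k t" n] by (simp add: P0)
    ultimately show ?thesis by simp
  qed
  have cz: "continuous_on {0..} z"
  proof (rule continuous_on_half_line)
    fix T :: real assume "0 \<le> T"
    show "continuous_on {0..T} z"
      by (rule uniform_limit_theorem[OF _ unif[OF \<open>0 \<le> T\<close>]])
        (auto intro!: always_eventually continuous_on_subset[OF cP])
  qed
  have zeq: "z t = z0 + integral {0..t} (\<lambda>s. F s (z s))" if t: "0 \<le> t" for t
  proof -
    obtain L where L: "L > 0" "\<And>s z w. s \<in> {0..t} \<Longrightarrow> norm (F s z - F s w) \<le> L * norm (z - w)"
      using lip[OF t] by blast
    have "uniform_limit {0..t} (\<lambda>n s. F s (P n s)) (\<lambda>s. F s (z s)) sequentially"
    proof (rule uniform_limitI)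
      fix e :: real assume "0 < e"
      then have "\<forall>\<^sub>F n in sequentially. \<forall>s\<in>{0..t}. dist (P n s) (z s) < e / L"
        using uniform_limitD[OF unif[OF t]] L(1) by simp
      then show "\<forall>\<^sub>F n in sequentially. \<forall>s\<in>{0..t}. dist (F s (P n s)) (F s (z s)) < e"
      proof eventually_elim
        case (elim n)
        show ?case
        proof
          fix s assume s: "s \<in> {0..t}"
          have "dist (F s (P n s)) (F s (z s)) \<le> L * dist (P n s) (z s)"
            using L(2)[OF s] by (simp add: dist_norm)
          also have "\<dots> < L * (e / L)" using elim s L(1) by (intro mult_strict_left_mono) auto
          finally show "dist (F s (P n s)) (F s (z s)) < e" using L(1) by simp
        qed
      qed
    qed
    then obtain I J where IJ: "\<And>n. ((\<lambda>s. F s (P n s)) has_integral I n) {0..t}"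
        "((\<lambda>s. F s (z s)) has_integral J) {0..t}" "I \<longlonglongrightarrow> J"
      by (rule uniform_limit_integral) (auto intro!: continuous_on_subset[OF cF[OF cP]])
    have "(\<lambda>n. z0 + I n) \<longlonglongrightarrow> z0 + J" by (intro tendsto_intros IJ(3))
    moreover have "z0 + I n = P (Suc n) t" for n using integral_unique[OF IJ(1)] by (simp add: PS)
    moreover have "(\<lambda>n. P (Suc n) t) \<longlonglongrightarrow> z t"
      using tendsto_uniform_limitI[OF unif[OF t]] t by (subst filterlim_sequentially_Suc) auto
    ultimately have "z t = z0 + J" using LIMSEQ_unique by simp
    then show ?thesis using integral_unique[OF IJ(2)] by simp
  qed
  have "(z has_vector_derivative F t (z t)) (at t within {0..})" if t: "0 \<le> t" for t
    by (rule has_vector_derivative_transform[OF _ _ der_int[OF cz t]]) (use t zeq in auto)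
  moreover have "z 0 = z0" using zeq[of 0] by simp
  ultimately show ?thesis by blast
qed

text \<open>The condition says that the upper right Dini derivative of \<open>W\<close> is
  nonpositive; it is meant for functions involving \<open>\<phi>\<close>, whose differentiability is
  not known. The last point at which \<open>W\<close> lies below the line of slope
  \<open>\<eta>\<close> through its initial value must be \<open>b\<close>, and
  \<open>\<eta>\<close> is arbitrary.\<close>

lemma dini_nonincreasing:
  fixes W :: "real \<Rightarrow> real"
  assumes "a \<le> b" and cont: "continuous_on {a..b} W"
    and dini: "\<And>t \<eta>. a \<le> t \<Longrightarrow> t < b \<Longrightarrow> 0 < \<eta> \<Longrightarrow> eventually (\<lambda>s. W s \<le> W t + \<eta> * (s - t)) (at_right t)"
  shows "W b \<le> W a"
proof -
  have main: "W b \<le> W a + \<eta> * (b - a)" if \<eta>: "0 < \<eta>" for \<eta>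
  proof (rule ccontr)
    assume nle: "\<not> W b \<le> W a + \<eta> * (b - a)"
    define Z where "Z = {t \<in> {a..b}. W t \<le> W a + \<eta> * (t - a)}"
    have "closed Z" unfolding Z_def
      by (intro continuous_on_closed_Collect_le cont continuous_intros)
    moreover have "a \<in> Z" using \<open>a \<le> b\<close> unfolding Z_def by auto
    moreover have bdd: "bdd_above Z" unfolding Z_def by (auto intro!: bdd_aboveI[of _ b])
    ultimately have s: "Sup Z \<in> Z" by (intro closed_contains_Sup) auto
    define s where "s = Sup Z"
    have s: "a \<le> s" "s \<le> b" "W s \<le> W a + \<eta> * (s - a)" using s unfolding s_def Z_def by auto
    moreover have "s \<noteq> b" using s nle by auto
    ultimately have sb: "s < b" by simp
    obtain u where u: "u > s" "\<And>y. s < y \<Longrightarrow> y < u \<Longrightarrow> W y \<le> W s + \<eta> * (y - s)"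
      using dini[OF s(1) sb \<eta>] unfolding eventually_at_right_field by blast
    obtain y where y: "s < y" "y < min u b" using dense[of s "min u b"] u sb by auto
    have "W y \<le> W a + \<eta> * (y - a)" using u(2)[of y] y s(3) by (simp add: algebra_simps)
    then have "y \<in> Z" using y s unfolding Z_def by auto
    then have "y \<le> s" unfolding s_def using bdd by (rule cSup_upper)
    then show False using y by simp
  qed
  show ?thesis
  proof (rule field_le_epsilon)
    fix e :: real assume "0 < e"
    have "e / (b - a + 1) * (b - a) \<le> e"
      using \<open>a \<le> b\<close> \<open>0 < e\<close> by (simp add: field_simps)
    with main[of "e / (b - a + 1)"] show "W b \<le> W a + e" using \<open>a \<le> b\<close> \<open>0 < e\<close> by fastforce
  qed
qed

section \<open>Global existence\<close>

locale isehd_system =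
  fixes f :: "'a::euclidean_space \<Rightarrow> real"
    and grad :: "'a \<Rightarrow> 'a"
    and hess :: "'a \<Rightarrow> 'a \<Rightarrow>\<^sub>L 'a"
    and \<gamma> :: "real \<Rightarrow> real"
    and c C \<beta> :: real
  assumes f_grad: "\<And>u. (f has_derivative (\<lambda>h. grad u \<bullet> h)) (at u)"
    and grad_hess: "\<And>u. (grad has_derivative blinfun_apply (hess u)) (at u)"
    and hess_cont: "continuous_on UNIV hess"
    and f_bdd: "bdd_below (range f)"
    and gamma_cont: "continuous_on {0..} \<gamma>"
    and c_pos: "0 < c" and c_le_C: "c \<le> C"
    and gamma_bounds: "\<And>t. t \<ge> 0 \<Longrightarrow> c \<le> \<gamma> t \<and> \<gamma> t \<le> C"
    and beta_pos: "0 < \<beta>" and beta_small: "\<beta> < 2 * c / C\<^sup>2"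
begin

text \<open>The coefficients left over in \<open>dissipation\<close> after completing the square:
  \<open>c / 4\<close> for the velocity and \<open>\<beta> / 3\<close> for the gradient.\<close>

definition \<delta> :: real where "\<delta> = min (c / 4) (\<beta> / 3)"

lemma delta_pos: "0 < \<delta>"
  using c_pos beta_pos unfolding \<delta>_def by simp

text \<open>From \<open>\<beta> * C^2 < 2 * c \<le> 2 * C\<close>, divided by
  \<open>C\<close>.\<close>

lemma beta_C: "\<beta> * C \<le> 2"
proof -
  have C: "0 < C" using c_pos c_le_C by linarith
  have "\<beta> * C\<^sup>2 < 2 * c" using beta_small C by (simp add: field_simps)
  then have "(\<beta> * C) * C \<le> 2 * C" using c_le_C by (simp add: power2_eq_square mult_ac)
  then show ?thesis using C by simp
qed

text \<open>With \<open>a = norm w\<close> and \<open>b = norm u\<close>, three quarters of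
  \<open>g * a^2\<close> and the mixed term are completed to the square
  \<open>g * (3 * a - 2 * \<beta> * b)^2 / 12\<close>. This costs
  \<open>\<beta> * g * (\<beta> / 3) * b^2\<close>, which is at most two thirds of
  \<open>\<beta> * b^2\<close> because \<open>\<beta> * g \<le> 2\<close>.\<close>

lemma dissipation:
  fixes w u :: 'a
  assumes "c \<le> g" "g \<le> C"
  shows "\<delta> * ((norm w)\<^sup>2 + (norm u)\<^sup>2) \<le> g * (norm w)\<^sup>2 + \<beta> * g * (u \<bullet> w) + \<beta> * (norm u)\<^sup>2"
proof -
  let ?a = "norm w" and ?b = "norm u"
  have g: "0 < g" using assms c_pos by linarith
  have "\<beta> * g \<le> 2" using beta_C mult_left_mono[OF assms(2), of \<beta>] beta_pos by linarith
  then have "(\<beta> * g) * (\<beta> / 3 * ?b\<^sup>2) \<le> 2 * (\<beta> / 3 * ?b\<^sup>2)"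
    using beta_pos by (intro mult_right_mono) auto
  moreover have "0 \<le> g * ((3 * ?a - 2 * \<beta> * ?b)\<^sup>2 / 12)" using g by simp
  moreover have "g * ((3 * ?a - 2 * \<beta> * ?b)\<^sup>2 / 12) = 3 / 4 * g * ?a\<^sup>2 - \<beta> * g * (?a * ?b) + (\<beta> * g) * (\<beta> / 3 * ?b\<^sup>2)"
    by (simp add: power2_eq_square field_simps)
  moreover have "- (\<beta> * g * (?a * ?b)) \<le> \<beta> * g * (u \<bullet> w)"
  proof -
    have "- (?a * ?b) \<le> u \<bullet> w" using Cauchy_Schwarz_ineq2[of u w] by (simp add: mult.commute abs_le_iff)
    then have "\<beta> * g * (- (?a * ?b)) \<le> \<beta> * g * (u \<bullet> w)" using beta_pos g by (intro mult_left_mono) auto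
    then show ?thesis by simp
  qed
  ultimately have "g / 4 * ?a\<^sup>2 + \<beta> / 3 * ?b\<^sup>2 \<le> g * ?a\<^sup>2 + \<beta> * g * (u \<bullet> w) + \<beta> * ?b\<^sup>2"
    by linarith
  moreover have "\<delta> * ?a\<^sup>2 \<le> g / 4 * ?a\<^sup>2" "\<delta> * ?b\<^sup>2 \<le> \<beta> / 3 * ?b\<^sup>2"
    using assms(1) unfolding \<delta>_def by (intro mult_right_mono; simp)+
  ultimately show ?thesis by (simp add: distrib_left)
qed

lemma continuous_on_grad: "continuous_on A grad"
  using grad_hess has_derivative_continuous by (blast intro: continuous_at_imp_continuous_on)

lemma continuous_on_f: "continuous_on A f"
  using f_grad has_derivative_continuous by (blast intro: continuous_at_imp_continuous_on)

lemma hess_bounded: "\<exists>B\<ge>0. \<forall>x\<in>cball p \<rho>. norm (hess x) \<le> B"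
proof -
  have "bounded (hess ` cball p \<rho>)"
    by (intro compact_imp_bounded compact_continuous_image continuous_on_subset[OF hess_cont]) auto
  then obtain B where B: "\<forall>y\<in>hess ` cball p \<rho>. norm y \<le> B" unfolding bounded_iff by blast
  have "\<forall>x\<in>cball p \<rho>. norm (hess x) \<le> max B 0" using B by (simp add: max.coboundedI1)
  then show ?thesis by (intro exI[of _ "max B 0"]) simp
qed

lemma grad_lipschitz: "\<exists>L\<ge>0. \<forall>x\<in>cball p \<rho>. \<forall>y\<in>cball p \<rho>. norm (grad x - grad y) \<le> L * norm (x - y)"
proof -
  obtain B where B: "B \<ge> 0" "\<And>x. x \<in> cball p \<rho> \<Longrightarrow> norm (hess x) \<le> B" using hess_bounded by blast
  have "norm (grad x - grad y) \<le> B * norm (x - y)" if "x \<in> cball p \<rho>" "y \<in> cball p \<rho>" for x y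
    by (rule differentiable_bound[of "cball p \<rho>" grad "\<lambda>x. blinfun_apply (hess x)"])
      (use that B(2) in \<open>auto intro: has_derivative_at_withinI[OF grad_hess] simp: norm_blinfun.rep_eq[symmetric]\<close>)
  then show ?thesis using B(1) by blast
qed

text \<open>The term \<open>grad (x t) \<bullet> w\<close> from \<open>f\<close> cancels against its
  negative in the derivative of the kinetic part, and no Hessian appears. The evolution of
  \<open>v\<close> is assumed only at the single time \<open>t\<close>, so the computation serves
  the truncated system before exit as well as a given solution.\<close>

lemma energy_derivative:
  assumes x: "(x has_vector_derivative w) (at t within S)"
    and v: "(v has_vector_derivative - (\<gamma> t *\<^sub>R w) - grad (x t)) (at t within S)"
    and vt: "v t = w + \<beta> *\<^sub>R grad (x t)"
  shows "((\<lambda>t. f (x t) + (norm (v t))\<^sup>2 / 2) has_real_derivative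
     - (\<gamma> t * (norm w)\<^sup>2 + \<beta> * \<gamma> t * (grad (x t) \<bullet> w) + \<beta> * (norm (grad (x t)))\<^sup>2)) (at t within S)"
proof -
  have fx: "((\<lambda>t. f (x t)) has_derivative (\<lambda>k. grad (x t) \<bullet> (k *\<^sub>R w))) (at t within S)"
    using has_derivative_compose[OF x[unfolded has_vector_derivative_def] f_grad] .
  have vv: "((\<lambda>t. (v t \<bullet> v t) / 2) has_derivative
      (\<lambda>k. (v t \<bullet> (k *\<^sub>R (- (\<gamma> t *\<^sub>R w) - grad (x t))) + (k *\<^sub>R (- (\<gamma> t *\<^sub>R w) - grad (x t))) \<bullet> v t) / 2)) (at t within S)"
    using v[unfolded has_vector_derivative_def] by (auto intro!: derivative_eq_intros)
  have "((\<lambda>t. f (x t) + (norm (v t))\<^sup>2 / 2) has_derivative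
      (\<lambda>k. grad (x t) \<bullet> (k *\<^sub>R w) + (v t \<bullet> (k *\<^sub>R (- (\<gamma> t *\<^sub>R w) - grad (x t))) + (k *\<^sub>R (- (\<gamma> t *\<^sub>R w) - grad (x t))) \<bullet> v t) / 2)) (at t within S)"
    unfolding power2_norm_eq_inner by (rule has_derivative_add[OF fx vv])
  then show ?thesis
    unfolding has_field_derivative_def
    by (rule has_derivative_eq_rhs)
      (rule ext, simp add: vt algebra_simps inner_add_left inner_diff_left inner_add_right inner_diff_right
         inner_commute power2_norm_eq_inner, simp add: field_simps)
qed

lemma global_solution:
  obtains x v where "x 0 = x0" "v 0 = v0 + \<beta> *\<^sub>R grad x0"
    "\<And>t. 0 \<le> t \<Longrightarrow> (x has_vector_derivative v t - \<beta> *\<^sub>R grad (x t)) (at t within {0..})"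
    "\<And>t. 0 \<le> t \<Longrightarrow> (v has_vector_derivative - (\<gamma> t *\<^sub>R (v t - \<beta> *\<^sub>R grad (x t))) - grad (x t)) (at t within {0..})"
proof -
  define E0 where "E0 = f x0 + (norm (v0 + \<beta> *\<^sub>R grad x0))\<^sup>2 / 2"
  obtain m where m: "\<And>u. m \<le> f u" using f_bdd unfolding bdd_below_def by blast
  \<comment> \<open>\<open>Q\<close> bounds the integral of the squared speed: it is the largest
    possible energy drop divided by \<open>\<delta>\<close>. By
    \<open>2 * norm w \<le> 1 + norm w ^ 2\<close>, the displacement up to time \<open>t\<close> is
    then at most \<open>(t + Q) / 2\<close>.\<close>
  define Q where "Q = (E0 - m) / \<delta>"
  have "m \<le> E0" unfolding E0_def using m[of x0] by (simp add: add_increasing2)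
  then have Q: "0 \<le> Q" unfolding Q_def using delta_pos by simp
  \<comment> \<open>The energy estimate confines every solution to the ball of radius \<open>R t - 1\<close> at time \<open>t\<close>, so the
    gradient may be frozen outside the ball of radius \<open>R t\<close>; the field becomes globally Lipschitz.\<close>
  define R where "R t = (t + Q) / 2 + 1" for t :: real
  have R: "0 < R t" if "0 \<le> t" for t
    using add_nonneg_nonneg[OF that Q] by (simp add: R_def add_nonneg_pos)
  \<comment> \<open>Projection onto a fixed unit ball, conjugated by scaling, gives the projection
    \<open>p t\<close> onto the ball of radius \<open>R t\<close> about \<open>x0\<close>. It is
    nonexpansive in space, and its continuity in \<open>t\<close> is inherited from
    \<open>R\<close>.\<close>
  define \<pi> where "\<pi> = closest_point (cball (0::'a) 1)"
  have \<pi>_in: "norm (\<pi> y) \<le> 1" for y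
    using closest_point_in_set[of "cball (0::'a) 1" y] unfolding \<pi>_def by simp
  have \<pi>_lip: "norm (\<pi> y - \<pi> z) \<le> norm (y - z)" for y z
    using closest_point_lipschitz[of "cball (0::'a) 1" y z] unfolding \<pi>_def dist_norm by simp
  have \<pi>_self: "\<pi> y = y" if "norm y \<le> 1" for y
    unfolding \<pi>_def by (rule closest_point_self) (use that in simp)
  have \<pi>_cont: "continuous_on A \<pi>" for A
    unfolding \<pi>_def by (rule continuous_on_closest_point) auto
  define p where "p t y = x0 + R t *\<^sub>R \<pi> ((1 / R t) *\<^sub>R (y - x0))" for t y
  have p_self: "p t y = y" if "0 \<le> t" "norm (y - x0) \<le> R t" for t y
  proof -
    have "norm ((1 / R t) *\<^sub>R (y - x0)) \<le> 1" using that R[of t] by (simp add: divide_le_eq_1)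
    then show ?thesis using R[of t] that(1) unfolding p_def by (simp add: \<pi>_self)
  qed
  define F where "F t z = (snd z - \<beta> *\<^sub>R grad (p t (fst z)),
     - (\<gamma> t *\<^sub>R (snd z - \<beta> *\<^sub>R grad (p t (fst z)))) - grad (p t (fst z)))" for t and z :: "'a \<times> 'a"
  have "\<exists>z. z 0 = (x0, v0 + \<beta> *\<^sub>R grad x0) \<and> (\<forall>t\<ge>0. (z has_vector_derivative F t (z t)) (at t within {0..}))"
  proof (rule picard_global)
    fix u :: "real \<Rightarrow> 'a \<times> 'a" assume u: "continuous_on {0..} u"
    have cR: "continuous_on {0..} R" unfolding R_def by (intro continuous_intros) auto
    have "continuous_on {0..} (\<lambda>s. p s (fst (u s)))"
      unfolding p_def
      by (intro continuous_intros cR u continuous_on_compose2[OF \<pi>_cont[of UNIV]]) (use R in force)+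
    then have "continuous_on {0..} (\<lambda>s. grad (p s (fst (u s))))"
      by (intro continuous_on_compose2[OF continuous_on_grad[of UNIV]]) auto
    then show "continuous_on {0..} (\<lambda>s. F s (u s))"
      unfolding F_def by (intro continuous_intros u gamma_cont)
  next
    fix T :: real assume T: "0 \<le> T"
    obtain L where L: "L \<ge> 0" "\<And>x y. x \<in> cball x0 (R T) \<Longrightarrow> y \<in> cball x0 (R T) \<Longrightarrow> norm (grad x - grad y) \<le> L * norm (x - y)"
      using grad_lipschitz by blast
    have C: "0 < C" using c_pos c_le_C by linarith
    have p_lip: "norm (grad (p t y) - grad (p t z)) \<le> L * norm (y - z)" if t: "t \<in> {0..T}" for t y z
    proof -
      have Rt: "0 < R t" "R t \<le> R T" using t R[of t] unfolding R_def by auto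
      have in_ball: "p t y \<in> cball x0 (R T)" for y
      proof -
        have "norm (R t *\<^sub>R \<pi> ((1 / R t) *\<^sub>R (y - x0))) \<le> R T * 1"
          using Rt \<pi>_in[of "(1 / R t) *\<^sub>R (y - x0)"] unfolding norm_scaleR by (intro mult_mono) auto
        then show ?thesis unfolding p_def by (simp add: dist_norm)
      qed
      have "norm (p t y - p t z) = R t * norm (\<pi> ((1 / R t) *\<^sub>R (y - x0)) - \<pi> ((1 / R t) *\<^sub>R (z - x0)))"
        unfolding p_def using Rt by (simp add: scaleR_diff_right[symmetric])
      also have "\<dots> \<le> R t * norm ((1 / R t) *\<^sub>R (y - x0) - (1 / R t) *\<^sub>R (z - x0))"
        using Rt by (intro mult_left_mono \<pi>_lip) auto
      also have "\<dots> = norm (y - z)" using Rt by (simp add: scaleR_diff_right[symmetric])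
      finally have "L * norm (p t y - p t z) \<le> L * norm (y - z)" using L(1) by (intro mult_left_mono)
      then show ?thesis using L(2)[OF in_ball in_ball, of y z] by linarith
    qed
    show "\<exists>L>0. \<forall>t\<in>{0..T}. \<forall>z w. norm (F t z - F t w) \<le> L * norm (z - w)"
    proof (intro exI[of _ "(1 + C) * (1 + \<beta> * L) + L"] conjI ballI allI)
      show "0 < (1 + C) * (1 + \<beta> * L) + L"
        using C L(1) beta_pos by (intro add_pos_nonneg mult_pos_pos) (auto simp: add_pos_nonneg)
      fix t and z w :: "'a \<times> 'a" assume t: "t \<in> {0..T}"
      let ?N = "norm (z - w)"
      let ?g = "grad (p t (fst z)) - grad (p t (fst w))"
      have d: "norm (snd z - snd w) \<le> ?N" "norm (fst z - fst w) \<le> ?N"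
        using norm_snd_le[of "snd (z - w)" "fst (z - w)"] norm_fst_le[of "fst (z - w)" "snd (z - w)"]
        unfolding prod.collapse by simp_all
      have g: "norm ?g \<le> L * ?N"
        using p_lip[OF t, of "fst z" "fst w"] mult_left_mono[OF d(2) L(1)] by linarith
      define a where "a = (snd z - snd w) - \<beta> *\<^sub>R ?g"
      have "norm a \<le> norm (snd z - snd w) + \<beta> * norm ?g"
        using norm_triangle_ineq4[of "snd z - snd w" "\<beta> *\<^sub>R ?g"] beta_pos unfolding a_def by simp
      also have "\<dots> \<le> ?N + \<beta> * (L * ?N)"
        using d(1) mult_left_mono[OF g, of \<beta>] beta_pos by linarith
      finally have a: "norm a \<le> (1 + \<beta> * L) * ?N" by (simp add: algebra_simps)
      have \<gamma>: "0 \<le> \<gamma> t" "\<gamma> t \<le> C" using gamma_bounds[of t] t c_pos by auto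
      have "norm (- (\<gamma> t *\<^sub>R a) - ?g) \<le> norm (\<gamma> t *\<^sub>R a) + norm ?g"
        using norm_triangle_ineq4[of "- (\<gamma> t *\<^sub>R a)" ?g] by simp
      also have "\<dots> \<le> C * ((1 + \<beta> * L) * ?N) + L * ?N"
        using mult_mono[OF \<gamma>(2) a] \<gamma> C g by (intro add_mono) auto
      finally have b: "norm (- (\<gamma> t *\<^sub>R a) - ?g) \<le> C * ((1 + \<beta> * L) * ?N) + L * ?N" .
      have "F t z - F t w = (a, - (\<gamma> t *\<^sub>R a) - ?g)"
        unfolding F_def a_def by (simp add: algebra_simps)
      then have "norm (F t z - F t w) \<le> norm a + norm (- (\<gamma> t *\<^sub>R a) - ?g)"
        using norm_Pair_le[of a "- (\<gamma> t *\<^sub>R a) - ?g"] by simp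
      then show "norm (F t z - F t w) \<le> ((1 + C) * (1 + \<beta> * L) + L) * ?N"
        using a b by (simp add: algebra_simps)
    qed
  qed
  then obtain z where z0: "z 0 = (x0, v0 + \<beta> *\<^sub>R grad x0)"
    and z: "\<And>t. 0 \<le> t \<Longrightarrow> (z has_vector_derivative F t (z t)) (at t within {0..})" by blast
  define x where "x t = fst (z t)" for t
  define v where "v t = snd (z t)" for t
  have dx: "(x has_vector_derivative v t - \<beta> *\<^sub>R grad (p t (x t))) (at t within {0..})" if "0 \<le> t" for t
    using has_derivative_fst[OF z[OF that, unfolded has_vector_derivative_def]]
    unfolding has_vector_derivative_def x_def v_def F_def by simp
  have dv: "(v has_vector_derivative - (\<gamma> t *\<^sub>R (v t - \<beta> *\<^sub>R grad (p t (x t)))) - grad (p t (x t))) (at t within {0..})"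
    if "0 \<le> t" for t
    using has_derivative_snd[OF z[OF that, unfolded has_vector_derivative_def]]
    unfolding has_vector_derivative_def x_def v_def F_def by simp
  have init: "x 0 = x0" "v 0 = v0 + \<beta> *\<^sub>R grad x0" using z0 unfolding x_def v_def by auto
  have cx: "continuous_on {0..} x" by (rule continuous_on_half_line_derivative[OF dx])
  have cv: "continuous_on {0..} v" by (rule continuous_on_half_line_derivative[OF dv])
  have inside: "norm (x t - x0) < R t" if "0 \<le> t" for t
  proof (rule ccontr)
    assume nlt: "\<not> norm (x t - x0) < R t"
    define Z where "Z = {s \<in> {0..}. R s \<le> norm (x s - x0)}"
    \<comment> \<open>The first time at which the cutoff radius is reached; before it
      \<open>p\<close> fixes the trajectory and the energy estimate applies.\<close>
    define s where "s = Inf Z"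
    have "closed Z" unfolding Z_def R_def
      by (intro continuous_on_closed_Collect_le continuous_intros cx) auto
    moreover have "t \<in> Z" using nlt that unfolding Z_def by simp
    moreover have bdd: "bdd_below Z" unfolding Z_def by (auto intro!: bdd_belowI[of _ 0])
    ultimately have "s \<in> Z" unfolding s_def by (intro closed_contains_Inf) auto
    then have s: "0 \<le> s" "R s \<le> norm (x s - x0)" unfolding Z_def by auto
    have "s \<noteq> 0" using s(2) R[of 0] init by auto
    then have s0: "0 < s" using s by simp
    have before: "norm (x r - x0) \<le> R r" if r: "0 \<le> r" "r < s" for r
    proof (rule ccontr)
      assume "\<not> ?thesis"
      then have "r \<in> Z" using r unfolding Z_def by simp
      then have "s \<le> r" unfolding s_def using bdd by (rule cInf_lower)
      then show False using r by simp
    qed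
    let ?E = "\<lambda>t. f (x t) + (norm (v t))\<^sup>2 / 2"
    let ?w = "\<lambda>t. v t - \<beta> *\<^sub>R grad (x t)"
    let ?e = "\<lambda>t. \<gamma> t * (norm (?w t))\<^sup>2 + \<beta> * \<gamma> t * (grad (x t) \<bullet> ?w t) + \<beta> * (norm (grad (x t)))\<^sup>2"
    \<comment> \<open>The comparison function has derivative
      \<open>(1 + ?e t / \<delta>) / 2\<close>. This dominates the speed, since
      \<open>\<delta>\<close> times the squared speed is at most the dissipation
      \<open>?e t\<close>.\<close>
    have "norm (x s - x 0) \<le> (s - ?E s / \<delta>) / 2 - (0 - ?E 0 / \<delta>) / 2"
    proof (rule differentiable_bound_general[OF s0, where f' = ?w and \<phi>' = "\<lambda>t. (1 + ?e t / \<delta>) / 2"])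
      show "continuous_on {0..s} x" by (rule continuous_on_subset[OF cx]) auto
      show "continuous_on {0..s} (\<lambda>s. (s - ?E s / \<delta>) / 2)"
        using delta_pos
        by (intro continuous_intros continuous_on_compose2[OF continuous_on_f[of UNIV]]
            continuous_on_subset[OF cx] continuous_on_subset[OF cv]) auto
      fix r assume r: "0 < r" "r < s"
      have pr: "p r (x r) = x r" using p_self[of r "x r"] before[of r] r by simp
      have at: "at r within {0..} = at r" using r by (simp add: at_within_half_line_pos)
      show dxr: "(x has_vector_derivative ?w r) (at r)"
        using dx[of r] r unfolding pr at by simp
      have "(v has_vector_derivative - (\<gamma> r *\<^sub>R ?w r) - grad (x r)) (at r)"
        using dv[of r] r unfolding pr at by simp
      from energy_derivative[OF dxr this]
      have "(?E has_real_derivative - ?e r) (at r)" by simp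
      then have "((\<lambda>s. (s - ?E s / \<delta>) / 2) has_real_derivative (1 - (- ?e r) / \<delta>) / 2) (at r)"
        by (intro derivative_intros DERIV_cdivide DERIV_ident)
      moreover have "(1 - (- a) / \<delta>) / 2 = (1 + a / \<delta>) / 2" for a by simp
      ultimately show "((\<lambda>s. (s - ?E s / \<delta>) / 2) has_vector_derivative (1 + ?e r / \<delta>) / 2) (at r)"
        by (simp only: has_real_derivative_iff_has_vector_derivative)
      have "\<delta> * (norm (?w r))\<^sup>2 \<le> ?e r"
        using dissipation[of "\<gamma> r" "?w r" "grad (x r)"] gamma_bounds[of r] r delta_pos
        by (smt (verit, best) distrib_left mult_nonneg_nonneg zero_le_power2)
      then have "(norm (?w r))\<^sup>2 \<le> ?e r / \<delta>" using delta_pos by (simp add: field_simps)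
      moreover have "2 * norm (?w r) \<le> 1 + (norm (?w r))\<^sup>2"
        using sum_squares_bound[of "norm (?w r)" 1] by simp
      ultimately show "norm (?w r) \<le> (1 + ?e r / \<delta>) / 2" by simp
    qed
    also have "\<dots> = (s + (?E 0 - ?E s) / \<delta>) / 2"
      unfolding diff_divide_distrib[of "?E 0" "?E s" \<delta>] by (simp add: diff_divide_distrib add_divide_distrib)
    also have "\<dots> \<le> (s + Q) / 2"
    proof -
      have "m \<le> ?E s" using m[of "x s"] by (simp add: add_increasing2)
      then have "(?E 0 - ?E s) / \<delta> \<le> Q"
        unfolding Q_def E0_def init using delta_pos by (intro divide_right_mono) auto
      then show ?thesis by (intro divide_right_mono add_left_mono) auto
    qed
    finally show False using s(2) unfolding init R_def by (simp add: field_simps)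
  qed
  have pt: "p t (x t) = x t" if "0 \<le> t" for t
    using p_self[OF that] inside[OF that] by simp
  show thesis
    by (rule that[of x v]) (use init dx dv pt in auto)
qed

lemma has_vector_derivative_grad:
  assumes "(x has_vector_derivative w) (at t within S)"
  shows "((\<lambda>t. grad (x t)) has_vector_derivative blinfun_apply (hess (x t)) w) (at t within S)"
  using has_derivative_compose[OF assms[unfolded has_vector_derivative_def] grad_hess]
  unfolding has_vector_derivative_def by (simp add: blinfun.scaleR_right)

lemma isehd_solution_exists: "\<exists>x x' x''. isehd_solution grad hess \<gamma> \<beta> x0 v0 x x' x''"
proof -
  obtain x v where init: "x 0 = x0" "v 0 = v0 + \<beta> *\<^sub>R grad x0"
    and dx: "\<And>t. 0 \<le> t \<Longrightarrow> (x has_vector_derivative v t - \<beta> *\<^sub>R grad (x t)) (at t within {0..})"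
    and dv: "\<And>t. 0 \<le> t \<Longrightarrow> (v has_vector_derivative - (\<gamma> t *\<^sub>R (v t - \<beta> *\<^sub>R grad (x t))) - grad (x t)) (at t within {0..})"
    using global_solution by blast
  define x' where "x' t = v t - \<beta> *\<^sub>R grad (x t)" for t
  \<comment> \<open>The equation solved for the acceleration, at time 0 as well, which gives
    continuity of \<open>x''\<close> on the closed half-line.\<close>
  define x'' where "x'' t = - (\<gamma> t *\<^sub>R x' t) - grad (x t) - \<beta> *\<^sub>R blinfun_apply (hess (x t)) (x' t)" for t
  have cx: "continuous_on {0..} x" by (rule continuous_on_half_line_derivative[OF dx])
  have cv: "continuous_on {0..} v" by (rule continuous_on_half_line_derivative[OF dv])
  have cg: "continuous_on {0..} (\<lambda>t. grad (x t))"
    by (rule continuous_on_compose2[OF continuous_on_grad[of UNIV] cx]) auto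
  have ch: "continuous_on {0..} (\<lambda>t. hess (x t))"
    by (rule continuous_on_compose2[OF hess_cont cx]) auto
  have cx': "continuous_on {0..} x'" unfolding x'_def by (intro continuous_intros cv cg)
  have "continuous_on {0..} x''"
    unfolding x''_def by (intro continuous_intros cx' cg ch gamma_cont)
  moreover have "(x' has_vector_derivative x'' t) (at t within {0..})" if "0 \<le> t" for t
    unfolding x'_def x''_def
    by (rule has_vector_derivative_diff[OF dv[OF that]
         has_vector_derivative_scaleR[OF DERIV_const has_vector_derivative_grad[OF dx[OF that]], of \<beta>, simplified]])
  ultimately have "isehd_solution grad hess \<gamma> \<beta> x0 v0 x x' x''"
    unfolding isehd_solution_def using dx init by (auto simp: x'_def x''_def)
  then show ?thesis by blast
qed

end

section \<open>Energy decay\<close>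

locale isehd_trajectory = isehd_system f grad hess \<gamma> c C \<beta>
  for f :: "'a::euclidean_space \<Rightarrow> real" and grad hess \<gamma> c C \<beta> +
  fixes x0 v0 :: 'a and x x' x'' :: "real \<Rightarrow> 'a"
  assumes sol: "isehd_solution grad hess \<gamma> \<beta> x0 v0 x x' x''"
begin

definition v :: "real \<Rightarrow> 'a" where "v t = x' t + \<beta> *\<^sub>R grad (x t)"
definition E :: "real \<Rightarrow> real" where "E t = f (x t) + (norm (v t))\<^sup>2 / 2"
definition h :: "real \<Rightarrow> real" where "h t = (norm (x' t))\<^sup>2 + (norm (grad (x t)))\<^sup>2"

lemma dx: "0 \<le> t \<Longrightarrow> (x has_vector_derivative x' t) (at t within {0..})"
  and dx': "0 \<le> t \<Longrightarrow> (x' has_vector_derivative x'' t) (at t within {0..})"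
  and ode: "0 < t \<Longrightarrow> x'' t + \<gamma> t *\<^sub>R x' t + \<beta> *\<^sub>R blinfun_apply (hess (x t)) (x' t) + grad (x t) = 0"
  using sol unfolding isehd_solution_def by auto

lemma dx_at: "0 < t \<Longrightarrow> (x has_vector_derivative x' t) (at t)"
  and dx'_at: "0 < t \<Longrightarrow> (x' has_vector_derivative x'' t) (at t)"
  using dx[of t] dx'[of t] at_within_half_line_pos[of t] by auto

lemma cx: "continuous_on {0..} x" and cx': "continuous_on {0..} x'"
  by (rule continuous_on_half_line_derivative; rule dx dx'; assumption)+

lemma cg: "continuous_on {0..} (\<lambda>t. grad (x t))"
  by (rule continuous_on_compose2[OF continuous_on_grad[of UNIV] cx]) auto

lemma cE: "continuous_on {0..} E"
  unfolding E_def v_def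
  by (intro continuous_intros continuous_on_compose2[OF continuous_on_f[of UNIV]] cx cx' cg) auto

lemma ch: "continuous_on {0..} h"
  unfolding h_def by (intro continuous_intros cx' cg)

lemma h_nonneg: "0 \<le> h t"
  unfolding h_def by simp

lemma energy_dissipation:
  assumes "0 < t"
  obtains e where "(E has_real_derivative e) (at t)" "e \<le> - \<delta> * h t"
proof -
  have "(v has_vector_derivative x'' t + \<beta> *\<^sub>R blinfun_apply (hess (x t)) (x' t)) (at t)"
    unfolding v_def
    by (rule has_vector_derivative_add[OF dx'_at[OF assms]
         has_vector_derivative_scaleR[OF DERIV_const has_vector_derivative_grad[OF dx_at[OF assms]], of \<beta>, simplified]])
  moreover have "x'' t + \<beta> *\<^sub>R blinfun_apply (hess (x t)) (x' t) = - (\<gamma> t *\<^sub>R x' t) - grad (x t)"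
    using ode[OF assms] by (simp add: algebra_simps eq_neg_iff_add_eq_0)
  ultimately have "(v has_vector_derivative - (\<gamma> t *\<^sub>R x' t) - grad (x t)) (at t)" by simp
  from energy_derivative[OF dx_at[OF assms] this v_def]
  have "(E has_real_derivative - (\<gamma> t * (norm (x' t))\<^sup>2 + \<beta> * \<gamma> t * (grad (x t) \<bullet> x' t) + \<beta> * (norm (grad (x t)))\<^sup>2)) (at t)"
    unfolding E_def[abs_def] .
  moreover have "- (\<gamma> t * (norm (x' t))\<^sup>2 + \<beta> * \<gamma> t * (grad (x t) \<bullet> x' t) + \<beta> * (norm (grad (x t)))\<^sup>2) \<le> - \<delta> * h t"
    using dissipation[of "\<gamma> t" "x' t" "grad (x t)"] gamma_bounds[of t] assms unfolding h_def by simp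
  ultimately show thesis by (rule that)
qed

lemma energy_decrease:
  assumes "0 \<le> s" "s \<le> t"
  shows "E t + \<delta> * integral {s..t} h \<le> E s"
proof -
  define H where "H t = integral {0..t} h" for t
  have dH: "(H has_vector_derivative h r) (at r within {0..})" if "0 \<le> r" for r
    unfolding H_def by (rule has_vector_derivative_integral_half_line[OF ch that])
  have cH: "continuous_on {0..} H" by (rule continuous_on_half_line_derivative[OF dH])
  have "E t + \<delta> * H t \<le> E s + \<delta> * H s"
  proof (rule DERIV_nonpos_imp_decreasing_open[OF assms(2)])
    show "continuous_on {s..t} (\<lambda>r. E r + \<delta> * H r)"
      using assms by (intro continuous_intros continuous_on_subset[OF cE] continuous_on_subset[OF cH]) auto
    fix r assume "s < r" "r < t"
    then have r: "0 < r" using assms by simp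
    obtain e where e: "(E has_real_derivative e) (at r)" "e \<le> - \<delta> * h r"
      using energy_dissipation[OF r] .
    have "(H has_real_derivative h r) (at r)"
      using dH[of r] r at_within_half_line_pos[OF r] by (simp add: has_real_derivative_iff_has_vector_derivative)
    then have "((\<lambda>r. E r + \<delta> * H r) has_real_derivative e + \<delta> * h r) (at r)"
      by (intro DERIV_add e DERIV_cmult)
    then show "\<exists>y. ((\<lambda>r. E r + \<delta> * H r) has_real_derivative y) (at r) \<and> y \<le> 0" using e(2) by auto
  qed
  moreover have "H s + integral {s..t} h = H t"
    unfolding H_def using assms
    by (intro Henstock_Kurzweil_Integration.integral_combine integrable_continuous_real continuous_on_subset[OF ch]) auto
  then have "H t = H s + integral {s..t} h" by simp
  ultimately show ?thesis by (simp add: distrib_left)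
qed

lemma energy_antimono: "0 \<le> s \<Longrightarrow> s \<le> t \<Longrightarrow> E t \<le> E s"
proof -
  assume st: "0 \<le> s" "s \<le> t"
  have "h integrable_on {s..t}"
    using st by (intro integrable_continuous_real continuous_on_subset[OF ch]) auto
  then have "0 \<le> integral {s..t} h" by (rule integral_nonneg) (rule h_nonneg)
  then have "0 \<le> \<delta> * integral {s..t} h" using delta_pos by simp
  then show ?thesis using energy_decrease[OF st] by linarith
qed

text \<open>Both integrands are at most \<open>h\<close>, and the integral of \<open>h\<close> is at
  most the energy that can be lost, divided by \<open>\<delta>\<close>.\<close>

lemma square_integrable:
  shows "(\<lambda>t. (norm (grad (x t)))\<^sup>2) integrable_on {0..}" "(\<lambda>t. (norm (x' t))\<^sup>2) integrable_on {0..}"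
proof -
  obtain m where m: "\<And>u. m \<le> f u" using f_bdd unfolding bdd_below_def by blast
  have int: "g integrable_on {0..}" if g: "continuous_on {0..} g" "\<And>t. 0 \<le> g t" "\<And>t. g t \<le> h t" for g
  proof (rule integrable_on_half_line[OF g(1,2)])
    fix t :: real assume t: "0 \<le> t"
    have "integral {0..t} g \<le> integral {0..t} h"
      by (intro integral_le integrable_continuous_real continuous_on_subset[OF g(1)] continuous_on_subset[OF ch] g(3)) auto
    moreover have "m \<le> E t" unfolding E_def using m[of "x t"] by (simp add: add_increasing2)
    then have "\<delta> * integral {0..t} h \<le> E 0 - m" using energy_decrease[OF order_refl t] by simp
    then have "integral {0..t} h \<le> (E 0 - m) / \<delta>" using delta_pos by (simp add: field_simps)
    ultimately show "integral {0..t} g \<le> (E 0 - m) / \<delta>" by linarith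
  qed
  show "(\<lambda>t. (norm (grad (x t)))\<^sup>2) integrable_on {0..}" "(\<lambda>t. (norm (x' t))\<^sup>2) integrable_on {0..}"
    by (rule int; (intro continuous_intros cx' cg)?; simp add: h_def)+
qed

lemma energy_converges:
  obtains Einf where "(E \<longlongrightarrow> Einf) at_top" "\<And>t. 0 \<le> t \<Longrightarrow> Einf \<le> E t"
proof -
  obtain m where m: "\<And>u. m \<le> f u" using f_bdd unfolding bdd_below_def by blast
  have mE: "m \<le> E t" for t unfolding E_def using m[of "x t"] by (simp add: add_increasing2)
  define Einf where "Einf = Inf (E ` {0..})"
  have bdd: "bdd_below (E ` {0..})" using mE by (auto intro!: bdd_belowI[of _ m])
  have low: "Einf \<le> E t" if "0 \<le> t" for t
    unfolding Einf_def by (rule cInf_lower[OF _ bdd]) (use that in auto)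
  have "(E \<longlongrightarrow> Einf) at_top"
  proof (rule decreasing_tendsto)
    show "eventually (\<lambda>t. Einf \<le> E t) at_top"
      by (rule eventually_mono[OF eventually_ge_at_top[of 0]]) (rule low)
    fix y assume "Einf < y"
    then obtain s where s: "0 \<le> s" "E s < y"
      using cInf_lessD[of "E ` {0..}" y] unfolding Einf_def by auto
    have "eventually (\<lambda>t. s \<le> t) at_top" by (rule eventually_ge_at_top)
    then show "eventually (\<lambda>t. E t < y) at_top"
      by eventually_elim (use s energy_antimono[of s] in force)
  qed
  then show thesis using low by (rule that)
qed

lemma velocity_bounds:
  assumes bdd: "bounded (x ` {0..})"
  obtains B where "0 \<le> B" "\<And>t. 0 \<le> t \<Longrightarrow> norm (x t) \<le> B" "\<And>t. 0 \<le> t \<Longrightarrow> norm (v t) \<le> B"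
    "\<And>t. 0 \<le> t \<Longrightarrow> norm (grad (x t)) \<le> B" "\<And>t. 0 \<le> t \<Longrightarrow> norm (x' t) \<le> B"
    "\<And>t. 0 \<le> t \<Longrightarrow> norm (hess (x t)) \<le> B"
proof -
  obtain m where m: "\<And>u. m \<le> f u" using f_bdd unfolding bdd_below_def by blast
  obtain X where X: "\<And>t. 0 \<le> t \<Longrightarrow> norm (x t) \<le> X"
    using bdd unfolding bounded_iff by auto
  obtain L where L: "0 \<le> L" "\<And>u. u \<in> cball 0 X \<Longrightarrow> norm (hess u) \<le> L" using hess_bounded by blast
  have "bounded (grad ` cball 0 X)"
    by (intro compact_imp_bounded compact_continuous_image continuous_on_grad) auto
  then obtain G where G: "\<forall>y\<in>grad ` cball 0 X. norm y \<le> G" unfolding bounded_iff by blast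
  have G: "norm (grad (x t)) \<le> G" if "0 \<le> t" for t using G X[OF that] by simp
  \<comment> \<open>The energy bounds the square of \<open>norm (v t)\<close>; the inequality
    \<open>norm (v t) \<le> 1 + norm (v t) ^ 2\<close> yields a bound without a root.\<close>
  define V where "V = 1 + 2 * (E 0 - m)"
  have V: "norm (v t) \<le> V" if "0 \<le> t" for t
  proof -
    have "(norm (v t))\<^sup>2 \<le> 2 * (E 0 - m)"
      using energy_antimono[OF order_refl that] m[of "x t"] unfolding E_def by (simp add: field_simps)
    moreover have "norm (v t) \<le> 1 + (norm (v t))\<^sup>2"
    proof -
      have "2 * norm (v t) \<le> 1 + (norm (v t))\<^sup>2" using sum_squares_bound[of "norm (v t)" 1] by simp
      then show ?thesis using norm_ge_zero[of "v t"] by linarith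
    qed
    ultimately show ?thesis unfolding V_def by linarith
  qed
  have X': "norm (x' t) \<le> V + \<beta> * G" if "0 \<le> t" for t
  proof -
    have "norm (x' t) \<le> norm (v t) + norm (\<beta> *\<^sub>R grad (x t))"
      using norm_triangle_ineq4[of "v t" "\<beta> *\<^sub>R grad (x t)"] unfolding v_def by simp
    also have "\<dots> \<le> V + \<beta> * G"
      using V[OF that] G[OF that] beta_pos by (simp add: add_mono mult_left_mono)
    finally show ?thesis .
  qed
  have nn: "0 \<le> X" "0 \<le> V" "0 \<le> G"
    using order_trans[OF norm_ge_zero X[of 0]] order_trans[OF norm_ge_zero V[of 0]] order_trans[OF norm_ge_zero G[of 0]] by auto
  have nn': "0 \<le> \<beta> * G" using beta_pos nn by simp
  show thesis
  proof (rule that[of "X + V + G + (V + \<beta> * G) + L"])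
    fix t :: real assume t: "0 \<le> t"
    have "norm (hess (x t)) \<le> L" using L(2)[of "x t"] X[OF t] by simp
    then show "norm (hess (x t)) \<le> X + V + G + (V + \<beta> * G) + L" using nn nn' L(1) by linarith
  qed (use nn nn' L(1) X V G X' in \<open>(linarith | smt (verit, best))+\<close>)
qed

text \<open>If \<open>h t\<close> were at least \<open>e\<close>, the bound \<open>M\<close> on its
  slope would keep it at or above \<open>e / 2\<close> for a time
  \<open>\<tau> = e / (2 * M)\<close>, and the energy would drop by at least
  \<open>\<delta> * \<tau> * e / 2\<close>. Eventually less than that remains above the limit of the
  energy.\<close>

lemma h_tendsto_zero:
  assumes bdd: "bounded (x ` {0..})"
  shows "(h \<longlongrightarrow> 0) at_top"
proof -
  obtain B where B: "0 \<le> B" "\<And>t. 0 \<le> t \<Longrightarrow> norm (grad (x t)) \<le> B" "\<And>t. 0 \<le> t \<Longrightarrow> norm (x' t) \<le> B"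
    "\<And>t. 0 \<le> t \<Longrightarrow> norm (hess (x t)) \<le> B"
    using velocity_bounds[OF bdd] by metis
  have C: "0 < C" using c_pos c_le_C by linarith
  \<comment> \<open>\<open>A\<close> bounds the acceleration, as read off from the equation;
    \<open>M\<close> bounds the derivative of \<open>h\<close>, with 1 added to make it
    positive.\<close>
  define A where "A = C * B + \<beta> * (B * B) + B"
  define M where "M = 2 * (B * A) + 2 * (B * (B * B)) + 1"
  have A: "0 \<le> A" unfolding A_def using B(1) C beta_pos by simp
  have M: "0 < M" unfolding M_def using A B(1) by (simp add: add_nonneg_pos)
  have hx': "norm (blinfun_apply (hess (x t)) (x' t)) \<le> B * B" if "0 \<le> t" for t
    by (rule order_trans[OF norm_blinfun mult_mono]) (use B that in auto)
  have slope: "h t - M * (s - t) \<le> h s" if st: "0 < t" "t \<le> s" for s t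
  proof -
    have "h t - M * (s - t) - h t \<le> h s - h t"
    proof -
      have "\<exists>y. ((\<lambda>r. h r + M * r) has_real_derivative y) (at r) \<and> 0 \<le> y" if "t \<le> r" "r \<le> s" for r
      proof -
        have r: "0 < r" using st that by simp
        let ?g = "blinfun_apply (hess (x r)) (x' r)"
        have "x'' r = - (\<gamma> r *\<^sub>R x' r + \<beta> *\<^sub>R ?g + grad (x r))"
          unfolding eq_neg_iff_add_eq_0 using ode[OF r] by (simp add: add.assoc)
        then have "norm (x'' r) \<le> norm (\<gamma> r *\<^sub>R x' r) + norm (\<beta> *\<^sub>R ?g) + norm (grad (x r))"
          by (smt (verit) norm_minus_cancel norm_triangle_ineq)
        also have "\<dots> \<le> A"
          unfolding A_def norm_scaleR using gamma_bounds[of r] c_pos r B hx'[of r] beta_pos C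
          by (intro add_mono mult_mono) auto
        finally have x'': "norm (x'' r) \<le> A" .
        have "((\<lambda>t. x' t \<bullet> x' t) has_derivative (\<lambda>k. x' r \<bullet> (k *\<^sub>R x'' r) + (k *\<^sub>R x'' r) \<bullet> x' r)) (at r)"
          by (rule has_derivative_inner[OF dx'_at[OF r, unfolded has_vector_derivative_def] dx'_at[OF r, unfolded has_vector_derivative_def]])
        moreover note dg = has_vector_derivative_grad[OF dx_at[OF r], unfolded has_vector_derivative_def]
        have "((\<lambda>t. grad (x t) \<bullet> grad (x t)) has_derivative (\<lambda>k. grad (x r) \<bullet> (k *\<^sub>R ?g) + (k *\<^sub>R ?g) \<bullet> grad (x r))) (at r)"
          by (rule has_derivative_inner[OF dg dg])
        ultimately have "(h has_derivative (\<lambda>k. (x' r \<bullet> (k *\<^sub>R x'' r) + (k *\<^sub>R x'' r) \<bullet> x' r) +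
            (grad (x r) \<bullet> (k *\<^sub>R ?g) + (k *\<^sub>R ?g) \<bullet> grad (x r)))) (at r)"
          unfolding h_def[abs_def] power2_norm_eq_inner by (rule has_derivative_add)
        then have "(h has_real_derivative 2 * (x' r \<bullet> x'' r) + 2 * (grad (x r) \<bullet> ?g)) (at r)"
          unfolding has_field_derivative_def by (rule has_derivative_eq_rhs) (auto simp: fun_eq_iff inner_commute algebra_simps)
        then have dM: "((\<lambda>r. h r + M * r) has_real_derivative (2 * (x' r \<bullet> x'' r) + 2 * (grad (x r) \<bullet> ?g)) + M * 1) (at r)"
          by (intro DERIV_add DERIV_cmult DERIV_ident)
        have "\<bar>x' r \<bullet> x'' r\<bar> \<le> B * A"
          by (rule order_trans[OF Cauchy_Schwarz_ineq2 mult_mono]) (use B r x'' in auto)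
        moreover have "\<bar>grad (x r) \<bullet> ?g\<bar> \<le> B * (B * B)"
          by (rule order_trans[OF Cauchy_Schwarz_ineq2 mult_mono]) (use B r hx'[of r] in auto)
        ultimately have "0 \<le> (2 * (x' r \<bullet> x'' r) + 2 * (grad (x r) \<bullet> ?g)) + M * 1" unfolding M_def by (simp add: abs_le_iff)
        with dM show ?thesis by blast
      qed
      then have "h t + M * t \<le> h s + M * s"
        by (intro DERIV_nonneg_imp_nondecreasing[OF st(2), of "\<lambda>r. h r + M * r"]) blast
      then show ?thesis by (simp add: algebra_simps)
    qed
    then show ?thesis by simp
  qed
  obtain Einf where Einf: "(E \<longlongrightarrow> Einf) at_top" "\<And>t. 0 \<le> t \<Longrightarrow> Einf \<le> E t" using energy_converges by blast
  show ?thesis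
  proof (rule tendstoI)
    fix e :: real assume e: "0 < e"
    define \<tau> where "\<tau> = e / (2 * M)"
    have \<tau>: "0 < \<tau>" "M * \<tau> = e / 2" unfolding \<tau>_def using e M by auto
    have "eventually (\<lambda>t. E t < Einf + \<delta> * (\<tau> * (e / 2))) at_top"
      by (rule order_tendstoD(2)[OF Einf(1)]) (use delta_pos \<tau> e in simp)
    moreover have "eventually (\<lambda>t::real. 0 < t) at_top" by (rule eventually_gt_at_top)
    ultimately show "eventually (\<lambda>t. dist (h t) 0 < e) at_top"
    proof eventually_elim
      case (elim t)
      have "(h t - M * \<tau>) * \<tau> = integral {t..t + \<tau>} (\<lambda>s. h t - M * \<tau>)" using \<tau> by simp
      also have "\<dots> \<le> integral {t..t + \<tau>} h"
      proof (rule integral_le)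
        show "h integrable_on {t..t + \<tau>}"
          using elim by (intro integrable_continuous_real continuous_on_subset[OF ch]) auto
        fix s assume s: "s \<in> {t..t + \<tau>}"
        then have "M * (s - t) \<le> M * \<tau>" using M by (intro mult_left_mono) auto
        then show "h t - M * \<tau> \<le> h s" using slope[of t s] elim s by auto
      qed (simp add: integrable_const_ivl)
      finally have "\<delta> * ((h t - M * \<tau>) * \<tau>) \<le> \<delta> * integral {t..t + \<tau>} h"
        using delta_pos by (intro mult_left_mono) auto
      also have "\<dots> \<le> E t - E (t + \<tau>)" using energy_decrease[of t "t + \<tau>"] elim \<tau> by simp
      also have "\<dots> < \<delta> * (\<tau> * (e / 2))" using elim Einf(2)[of "t + \<tau>"] \<tau> by simp
      finally have "(h t - M * \<tau>) * \<tau> < (e / 2) * \<tau>" using delta_pos by (simp add: mult.commute)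
      then have "h t - M * \<tau> < e / 2" using \<tau>(1) by simp
      then show "dist (h t) 0 < e" using \<tau>(2) h_nonneg[of t] by simp
    qed
  qed
qed

text \<open>\<open>h\<close> dominates both squares, and \<open>f (x t)\<close> differs from the
  convergent energy by half the square of \<open>norm (v t)\<close>, which tends to 0.\<close>

lemma convergence_of_values:
  assumes bdd: "bounded (x ` {0..})"
  shows "((\<lambda>t. norm (grad (x t))) \<longlongrightarrow> 0) at_top" "((\<lambda>t. norm (x' t)) \<longlongrightarrow> 0) at_top"
    "\<exists>L. ((\<lambda>t. f (x t)) \<longlongrightarrow> L) at_top"
proof -
  have sq: "(u \<longlongrightarrow> 0) at_top" if u: "\<And>t. 0 \<le> u t" "\<And>t. (u t)\<^sup>2 \<le> h t" for u :: "real \<Rightarrow> real"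
  proof -
    have "((\<lambda>t. sqrt (h t)) \<longlongrightarrow> sqrt 0) at_top"
      by (intro tendsto_real_sqrt h_tendsto_zero bdd)
    then have "((\<lambda>t. sqrt (h t)) \<longlongrightarrow> 0) at_top" by simp
    moreover have "eventually (\<lambda>t. norm (u t) \<le> sqrt (h t)) at_top"
      using u real_le_rsqrt by (intro always_eventually) auto
    ultimately show ?thesis by (rule Lim_null_comparison[rotated])
  qed
  show 1: "((\<lambda>t. norm (grad (x t))) \<longlongrightarrow> 0) at_top" and 2: "((\<lambda>t. norm (x' t)) \<longlongrightarrow> 0) at_top"
    by (rule sq; simp add: h_def)+
  have "(v \<longlongrightarrow> 0 + \<beta> *\<^sub>R 0) at_top"
    unfolding v_def by (intro tendsto_intros tendsto_norm_zero_cancel[OF 1] tendsto_norm_zero_cancel[OF 2])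
  then have v: "((\<lambda>t. (norm (v t))\<^sup>2 / 2) \<longlongrightarrow> (norm (0::'a))\<^sup>2 / 2) at_top"
    by (intro tendsto_intros) auto
  obtain Einf where "(E \<longlongrightarrow> Einf) at_top" using energy_converges by blast
  from tendsto_diff[OF this v] show "\<exists>L. ((\<lambda>t. f (x t)) \<longlongrightarrow> L) at_top"
    unfolding E_def by auto
qed

end

section \<open>Convergence in the definable case\<close>

lemma has_real_derivative_eventually_le:
  fixes g :: "real \<Rightarrow> real"
  assumes "(g has_real_derivative d) (at t)" "d < q"
  shows "eventually (\<lambda>s. g s - g t \<le> q * (s - t)) (at_right t)"
proof -
  have "((\<lambda>s. (g s - g t) / (s - t)) \<longlongrightarrow> d) (at t)"
    using assms(1) unfolding has_field_derivative_iff .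
  then have "((\<lambda>s. (g s - g t) / (s - t)) \<longlongrightarrow> d) (at_right t)"
    by (rule tendsto_within_subset) auto
  then have "eventually (\<lambda>s. (g s - g t) / (s - t) < q) (at_right t)"
    using assms(2) by (rule order_tendstoD)
  moreover have "eventually (\<lambda>s. t < s) (at_right t)" by (rule eventually_at_right_less)
  ultimately show ?thesis
    by eventually_elim (simp add: pos_divide_less_eq)
qed

text \<open>Mean value inequality on the segment, with the slope at any of its points estimated by
  the slope at \<open>p\<close>: the Kurdyka-Lojasiewicz argument controls the slope at one endpoint
  only.\<close>

lemma gradient_increment_bound:
  fixes E :: "'b::euclidean_space \<Rightarrow> real"
  assumes "convex K" and der: "\<And>p. (E has_derivative (\<lambda>h. G p \<bullet> h)) (at p)" and L: "0 \<le> L"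
    and lip: "\<And>p q. p \<in> K \<Longrightarrow> q \<in> K \<Longrightarrow> norm (G p - G q) \<le> L * norm (p - q)"
    and pq: "p \<in> K" "q \<in> K"
  shows "\<bar>E q - E p\<bar> \<le> (norm (G p) + L * norm (q - p)) * norm (q - p)"
proof -
  have seg: "closed_segment p q \<subseteq> K" using pq \<open>convex K\<close> by (simp add: closed_segment_subset)
  have "norm (E q - E p) \<le> (norm (G p) + L * norm (q - p)) * norm (q - p)"
  proof (rule differentiable_bound[of "closed_segment p q" E "\<lambda>u h. G u \<bullet> h"])
    fix u assume u: "u \<in> closed_segment p q"
    show "(E has_derivative (\<lambda>h. G u \<bullet> h)) (at u within closed_segment p q)"
      by (rule has_derivative_at_withinI[OF der])
    have "norm (G u) \<le> norm (G p) + norm (G u - G p)" using norm_triangle_sub by blast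
    also have "\<dots> \<le> norm (G p) + L * norm (u - p)" using lip[of u p] seg u pq by auto
    also have "\<dots> \<le> norm (G p) + L * norm (q - p)"
      using segment_bound(1)[OF u] L by (intro add_left_mono mult_left_mono)
    finally have Gu: "norm (G u) \<le> norm (G p) + L * norm (q - p)" .
    show "onorm (\<lambda>h. G u \<bullet> h) \<le> norm (G p) + L * norm (q - p)"
    proof (rule onorm_le)
      fix h
      have "norm (G u \<bullet> h) \<le> norm (G u) * norm h" using Cauchy_Schwarz_ineq2[of "G u" h] by simp
      also have "\<dots> \<le> (norm (G p) + L * norm (q - p)) * norm h" by (intro mult_right_mono Gu) simp
      finally show "norm (G u \<bullet> h) \<le> (norm (G p) + L * norm (q - p)) * norm h" .
    qed
  qed auto
  then show ?thesis by simp
qed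

context isehd_system
begin

text \<open>The scalar \<open>w\<close> stands for the norm of \<open>v\<close>, through which alone
  the energy depends on \<open>v\<close>. On the product space the gradient is
  \<open>(grad y, w)\<close>; its Lipschitz constant on a box is \<open>L1 + 1\<close>, the 1 coming
  from the identity in the scalar component.\<close>

lemma kurdyka_lojasiewicz_augmented:
  assumes "definable_fun f"
  shows "\<exists>L \<epsilon> \<phi>. 0 \<le> L \<and> 0 < \<epsilon> \<and> continuous_on {0<..<\<epsilon>} \<phi> \<and> mono_on {0<..<\<epsilon>} \<phi> \<and> bounded (\<phi> ` {0<..<\<epsilon>}) \<and>
    (\<forall>y w r r'. norm y \<le> B \<longrightarrow> norm w \<le> B \<longrightarrow> r \<in> {0<..<\<epsilon>} \<longrightarrow> r' \<in> {0<..<\<epsilon>} \<longrightarrow> f y + w\<^sup>2 / 2 = es + r \<longrightarrow>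
       \<bar>r - r'\<bar> \<le> (norm (grad y, w) + L * \<bar>\<phi> r - \<phi> r'\<bar>) * \<bar>\<phi> r - \<phi> r'\<bar>)"
proof -
  obtain S bs where S: "o_minimal_structure S" "distinct bs" "set bs = (Basis :: 'a set)"
    "{map (\<lambda>b. x \<bullet> b) bs @ [f x] |x. True} \<in> S (Suc (length bs))"
    using assms unfolding definable_fun_def by blast
  interpret o_minimal S by standard (rule S(1))
  define E where "E p = f (fst p) + (snd p)\<^sup>2 / 2" for p :: "'a \<times> real"
  define G where "G p = (grad (fst p), snd p)" for p :: "'a \<times> real"
  have dE: "definable_term (\<lambda>e. E (h e))" if h: "definable_vector h" for h
  proof -
    have "definable_vector (\<lambda>e. fst (h e))"
      unfolding definable_vector_def
    proof
      fix b :: 'a assume "b \<in> Basis"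
      then have "definable_term (\<lambda>e. h e \<bullet> (b, 0))" using h unfolding definable_vector_def by (auto simp: Basis_prod_def)
      then show "definable_term (\<lambda>e. fst (h e) \<bullet> b)" by (simp add: inner_prod_def)
    qed
    from term_graph[OF S(2-4) this] have "definable_term (\<lambda>e. f (fst (h e)))" .
    moreover have "definable_term (\<lambda>e. h e \<bullet> (0, 1))" using h unfolding definable_vector_def by (auto simp: Basis_prod_def)
    then have "definable_term (\<lambda>e. snd (h e))" by (simp add: inner_prod_def)
    ultimately have "definable_term (\<lambda>e. f (fst (h e)) + (1 / 2) * (snd (h e))\<^sup>2)"
      by (intro term_add term_mult term_power2 term_const)
    then show ?thesis unfolding E_def by simp
  qed
  have der: "(E has_derivative (\<lambda>h. G p \<bullet> h)) (at p)" for p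
  proof -
    have "((\<lambda>p::'a \<times> real. f (fst p)) has_derivative (\<lambda>h. grad (fst p) \<bullet> fst h)) (at p)"
      by (rule has_derivative_compose[OF has_derivative_fst[OF has_derivative_ident] f_grad])
    moreover have "((\<lambda>p::'a \<times> real. (snd p)\<^sup>2 / 2) has_derivative (\<lambda>h. snd p * snd h)) (at p)"
      by (auto intro!: derivative_eq_intros)
    ultimately have "(E has_derivative (\<lambda>h. grad (fst p) \<bullet> fst h + snd p * snd h)) (at p)"
      unfolding E_def[abs_def] by (rule has_derivative_add)
    then show ?thesis unfolding G_def by (simp add: inner_prod_def)
  qed
  have "bounded (cball (0::'a) B \<times> cball (0::real) B)" by (intro bounded_Times) auto
  then obtain a where a: "cball (0::'a) B \<times> cball (0::real) B \<subseteq> cbox (- a) a"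
    using bounded_subset_cbox_symmetric by blast
  obtain \<rho> where \<rho>: "\<And>p. p \<in> cbox (- a) a \<Longrightarrow> norm p \<le> \<rho>"
    using bounded_cbox[of "- a" a] unfolding bounded_iff by blast
  obtain L1 where L1: "0 \<le> L1" "\<And>x y. x \<in> cball 0 \<rho> \<Longrightarrow> y \<in> cball 0 \<rho> \<Longrightarrow> norm (grad x - grad y) \<le> L1 * norm (x - y)"
    using grad_lipschitz by blast
  have nf: "norm (fst p) \<le> norm p" and ns: "norm (snd p) \<le> norm p" for p :: "'a \<times> real"
    using norm_fst_le[of "fst p" "snd p"] norm_snd_le[of "snd p" "fst p"] unfolding prod.collapse by auto
  have lip: "norm (G p - G q) \<le> (L1 + 1) * norm (p - q)" if "p \<in> cbox (- a) a" "q \<in> cbox (- a) a" for p q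
  proof -
    have "norm (G p - G q) \<le> norm (grad (fst p) - grad (fst q)) + norm (snd p - snd q)"
      using norm_Pair_le[of "grad (fst p) - grad (fst q)" "snd p - snd q"] unfolding G_def by simp
    also have "\<dots> \<le> L1 * norm (fst (p - q)) + norm (snd (p - q))"
      using L1(2)[of "fst p" "fst q"] order_trans[OF nf \<rho>[OF that(1)]] order_trans[OF nf \<rho>[OF that(2)]] by simp
    also have "\<dots> \<le> L1 * norm (p - q) + norm (p - q)"
      by (intro add_mono mult_left_mono nf ns L1)
    finally show ?thesis by (simp add: algebra_simps)
  qed
  have cG: "continuous_on (cbox (- a) a) G"
    unfolding G_def by (intro continuous_intros continuous_on_compose2[OF continuous_on_grad[of UNIV]]) auto
  have L: "0 \<le> L1 + 1" using L1(1) by simp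
  have inc: "\<bar>E q - E p\<bar> \<le> (norm (G p) + (L1 + 1) * norm (q - p)) * norm (q - p)"
    if "p \<in> cbox (- a) a" "q \<in> cbox (- a) a" for p q
    by (rule gradient_increment_bound[OF convex_box(1) der L lip that])
  obtain \<epsilon> \<phi> where \<phi>: "\<epsilon> > 0" "continuous_on {0<..<\<epsilon>} \<phi>" "mono_on {0<..<\<epsilon>} \<phi>" "bounded (\<phi> ` {0<..<\<epsilon>})"
    and kl: "\<forall>p\<in>cbox (- a) a. \<forall>r\<in>{0<..<\<epsilon>}. \<forall>r'\<in>{0<..<\<epsilon>}. E p = es + r \<longrightarrow>
        \<bar>r - r'\<bar> \<le> (norm (G p) + (L1 + 1) * \<bar>\<phi> r - \<phi> r'\<bar>) * \<bar>\<phi> r - \<phi> r'\<bar>"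
    using kurdyka_lojasiewicz[OF dE der cG L inc, of es] by blast
  show ?thesis
  proof (rule exI[of _ "L1 + 1"], rule exI[of _ \<epsilon>], rule exI[of _ \<phi>], intro conjI allI impI)
    fix y w r r' assume "norm y \<le> B" "norm w \<le> B" "r \<in> {0<..<\<epsilon>}" "r' \<in> {0<..<\<epsilon>}" "f y + w\<^sup>2 / 2 = es + r"
    moreover from this have "(y, w) \<in> cbox (- a) a" using a by auto
    ultimately show "\<bar>r - r'\<bar> \<le> (norm (grad y, w) + (L1 + 1) * \<bar>\<phi> r - \<phi> r'\<bar>) * \<bar>\<phi> r - \<phi> r'\<bar>"
      using kl[rule_format, of "(y, w)" r r'] unfolding E_def G_def by simp
  qed (use L \<phi> in auto)
qed

end

context isehd_trajectory
begin

lemma finite_length: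
  assumes bdd: "bounded (x ` {0..})" and "definable_fun f"
  shows "\<exists>Y. \<forall>t\<ge>0. integral {0..t} (\<lambda>s. norm (x' s)) \<le> Y"
proof -
  obtain B where B: "\<And>t. 0 \<le> t \<Longrightarrow> norm (x t) \<le> B" "\<And>t. 0 \<le> t \<Longrightarrow> norm (v t) \<le> B"
    using velocity_bounds[OF bdd] by metis
  obtain Einf where Einf: "(E \<longlongrightarrow> Einf) at_top" "\<And>t. 0 \<le> t \<Longrightarrow> Einf \<le> E t" using energy_converges by blast
  define y where "y t = integral {0..t} (\<lambda>s. norm (x' s))" for t
  have cn: "continuous_on {0..} (\<lambda>s. norm (x' s))" by (intro continuous_intros cx')
  have dy: "(y has_vector_derivative norm (x' t)) (at t within {0..})" if "0 \<le> t" for t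
    unfolding y_def by (rule has_vector_derivative_integral_half_line[OF cn that])
  have dy_at: "(y has_real_derivative norm (x' t)) (at t)" if "0 < t" for t
    using dy[of t] that at_within_half_line_pos[OF that] by (simp add: has_real_derivative_iff_has_vector_derivative)
  have cy: "continuous_on {0..} y" by (rule continuous_on_half_line_derivative[OF dy])
  have y_mono: "y s \<le> y t" if "0 \<le> s" "s \<le> t" for s t
  proof (rule DERIV_nonneg_imp_increasing_open[OF that(2)])
    show "continuous_on {s..t} y" using that by (intro continuous_on_subset[OF cy]) auto
    show "\<exists>d. (y has_real_derivative d) (at u) \<and> 0 \<le> d" if "s < u" "u < t" for u
      using dy_at[of u] \<open>0 \<le> s\<close> that by (intro exI[of _ "norm (x' u)"]) auto
  qed
  show ?thesis
  proof (cases "\<exists>t1\<ge>0. E t1 = Einf")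
    \<comment> \<open>If the energy attains its limit, the inequality, which concerns levels
      \<open>r > 0\<close>, says nothing; but then dissipation stops, and with it the
      motion.\<close>
    case True
    then obtain t1 where t1: "0 \<le> t1" "E t1 = Einf" by blast
    have const: "E t = Einf" if "t1 \<le> t" for t
      using energy_antimono[OF t1(1) that] Einf(2)[of t] t1 that by simp
    have x'0: "x' t = 0" if "t1 < t" for t
    proof -
      have "0 < t" using t1 that by simp
      then obtain e where e: "(E has_real_derivative e) (at t)" "e \<le> - \<delta> * h t"
        by (rule energy_dissipation)
      have "(E has_real_derivative 0) (at t)"
        by (rule has_field_derivative_transform_within_open[of "\<lambda>_. Einf" 0 t "{t1<..}"]) (use const that in auto)
      then have "\<delta> * h t \<le> 0" using DERIV_unique[OF e(1)] e(2) by simp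
      then have "h t \<le> 0" using delta_pos by (simp add: mult_le_0_iff)
      then show ?thesis unfolding h_def by (simp add: sum_power2_le_zero_iff)
    qed
    have after: "y t \<le> y t1" if "t1 \<le> t" for t
    proof (rule DERIV_nonpos_imp_decreasing_open[OF that])
      show "continuous_on {t1..t} y" using t1 by (intro continuous_on_subset[OF cy]) auto
      show "\<exists>d. (y has_real_derivative d) (at u) \<and> d \<le> 0" if "t1 < u" "u < t" for u
        using dy_at[of u] x'0[OF that(1)] t1 that by (intro exI[of _ 0]) simp
    qed
    have "y t \<le> y t1" if "0 \<le> t" for t
      using y_mono[OF that, of t1] after[of t] by (cases "t \<le> t1") simp_all
    then show ?thesis unfolding y_def by blast
  next
    case False
    then have pos: "Einf < E t" if "0 \<le> t" for t using Einf(2)[OF that] that by force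
    obtain L \<epsilon> \<phi> where L: "0 \<le> L" and \<epsilon>: "0 < \<epsilon>" and c\<phi>: "continuous_on {0<..<\<epsilon>} \<phi>"
      and m\<phi>: "mono_on {0<..<\<epsilon>} \<phi>" and b\<phi>: "bounded (\<phi> ` {0<..<\<epsilon>})"
      and kl: "\<And>y w r r'. norm y \<le> B \<Longrightarrow> norm w \<le> B \<Longrightarrow> r \<in> {0<..<\<epsilon>} \<Longrightarrow> r' \<in> {0<..<\<epsilon>} \<Longrightarrow> f y + w\<^sup>2 / 2 = Einf + r \<Longrightarrow>
         \<bar>r - r'\<bar> \<le> (norm (grad y, w) + L * \<bar>\<phi> r - \<phi> r'\<bar>) * \<bar>\<phi> r - \<phi> r'\<bar>"
      using kurdyka_lojasiewicz_augmented[OF assms(2), of B Einf] by blast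
    obtain P where "\<forall>u\<in>\<phi> ` {0<..<\<epsilon>}. norm u \<le> P" using b\<phi> unfolding bounded_iff by blast
    then have P: "\<bar>\<phi> r\<bar> \<le> P" if "r \<in> {0<..<\<epsilon>}" for r using that by simp
    have "eventually (\<lambda>t. E t < Einf + \<epsilon>) at_top" by (rule order_tendstoD(2)[OF Einf(1)]) (use \<epsilon> in simp)
    moreover have "eventually (\<lambda>t::real. 0 < t) at_top" by (rule eventually_gt_at_top)
    ultimately have "eventually (\<lambda>t. E t < Einf + \<epsilon> \<and> 0 < t) at_top" by (rule eventually_conj)
    then obtain t0 where t0: "0 < t0" "E t0 < Einf + \<epsilon>"
      using eventually_happens'[OF trivial_limit_at_top_linorder] by blast
    define r where "r t = E t - Einf" for t
    have r: "r t \<in> {0<..<\<epsilon>}" if "t0 \<le> t" for t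
      using pos[of t] energy_antimono[of t0 t] t0 that unfolding r_def by auto
    have r_anti: "r s \<le> r t" if "t0 \<le> t" "t \<le> s" for s t
      using energy_antimono[of t s] t0 that unfolding r_def by auto
    have cr: "continuous_on {t0..} (\<lambda>t. \<phi> (r t))"
      by (rule continuous_on_compose2[OF c\<phi>])
        (use r t0 in \<open>auto simp: r_def intro!: continuous_intros continuous_on_subset[OF cE]\<close>)
    \<comment> \<open>Put \<open>\<Sigma> = norm (x' t) + norm (grad (x t))\<close>. As
      \<open>\<Sigma>^2 \<le> 2 * h t\<close>, the energy decays at rate at least
      \<open>\<delta> / 2 * \<Sigma>^2\<close>, half of which is given up for a strict inequality.
      In \<open>2 + \<beta>\<close>, the slope of the augmented function accounts for
      \<open>1 + \<beta>\<close> and the second-order error for 1.\<close>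
    define \<kappa> where "\<kappa> = (\<delta> / 4) / (2 + \<beta>)"
    have \<kappa>: "0 < \<kappa>" unfolding \<kappa>_def using delta_pos beta_pos by simp
    have decay: "eventually (\<lambda>s. \<phi> (r s) + \<kappa> * norm (x' t) * (s - t) \<le> \<phi> (r t)) (at_right t)" if t: "t0 \<le> t" for t
    proof -
      define \<Sigma> where "\<Sigma> = norm (x' t) + norm (grad (x t))"
      have \<Sigma>0: "0 \<le> \<Sigma>" unfolding \<Sigma>_def by simp
      have tpos: "0 < t" using t t0 by simp
      have right: "eventually (\<lambda>s. t < s) (at_right t)" by (rule eventually_at_right_less)
      have mono: "\<phi> (r s) \<le> \<phi> (r t)" if "t < s" for s
        using mono_onD[OF m\<phi> r[of s] r[OF t] r_anti[OF t, of s]] t that by auto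
      show ?thesis
      proof (cases "\<Sigma> = 0")
        \<comment> \<open>Division by \<open>\<Sigma>\<close> is impossible here, but
          \<open>x' t = 0\<close> reduces the claim to monotonicity.\<close>
        case True
        then have "x' t = 0" unfolding \<Sigma>_def by (simp add: add_nonneg_eq_0_iff)
        then show ?thesis using right by (auto elim: eventually_mono simp: mono)
      next
        case False
        then have \<Sigma>: "0 < \<Sigma>" using \<Sigma>0 by simp
        obtain e where e: "(E has_real_derivative e) (at t)" "e \<le> - \<delta> * h t" using energy_dissipation[OF tpos] .
        have "\<Sigma>\<^sup>2 \<le> 2 * h t"
          using sum_squares_bound[of "norm (x' t)" "norm (grad (x t))"] unfolding \<Sigma>_def h_def by (simp add: power2_sum)
        then have "\<delta> * \<Sigma>\<^sup>2 \<le> \<delta> * (2 * h t)" using delta_pos by (intro mult_left_mono) auto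
        moreover have "0 < \<delta> * \<Sigma>\<^sup>2" using delta_pos \<Sigma> by simp
        ultimately have "e < - (\<delta> / 4 * \<Sigma>\<^sup>2)" using e(2) by (simp add: field_simps)
        from has_real_derivative_eventually_le[OF e(1) this]
        have E1: "eventually (\<lambda>s. E s - E t \<le> - (\<delta> / 4 * \<Sigma>\<^sup>2) * (s - t)) (at_right t)" .
        have "((\<lambda>s. \<phi> (r s)) \<longlongrightarrow> \<phi> (r t)) (at t within {t0..})"
          using cr t unfolding continuous_on_def by simp
        then have "((\<lambda>s. \<phi> (r s)) \<longlongrightarrow> \<phi> (r t)) (at_right t)"
          by (rule tendsto_within_subset) (use t in auto)
        then have "((\<lambda>s. L * (\<phi> (r t) - \<phi> (r s))) \<longlongrightarrow> L * (\<phi> (r t) - \<phi> (r t))) (at_right t)"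
          by (intro tendsto_intros)
        \<comment> \<open>Continuity of \<open>\<phi>\<close> along the trajectory makes the
          second-order error factor smaller than \<open>\<Sigma>\<close> for \<open>s\<close> close
          to \<open>t\<close>.\<close>
        then have E2: "eventually (\<lambda>s. L * (\<phi> (r t) - \<phi> (r s)) < \<Sigma>) (at_right t)"
          by (rule order_tendstoD) (use \<Sigma> in simp)
        show ?thesis
          using E1 E2 right
        proof eventually_elim
          case (elim s)
          define \<Delta> where "\<Delta> = \<phi> (r t) - \<phi> (r s)"
          have \<Delta>: "0 \<le> \<Delta>" unfolding \<Delta>_def using mono elim by simp
          have "norm (grad (x t), norm (v t)) \<le> norm (grad (x t)) + norm (v t)"
            using norm_Pair_le[of "grad (x t)" "norm (v t)"] by simp
          also have "\<dots> \<le> norm (grad (x t)) + (norm (x' t) + \<beta> * norm (grad (x t)))"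
            using norm_triangle_ineq[of "x' t" "\<beta> *\<^sub>R grad (x t)"] beta_pos unfolding v_def by simp
          also have "\<dots> \<le> (1 + \<beta>) * \<Sigma>"
            using beta_pos unfolding \<Sigma>_def by (simp add: algebra_simps)
          finally have G: "norm (grad (x t), norm (v t)) \<le> (1 + \<beta>) * \<Sigma>" .
          have "\<delta> / 4 * \<Sigma>\<^sup>2 * (s - t) \<le> r t - r s" using elim(1) unfolding r_def by simp
          also have "\<dots> \<le> (norm (grad (x t), norm (v t)) + L * \<Delta>) * \<Delta>"
          proof -
            have "f (x t) + (norm (v t))\<^sup>2 / 2 = Einf + r t" by (simp add: r_def E_def)
            moreover have "r s \<in> {0<..<\<epsilon>}" using r[of s] t elim(3) by simp
            moreover have "norm (norm (v t)) \<le> B" using B(2)[of t] tpos by simp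
            ultimately have "\<bar>r t - r s\<bar> \<le> (norm (grad (x t), norm (v t)) + L * \<bar>\<Delta>\<bar>) * \<bar>\<Delta>\<bar>"
              unfolding \<Delta>_def using kl[OF B(1)[of t] _ r[OF t]] tpos by simp
            then show ?thesis unfolding abs_of_nonneg[OF \<Delta>] by (rule order_trans[OF abs_ge_self])
          qed
          also have "\<dots> \<le> ((2 + \<beta>) * \<Sigma>) * \<Delta>"
            using G elim(2) \<Delta> unfolding \<Delta>_def[symmetric] by (intro mult_right_mono) (auto simp: algebra_simps)
          finally have "\<Sigma> * (\<delta> / 4 * \<Sigma> * (s - t)) \<le> \<Sigma> * ((2 + \<beta>) * \<Delta>)"
            by (simp add: power2_eq_square mult_ac)
          then have "\<delta> / 4 * \<Sigma> * (s - t) \<le> (2 + \<beta>) * \<Delta>" using \<Sigma> by simp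
          then have "\<kappa> * \<Sigma> * (s - t) \<le> \<Delta>"
            unfolding \<kappa>_def using beta_pos by (simp add: field_simps)
          moreover have "\<kappa> * norm (x' t) * (s - t) \<le> \<kappa> * \<Sigma> * (s - t)"
            using \<kappa> elim unfolding \<Sigma>_def by (intro mult_right_mono mult_left_mono) auto
          ultimately show ?case unfolding \<Delta>_def by simp
        qed
      qed
    qed
    \<comment> \<open>\<open>\<phi> (r t) + \<kappa> * y t\<close> acts as a Lyapunov function; as
      \<open>\<phi>\<close> is bounded, so is the length \<open>y\<close>.\<close>
    have W: "\<phi> (r t) + \<kappa> * y t \<le> \<phi> (r t0) + \<kappa> * y t0" if "t0 \<le> t" for t
    proof (rule dini_nonincreasing[OF that, of "\<lambda>t. \<phi> (r t) + \<kappa> * y t"])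
      show "continuous_on {t0..t} (\<lambda>t. \<phi> (r t) + \<kappa> * y t)"
        using t0 by (intro continuous_intros continuous_on_subset[OF cr] continuous_on_subset[OF cy]) auto
      fix s \<eta> :: real assume s: "t0 \<le> s" "s < t" and \<eta>: "0 < \<eta>"
      have "eventually (\<lambda>u. y u - y s \<le> (norm (x' s) + \<eta> / \<kappa>) * (u - s)) (at_right s)"
        by (rule has_real_derivative_eventually_le[OF dy_at]) (use s t0 \<eta> \<kappa> in auto)
      with decay[OF s(1)]
      show "eventually (\<lambda>u. \<phi> (r u) + \<kappa> * y u \<le> \<phi> (r s) + \<kappa> * y s + \<eta> * (u - s)) (at_right s)"
      proof eventually_elim
        case (elim u)
        have "\<kappa> * (y u - y s) \<le> \<kappa> * ((norm (x' s) + \<eta> / \<kappa>) * (u - s))"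
          using elim(2) \<kappa> by (intro mult_left_mono) auto
        also have "\<dots> = \<kappa> * norm (x' s) * (u - s) + \<eta> * (u - s)" using \<kappa> by (simp add: field_simps)
        finally show ?case using elim(1) by (simp add: algebra_simps)
      qed
    qed
    have "y t \<le> y t0 + 2 * P / \<kappa>" if "0 \<le> t" for t
    proof (cases "t0 \<le> t")
      case True
      have "\<kappa> * y t \<le> \<kappa> * y t0 + 2 * P" using W[OF True] P[OF r[OF True]] P[OF r[OF order_refl]] by (simp add: abs_le_iff)
      then show ?thesis using \<kappa> by (simp add: field_simps)
    next
      case False
      have "0 \<le> P" using P[OF r[OF order_refl]] by (meson abs_ge_zero order_trans)
      then have "0 \<le> 2 * P / \<kappa>" using \<kappa> by simp
      then show ?thesis using y_mono[OF that, of t0] False by simp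
    qed
    then show ?thesis unfolding y_def by blast
  qed
qed

text \<open>The remaining length \<open>Yinf - y t\<close> bounds the distance from
  \<open>x t\<close> to the limit point. That point is critical because \<open>grad\<close> is
  continuous and tends to 0 along the trajectory.\<close>

lemma trajectory_converges:
  assumes bdd: "bounded (x ` {0..})" and "definable_fun f"
  shows "x' absolutely_integrable_on {0..}" "\<exists>z. (x \<longlongrightarrow> z) at_top \<and> grad z = 0"
proof -
  obtain Y where Y: "\<And>t. 0 \<le> t \<Longrightarrow> integral {0..t} (\<lambda>s. norm (x' s)) \<le> Y"
    using finite_length[OF assms] by blast
  have cn: "continuous_on {0..} (\<lambda>s. norm (x' s))" by (intro continuous_intros cx')
  have "(\<lambda>s. norm (x' s)) integrable_on {0..}"
    by (rule integrable_on_half_line[OF cn _ Y]) auto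
  then show "x' absolutely_integrable_on {0..}"
    by (intro measurable_bounded_by_integrable_imp_absolutely_integrable[where g = "\<lambda>s. norm (x' s)"]
        continuous_imp_measurable_on_sets_lebesgue cx') auto
  define y where "y t = integral {0..t} (\<lambda>s. norm (x' s))" for t
  have dy: "(y has_vector_derivative norm (x' t)) (at t within {0..})" if "0 \<le> t" for t
    unfolding y_def by (rule has_vector_derivative_integral_half_line[OF cn that])
  have cy: "continuous_on {0..} y" by (rule continuous_on_half_line_derivative[OF dy])
  have len: "norm (x t - x s) \<le> y t - y s" if "0 \<le> s" "s \<le> t" for s t
  proof (cases "s = t")
    case False
    then have st: "s < t" using that by simp
    show ?thesis
    proof (rule differentiable_bound_general[OF st, where f' = x' and \<phi>' = "\<lambda>t. norm (x' t)"])
      fix u assume "s < u" "u < t"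
      then have u: "0 < u" using that by simp
      show "(x has_vector_derivative x' u) (at u)" by (rule dx_at[OF u])
      show "(y has_vector_derivative norm (x' u)) (at u)"
        using dy[of u] u at_within_half_line_pos[OF u] by simp
    qed (use that in \<open>auto intro!: continuous_on_subset[OF cx] continuous_on_subset[OF cy]\<close>)
  qed simp
  define Yinf where "Yinf = Sup (y ` {0..})"
  have bddY: "bdd_above (y ` {0..})" using Y unfolding y_def by (auto intro!: bdd_aboveI[of _ Y])
  have le: "y t \<le> Yinf" if "0 \<le> t" for t
    unfolding Yinf_def by (rule cSup_upper[OF _ bddY]) (use that in auto)
  have "(y \<longlongrightarrow> Yinf) at_top"
  proof (rule increasing_tendsto)
    show "eventually (\<lambda>t. y t \<le> Yinf) at_top"
      by (rule eventually_mono[OF eventually_ge_at_top[of 0]]) (rule le)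
    fix a assume "a < Yinf"
    then obtain s where s: "0 \<le> s" "a < y s"
      using less_cSupD[of "y ` {0..}" a] unfolding Yinf_def by auto
    show "eventually (\<lambda>t. a < y t) at_top"
      using eventually_ge_at_top[of s]
    proof eventually_elim
      case (elim t)
      then show ?case using len[OF s(1) elim] s(2) norm_ge_zero[of "x t - x s"] by linarith
    qed
  qed
  then have y0: "((\<lambda>t. Yinf - y t) \<longlongrightarrow> 0) at_top" using tendsto_diff[OF tendsto_const, of y Yinf at_top Yinf] by simp
  \<comment> \<open>Completeness is applied along integer times; \<open>lim\<close> then transfers
    the limit to all times.\<close>
  have "Cauchy (\<lambda>n. x (real n))"
  proof (rule metric_CauchyI)
    fix e :: real assume "0 < e"
    then have "eventually (\<lambda>t. Yinf - y t < e) at_top" by (rule order_tendstoD(2)[OF y0])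
    then obtain T where T: "\<And>t. T \<le> t \<Longrightarrow> Yinf - y t < e" unfolding eventually_at_top_linorder by blast
    obtain N where N: "max T 0 \<le> real N" using real_arch_simple by blast
    have *: "dist (x (real m)) (x (real n)) < e" if "N \<le> m" "m \<le> n" for m n
    proof -
      have "dist (x (real m)) (x (real n)) \<le> y (real n) - y (real m)"
        using len[of "real m" "real n"] that by (simp add: dist_norm norm_minus_commute)
      also have "\<dots> \<le> Yinf - y (real m)" using le[of "real n"] by simp
      also have "\<dots> < e" using T[of "real m"] N that by simp
      finally show ?thesis .
    qed
    show "\<exists>M. \<forall>m\<ge>M. \<forall>n\<ge>M. dist (x (real m)) (x (real n)) < e"
    proof (intro exI[of _ N] allI impI)
      fix m n assume "N \<le> m" "N \<le> n"
      then show "dist (x (real m)) (x (real n)) < e"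
        using *[of m n] *[of n m] by (cases "m \<le> n") (auto simp: dist_commute)
    qed
  qed
  then have "convergent (\<lambda>n. x (real n))" by (rule Cauchy_convergent)
  then obtain z where z: "(\<lambda>n. x (real n)) \<longlonglongrightarrow> z" unfolding convergent_def by (elim exE)
  have lim: "norm (x t - z) \<le> Yinf - y t" if t: "0 \<le> t" for t
  proof (rule tendsto_upperbound)
    show "(\<lambda>n. norm (x t - x (real n))) \<longlonglongrightarrow> norm (x t - z)" by (intro tendsto_intros z)
    obtain N where N: "t \<le> real N" using real_arch_simple by blast
    show "eventually (\<lambda>n. norm (x t - x (real n)) \<le> Yinf - y t) sequentially"
      using eventually_ge_at_top[of N]
    proof eventually_elim
      case (elim n)
      then have tn: "t \<le> real n" using N by simp
      show ?case using len[OF t tn] le[of "real n"] by (simp add: norm_minus_commute)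
    qed
  qed simp
  have "eventually (\<lambda>t. norm (x t - z) \<le> Yinf - y t) at_top"
    by (rule eventually_mono[OF eventually_ge_at_top[of 0]]) (rule lim)
  then have "((\<lambda>t. x t - z) \<longlongrightarrow> 0) at_top" using y0 by (rule Lim_null_comparison)
  then have xz: "(x \<longlongrightarrow> z) at_top" by (simp add: LIM_zero_iff)
  have "isCont grad z" using grad_hess has_derivative_continuous by blast
  then have "((\<lambda>t. grad (x t)) \<longlongrightarrow> grad z) at_top" using xz by (rule isCont_tendsto_compose)
  moreover have "((\<lambda>t. grad (x t)) \<longlongrightarrow> 0) at_top"
    by (rule tendsto_norm_zero_cancel[OF convergence_of_values(1)[OF bdd]])
  ultimately have "grad z = 0" by (rule tendsto_unique[OF trivial_limit_at_top_linorder])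
  with xz show "\<exists>z. (x \<longlongrightarrow> z) at_top \<and> grad z = 0" by blast
qed

end

theorem mainTheorem1:
  fixes f :: "'a::euclidean_space \<Rightarrow> real"
    and grad :: "'a \<Rightarrow> 'a"
    and hess :: "'a \<Rightarrow> 'a \<Rightarrow>\<^sub>L 'a"
    and \<gamma> \<gamma>' :: "real \<Rightarrow> real"
    and c C \<beta> :: real
    and x0 v0 :: 'a
  assumes f_grad: "\<And>u. (f has_derivative (\<lambda>h. grad u \<bullet> h)) (at u)"
    and grad_hess: "\<And>u. (grad has_derivative blinfun_apply (hess u)) (at u)"
    and hess_cont: "continuous_on UNIV hess"
    and f_bdd: "bdd_below (range f)"
    and gamma_deriv: "\<And>t. t \<ge> 0 \<Longrightarrow> (\<gamma> has_real_derivative \<gamma>' t) (at t within {0..})"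
    and gamma'_cont: "continuous_on {0..} \<gamma>'"
    and c_pos: "0 < c" and c_le_C: "c \<le> C"
    and gamma_bounds: "\<And>t. t \<ge> 0 \<Longrightarrow> c \<le> \<gamma> t \<and> \<gamma> t \<le> C"
    and beta_pos: "0 < \<beta>" and beta_small: "\<beta> < 2 * c / C\<^sup>2"
  shows "(\<exists>x x' x''. isehd_solution grad hess \<gamma> \<beta> x0 v0 x x' x'')
    \<and> (\<forall>x x' x''. isehd_solution grad hess \<gamma> \<beta> x0 v0 x x' x'' \<longrightarrow>
         ((\<lambda>t. (norm (grad (x t)))\<^sup>2) integrable_on {0..}
          \<and> (\<lambda>t. (norm (x' t))\<^sup>2) integrable_on {0..})
       \<and> (bounded (x ` {0..}) \<longrightarrow>
            ((\<lambda>t. norm (grad (x t))) \<longlongrightarrow> 0) at_top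
          \<and> ((\<lambda>t. norm (x' t)) \<longlongrightarrow> 0) at_top
          \<and> (\<exists>L. ((\<lambda>t. f (x t)) \<longlongrightarrow> L) at_top))
       \<and> (bounded (x ` {0..}) \<and> definable_fun f \<longrightarrow>
            x' absolutely_integrable_on {0..}
          \<and> (\<exists>z. (x \<longlongrightarrow> z) at_top \<and> grad z = 0)))"
proof -
  have "continuous_on {0..} \<gamma>"
    by (rule DERIV_continuous_on) (use gamma_deriv in auto)
  then interpret isehd_system f grad hess \<gamma> c C \<beta>
    using assms by unfold_locales auto
  show ?thesis
  proof (intro conjI allI impI)
    show "\<exists>x x' x''. isehd_solution grad hess \<gamma> \<beta> x0 v0 x x' x''" by (rule isehd_solution_exists)
  next
    fix x x' x'' assume sol: "isehd_solution grad hess \<gamma> \<beta> x0 v0 x x' x''"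
    interpret isehd_trajectory f grad hess \<gamma> c C \<beta> x0 v0 x x' x''
      by unfold_locales (rule sol)
    show "(\<lambda>t. (norm (grad (x t)))\<^sup>2) integrable_on {0..}" "(\<lambda>t. (norm (x' t))\<^sup>2) integrable_on {0..}"
      by (rule square_integrable)+
    {
      assume "bounded (x ` {0..})"
      then show "((\<lambda>t. norm (grad (x t))) \<longlongrightarrow> 0) at_top" "((\<lambda>t. norm (x' t)) \<longlongrightarrow> 0) at_top"
        "\<exists>L. ((\<lambda>t. f (x t)) \<longlongrightarrow> L) at_top" by (rule convergence_of_values)+
    }
    {
      assume "bounded (x ` {0..}) \<and> definable_fun f"
      then show "x' absolutely_integrable_on {0..}" "\<exists>z. (x \<longlongrightarrow> z) at_top \<and> grad z = 0"
        using trajectory_converges by blast+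
    }
  qed
qed

end
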